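(* Assume the System Hypotheses, the Local Null-Controllability Hypotheses and the Running Cost Hypotheses (all stated in the context), and let $V_0,v_0$ and $V_\delta,v_\delta$ ($\delta\in(0,r]$) be the infinite-horizon and exit-time value functions and their Kruzhkov transforms defined in the context. Then: 1) the domain of asymptotic null-controllability can be represented as $$\mathcal D_0=\{x_0\in G:V_\delta(x_0)<+\infty\}=\{x_0\in G:v_\delta(x_0)<1\}\qquad\forall\delta\in[0,r];$$ 2) $v_\delta(x_0)\to v_0(x_0)$ uniformly on $G$ as $\delta\to+0$; 3) $V_\delta(x_0)\to V_0(x_0)$ uniformly on every compact subset of $\mathcal D_0$ as $\delta\to+0$; 4) for every $\delta\in(0,r]$, $V_\delta(\cdot)$ is locally Lipschitz continuous in $\mathcal D_0$ (and therefore differentiable almost everywhere in $\mathcal D_0$ with respect to the Lebesgue measure in $\mathbb R^n$) if the Petrov condition $$\min_{u\in U}\langle x,f(x,u)\rangle<0\qquad\forall x\in\partial\mathrm B_\delta(0_n)=\{x'\in\mathbb R^n:\|x'\|=\delta\}$$ holds.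
   Context: Notation. $n,m\in\mathbb N$; $\|\cdot\|$ is the Euclidean norm, $\langle\cdot,\cdot\rangle$ the inner product, $\mathrm B_r(\xi)$ and $\bar{\mathrm B}_r(\xi)$ are the open and closed Euclidean balls, $0_j$ is the origin of $\mathbb R^j$; an open domain is an open connected set; $\inf\emptyset=+\infty$; $e^{-(+\infty)}=0$. $\mathcal K$ is the class of strictly increasing continuous functions $\varphi\colon[0,+\infty)\to[0,+\infty)$ with $\varphi(0)=0$; $\mathcal K_\infty$ is the class of $\varphi\in\mathcal K$ with $\lim_{\rho\to+\infty}\varphi(\rho)=+\infty$; $\mathcal L$ is the class of nonincreasing continuous $\varphi\colon[0,+\infty)\to[0,+\infty)$ with $\lim_{\rho\to+\infty}\varphi(\rho)=0$; $\mathcal{KL}$ is the class of continuous $\varphi\colon[0,+\infty)^2\to[0,+\infty)$ with $\varphi(\cdot,\rho)\in\mathcal K$ and $\varphi(\rho,\cdot)\in\mathcal L$ for every $\rho\ge0$. A function is proper if the preimage of every compact subset of $\mathbb R$ is compact. Control system. $\dot x(t)=f(x(t),u(t))$, $t\ge0$, $x(0)=x_0\in G$, $u(\cdot)\in\mathcal U:=L^\infty_{\mathrm{loc}}([0,+\infty),U)$ (locally essentially bounded functions with values in $U$). $x(\cdot;x_0,u(\cdot))$ denotes the corresponding (Carathéodory) solution; under the System Hypotheses it exists, is unique, is defined on $[0,+\infty)$ and stays in $G$. System Hypotheses. (1) $U\subset\mathbb R^m$ is compact, $G,G_1\subseteq\mathbb R^n$ are open domains, $\bar G\subset G_1$, $0_n\in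 G$. (2) $f\colon G_1\times U\to\mathbb R^n$ is continuous. (3) Any state trajectory of the system defined on an interval $[0,T)$ with $T\in(0,+\infty)\cup\{+\infty\}$ and corresponding to $x_0\in G$ and $u(\cdot)\in\mathcal U$ stays inside $G$ and does not reach $\partial G$. (4) For any $R>0$ there is $C_{1,R}>0$ with $\|f(x,u)-f(x',u)\|\le C_{1,R}\|x-x'\|$ for all $x,x'\in\bar{\mathrm B}_R(0_n)\cap\bar G$, $u\in U$. (5) There exist a continuously differentiable proper function $Y\colon G_1\to[0,+\infty)$ and a constant $C_2>0$ with $\sup_{u\in U}\langle \mathrm DY(x),f(x,u)\rangle\le C_2Y(x)$ for all $x\in G_1$. Region of asymptotic null-controllability. $\mathcal D_0:=\{x_0\in G:\ \exists u(\cdot)\in\mathcal U,\ \lim_{t\to+\infty}\|x(t;x_0,u(\cdot))\|=0\}$. Local Null-Controllability Hypotheses. $0_m\in U$, $f(0_n,0_m)=0_n$, and one of the following two conditions holds (the second strengthens the first): (weak) there exist constants $r,\bar u>0$ and $\beta\in\mathcal{KL}$ such that $\bar{\mathrm B}_r(0_n)\subset G$ and for any $x_0\in\mathrm B_r(0_n)$ there is $u_{x_0}(\cdot)\in\mathcal U$ with $\|u_{x_0}(\cdot)\|_{L^\infty([0,+\infty),U)}\le\bar u$ and $\|x(t;x_0,u_{x_0}(\cdot))\|\le\beta(\|x_0\|,t)$ for all $t\ge0$; (small control property) there exist $r>0$ and $\beta\in\mathcal{KL}$ such that $\bar{\mathrm B}_r(0_n)\subset G$ and for any $x_0\in\mathrm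 B_r(0_n)$ there is $u_{x_0}(\cdot)\in\mathcal U$ with $\|x(t;x_0,u_{x_0}(\cdot))\|+\|u_{x_0}(t)\|\le\beta(\|x_0\|,t)$ for all $t\ge0$; in this case put $\bar u:=\beta(r,0)$. The data $r,\bar u,\beta$ are fixed, and $\alpha_1,\alpha_2\in\mathcal K_\infty$ are fixed functions with $\beta(\rho,t)\le\alpha_2(\alpha_1(\rho)e^{-t})$ for all $\rho,t\ge0$ (such functions exist for every $\beta\in\mathcal{KL}$); $\alpha_2^{-1}$ is the inverse function of $\alpha_2$. Running Cost Hypotheses. (1) $g\colon\bar G\times U\to[0,+\infty)$ is continuous, and for any $R>0$ there is $C_{5,R}>0$ with $|g(x,u)-g(x',u)|\le C_{5,R}\|x-x'\|$ for all $x,x'\in\bar{\mathrm B}_R(0_n)\cap\bar G$, $u\in U$. (2) For any $R>0$, $\inf\{g(x,u):(x,u)\in\bar G\times U,\ \|x\|\ge R\}>0$. (3) If the small control property is not asserted, there exist positive constants $C_{11},C_{12}$ with $g(x,u)\le C_{11}(\alpha_2^{-1}(\|x\|))^{C_{12}}$ for all $x\in\bar{\mathrm B}_r(0_n)$, $u\in\bar{\mathrm B}_{\bar u}(0_m)\cap U$. (4) If the small control property holds, the condition in (3) is weakened to: there exist positive constants $C_{11},C_{12}$ with $g(x,u)\le C_{11}(\alpha_2^{-1}(\|x\|+\|u\|))^{C_{12}}$ for all $x\in\bar{\mathrm B}_r(0_n)$, $u\in\bar{\mathrm B}_{\bar u}(0_m)\cap U$. (5) There is $C_{13}>0$ with $g(x,u)\ge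 C_{13}\|f(x,u)\|$ for all $(x,u)\in\bar G\times U$ such that $\|x\|\ge2r$ or $\|u\|\ge2\bar u$. Value functions. For $x_0\in G$, $$V_0(x_0):=\inf_{u(\cdot)\in\mathcal U}\int_0^{+\infty}g(x(t;x_0,u(\cdot)),u(t))\,\mathrm dt\in[0,+\infty)\cup\{+\infty\},\qquad v_0(x_0):=1-e^{-V_0(x_0)},$$ and, for $\delta\in(0,r]$, $$V_\delta(x_0):=\inf\Big\{\int_0^Tg(x(t;x_0,u(\cdot)),u(t))\,\mathrm dt:\ u(\cdot)\in\mathcal U,\ T\in[0,+\infty),\ x(T;x_0,u(\cdot))\in\bar{\mathrm B}_\delta(0_n)\Big\},\qquad v_\delta(x_0):=1-e^{-V_\delta(x_0)}.$$ *)

theory Defs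
  imports "HOL-Analysis.Analysis"
begin

section \<open>Comparison functions\<close>

definition class_K :: "(real \<Rightarrow> real) set" where
  "class_K = {\<phi>. \<phi> \<in> {0..} \<rightarrow> {0..} \<and> strict_mono_on {0..} \<phi> \<and> continuous_on {0..} \<phi> \<and> \<phi> 0 = 0}"

definition class_K_inf :: "(real \<Rightarrow> real) set" where
  "class_K_inf = {\<phi> \<in> class_K. filterlim \<phi> at_top at_top}"

definition class_L :: "(real \<Rightarrow> real) set" where
  "class_L = {\<phi>. \<phi> \<in> {0..} \<rightarrow> {0..} \<and> antimono_on {0..} \<phi> \<and> continuous_on {0..} \<phi> \<and> (\<phi> \<longlongrightarrow> 0) at_top}"

definition class_KL :: "(real \<Rightarrow> real \<Rightarrow> real) set" where
  "class_KL = {\<phi>. continuous_on ({0..} \<times> {0..}) (\<lambda>(\<rho>, t). \<phi> \<rho> t) \<and>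
     (\<forall>\<rho>\<ge>0. (\<lambda>s. \<phi> s \<rho>) \<in> class_K \<and> (\<lambda>s. \<phi> \<rho> s) \<in> class_L)}"


section \<open>Control system\<close>

text \<open>
  Elements of \<open>L\<^sup>\<infinity>\<^sub>l\<^sub>o\<^sub>c([0,\<infinity>),U)\<close> are represented by functions, defined everywhere on
  \<open>[0,\<infinity>)\<close> with values in \<open>U\<close>; the values at negative times are irrelevant.
\<close>

definition controls :: "(real ^ 'm) set \<Rightarrow> (real \<Rightarrow> real ^ 'm) set" where
  "controls U = {u. u \<in> {0..} \<rightarrow> U \<and> u \<in> borel_measurable (lebesgue_on {0..}) \<and>
     (\<forall>T\<ge>0. \<exists>C. AE t in lebesgue_on {0..T}. norm (u t) \<le> C)}"

text \<open>
  Caratheodory solutions on \<open>[0,T)\<close>, \<open>0 < T \<le> \<infinity>\<close>, through the Lebesgue integral equation, i.e.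
  \<open>x\<close> is locally absolutely continuous, \<open>x' = f(x,u)\<close> almost everywhere and \<open>x(0) = x\<^sub>0\<close>.
  The dynamics is only meaningful on \<open>G\<^sub>1\<close>, so trajectories are required to remain there.
\<close>

definition is_trajectory ::
  "(real ^ 'n) set \<Rightarrow> (real ^ 'n \<Rightarrow> real ^ 'm \<Rightarrow> real ^ 'n) \<Rightarrow> ereal \<Rightarrow>
   real ^ 'n \<Rightarrow> (real \<Rightarrow> real ^ 'm) \<Rightarrow> (real \<Rightarrow> real ^ 'n) \<Rightarrow> bool" where
  "is_trajectory G1 f T x0 u x \<longleftrightarrow>
     (\<forall>t\<ge>0. ereal t < T \<longrightarrow>
        x t \<in> G1 \<and>
        (\<lambda>s. f (x s) (u s)) absolutely_integrable_on {0..t} \<and>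
        x t = x0 + integral {0..t} (\<lambda>s. f (x s) (u s)))"

text \<open>
  \<open>x(t; x\<^sub>0, u)\<close> for \<open>t \<ge> 0\<close>: the value at time \<open>t\<close> of the solution on \<open>[0,\<infinity>)\<close>. The description
  ranges over values because solutions are only determined at nonnegative times.
\<close>

definition state ::
  "(real ^ 'n) set \<Rightarrow> (real ^ 'n \<Rightarrow> real ^ 'm \<Rightarrow> real ^ 'n) \<Rightarrow>
   real ^ 'n \<Rightarrow> (real \<Rightarrow> real ^ 'm) \<Rightarrow> real \<Rightarrow> real ^ 'n" where
  "state G1 f x0 u t = (THE y. \<exists>x. is_trajectory G1 f \<infinity> x0 u x \<and> y = x t)"

definition system_hypotheses ::
  "(real ^ 'm) set \<Rightarrow> (real ^ 'n) set \<Rightarrow> (real ^ 'n) set \<Rightarrow>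
   (real ^ 'n \<Rightarrow> real ^ 'm \<Rightarrow> real ^ 'n) \<Rightarrow> bool" where
  "system_hypotheses U G G1 f \<longleftrightarrow>
     compact U \<and> open G \<and> connected G \<and> open G1 \<and> connected G1 \<and> closure G \<subseteq> G1 \<and> 0 \<in> G \<and>
     continuous_on (G1 \<times> U) (\<lambda>(x, u). f x u) \<and>
     (\<forall>T x0 u x. 0 < T \<and> x0 \<in> G \<and> u \<in> controls U \<and> is_trajectory G1 f T x0 u x \<longrightarrow>
        (\<forall>t\<ge>0. ereal t < T \<longrightarrow> x t \<in> G \<and> x t \<notin> frontier G)) \<and>
     (\<forall>R>0. \<exists>C>0. \<forall>x \<in> cball 0 R \<inter> closure G. \<forall>x' \<in> cball 0 R \<inter> closure G. \<forall>u\<in>U.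
        norm (f x u - f x' u) \<le> C * norm (x - x')) \<and>
     (\<exists>(Y :: real ^ 'n \<Rightarrow> real) DY C2.
        (\<forall>x\<in>G1. Y x \<ge> 0 \<and> GDERIV Y x :> DY x) \<and> continuous_on G1 DY \<and>
        (\<forall>K. compact K \<longrightarrow> compact {x \<in> G1. Y x \<in> K}) \<and>
        C2 > 0 \<and> (\<forall>x\<in>G1. (SUP u\<in>U. DY x \<bullet> f x u) \<le> C2 * Y x))"

definition null_controllable_domain ::
  "(real ^ 'm) set \<Rightarrow> (real ^ 'n) set \<Rightarrow> (real ^ 'n) set \<Rightarrow>
   (real ^ 'n \<Rightarrow> real ^ 'm \<Rightarrow> real ^ 'n) \<Rightarrow> (real ^ 'n) set" where
  "null_controllable_domain U G G1 f =
     {x0 \<in> G. \<exists>u \<in> controls U. ((\<lambda>t. norm (state G1 f x0 u t)) \<longlongrightarrow> 0) at_top}"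


section \<open>Local null-controllability\<close>

definition weak_null_controllability ::
  "(real ^ 'm) set \<Rightarrow> (real ^ 'n) set \<Rightarrow> (real ^ 'n) set \<Rightarrow>
   (real ^ 'n \<Rightarrow> real ^ 'm \<Rightarrow> real ^ 'n) \<Rightarrow> real \<Rightarrow> real \<Rightarrow> (real \<Rightarrow> real \<Rightarrow> real) \<Rightarrow> bool" where
  "weak_null_controllability U G G1 f r ubar \<beta> \<longleftrightarrow>
     r > 0 \<and> ubar > 0 \<and> \<beta> \<in> class_KL \<and> cball 0 r \<subseteq> G \<and>
     (\<forall>x0 \<in> ball 0 r. \<exists>u \<in> controls U.
        (AE t in lebesgue_on {0..}. norm (u t) \<le> ubar) \<and>
        (\<forall>t\<ge>0. norm (state G1 f x0 u t) \<le> \<beta> (norm x0) t))"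

definition small_control_property ::
  "(real ^ 'm) set \<Rightarrow> (real ^ 'n) set \<Rightarrow> (real ^ 'n) set \<Rightarrow>
   (real ^ 'n \<Rightarrow> real ^ 'm \<Rightarrow> real ^ 'n) \<Rightarrow> real \<Rightarrow> (real \<Rightarrow> real \<Rightarrow> real) \<Rightarrow> bool" where
  "small_control_property U G G1 f r \<beta> \<longleftrightarrow>
     r > 0 \<and> \<beta> \<in> class_KL \<and> cball 0 r \<subseteq> G \<and>
     (\<forall>x0 \<in> ball 0 r. \<exists>u \<in> controls U.
        (\<forall>t\<ge>0. norm (state G1 f x0 u t) + norm (u t) \<le> \<beta> (norm x0) t))"

text \<open>
  The flag \<open>small\<close> records which of the two alternatives is asserted; the growth condition on
  the running cost depends on this choice.
\<close>

definition local_null_controllability_hypotheses ::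
  "bool \<Rightarrow> (real ^ 'm) set \<Rightarrow> (real ^ 'n) set \<Rightarrow> (real ^ 'n) set \<Rightarrow>
   (real ^ 'n \<Rightarrow> real ^ 'm \<Rightarrow> real ^ 'n) \<Rightarrow> real \<Rightarrow> real \<Rightarrow> (real \<Rightarrow> real \<Rightarrow> real) \<Rightarrow> bool" where
  "local_null_controllability_hypotheses small U G G1 f r ubar \<beta> \<longleftrightarrow>
     0 \<in> U \<and> f 0 0 = 0 \<and>
     (if small then small_control_property U G G1 f r \<beta> \<and> ubar = \<beta> r 0
      else weak_null_controllability U G G1 f r ubar \<beta>)"


section \<open>Running cost and value functions\<close>

text \<open>
  The infimum in the second condition is taken in the extended reals, so that it is \<open>+\<infinity>\<close>
  over the empty set.
\<close>

definition running_cost_hypotheses ::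
  "bool \<Rightarrow> (real ^ 'm) set \<Rightarrow> (real ^ 'n) set \<Rightarrow>
   (real ^ 'n \<Rightarrow> real ^ 'm \<Rightarrow> real ^ 'n) \<Rightarrow> real \<Rightarrow> real \<Rightarrow> (real \<Rightarrow> real) \<Rightarrow>
   (real ^ 'n \<Rightarrow> real ^ 'm \<Rightarrow> real) \<Rightarrow> bool" where
  "running_cost_hypotheses small U G f r ubar \<alpha>2 g \<longleftrightarrow>
     (\<forall>x \<in> closure G. \<forall>u\<in>U. g x u \<ge> 0) \<and>
     continuous_on (closure G \<times> U) (\<lambda>(x, u). g x u) \<and>
     (\<forall>R>0. \<exists>C>0. \<forall>x \<in> cball 0 R \<inter> closure G. \<forall>x' \<in> cball 0 R \<inter> closure G. \<forall>u\<in>U.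
        \<bar>g x u - g x' u\<bar> \<le> C * norm (x - x')) \<and>
     (\<forall>R>0. (INF (x, u) \<in> {(x, u). x \<in> closure G \<and> u \<in> U \<and> norm x \<ge> R}. ereal (g x u)) > 0) \<and>
     (\<exists>C11>0. \<exists>C12>0. \<forall>x \<in> cball 0 r. \<forall>u \<in> cball 0 ubar \<inter> U.
        g x u \<le> C11 * (the_inv_into {0..} \<alpha>2 (if small then norm x + norm u else norm x)) powr C12) \<and>
     (\<exists>C13>0. \<forall>x \<in> closure G. \<forall>u\<in>U.
        norm x \<ge> 2 * r \<or> norm u \<ge> 2 * ubar \<longrightarrow> g x u \<ge> C13 * norm (f x u))"

definition infinite_horizon_value ::
  "(real ^ 'm) set \<Rightarrow> (real ^ 'n) set \<Rightarrow> (real ^ 'n \<Rightarrow> real ^ 'm \<Rightarrow> real ^ 'n) \<Rightarrow>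
   (real ^ 'n \<Rightarrow> real ^ 'm \<Rightarrow> real) \<Rightarrow> real ^ 'n \<Rightarrow> ennreal" where
  "infinite_horizon_value U G1 f g x0 =
     (INF u \<in> controls U. \<integral>\<^sup>+t\<in>{0..}. ennreal (g (state G1 f x0 u t) (u t)) \<partial>lebesgue)"

definition exit_time_value ::
  "(real ^ 'm) set \<Rightarrow> (real ^ 'n) set \<Rightarrow> (real ^ 'n \<Rightarrow> real ^ 'm \<Rightarrow> real ^ 'n) \<Rightarrow>
   (real ^ 'n \<Rightarrow> real ^ 'm \<Rightarrow> real) \<Rightarrow> real \<Rightarrow> real ^ 'n \<Rightarrow> ennreal" where
  "exit_time_value U G1 f g \<delta> x0 =
     Inf {\<integral>\<^sup>+t\<in>{0..T}. ennreal (g (state G1 f x0 u t) (u t)) \<partial>lebesgue | u T.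
            u \<in> controls U \<and> T \<ge> 0 \<and> state G1 f x0 u T \<in> cball 0 \<delta>}"

text \<open>
  The family \<open>V\<^sub>\<delta>\<close> for \<open>\<delta> \<ge> 0\<close>. Its member for \<open>\<delta> = 0\<close> is the infinite-horizon value, not the
  exit-time value for the target \<open>{0}\<close>.
\<close>

definition value_fun ::
  "(real ^ 'm) set \<Rightarrow> (real ^ 'n) set \<Rightarrow> (real ^ 'n \<Rightarrow> real ^ 'm \<Rightarrow> real ^ 'n) \<Rightarrow>
   (real ^ 'n \<Rightarrow> real ^ 'm \<Rightarrow> real) \<Rightarrow> real \<Rightarrow> real ^ 'n \<Rightarrow> ennreal" where
  "value_fun U G1 f g \<delta> =
     (if \<delta> = 0 then infinite_horizon_value U G1 f g else exit_time_value U G1 f g \<delta>)"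

definition kruzhkov :: "ennreal \<Rightarrow> real" where
  "kruzhkov V = 1 - (if V = \<infinity> then 0 else exp (- enn2real V))"

text \<open>The minimum in the Petrov condition is attained when \<open>U\<close> is compact and nonempty.\<close>

definition petrov_condition ::
  "(real ^ 'm) set \<Rightarrow> (real ^ 'n \<Rightarrow> real ^ 'm \<Rightarrow> real ^ 'n) \<Rightarrow> real \<Rightarrow> bool" where
  "petrov_condition U f \<delta> \<longleftrightarrow> (\<forall>x \<in> sphere 0 \<delta>. (INF u\<in>U. x \<bullet> f x u) < 0)"

definition locally_lipschitz_on ::
  "'a::metric_space set \<Rightarrow> ('a \<Rightarrow> 'b::metric_space) \<Rightarrow> bool" where
  "locally_lipschitz_on D F \<longleftrightarrow> (\<forall>x\<in>D. \<exists>\<epsilon>>0. \<exists>L. L-lipschitz_on (ball x \<epsilon> \<inter> D) F)"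

end

theory Submission
  imports Defs "HOL-Complex_Analysis.Great_Picard"
begin

text \<open>
  The value functions are compared through the dynamic programming inequality, which bounds
  \<open>V\<^sub>\<delta>(x\<^sub>0)\<close> by the cost up to time \<open>T\<close> plus \<open>V\<^sub>\<delta>(x(T))\<close>. A trajectory of finite infinite-horizon cost
  enters every ball around the origin, because the running cost is bounded below away from it; hence
  \<open>V\<^sub>\<delta> \<le> V\<^sub>0\<close>. Conversely, \<open>\<beta>(\<rho>,t) \<le> \<alpha>\<^sub>2(\<alpha>\<^sub>1(\<rho>) exp(-t))\<close> and the growth condition on the cost bound
  \<open>V\<^sub>0(x)\<close> near the origin by a constant times a power of \<open>\<alpha>\<^sub>1(\<parallel>x\<parallel>)\<close>, so \<open>V\<^sub>0 \<le> V\<^sub>\<delta> + o(1)\<close> uniformly.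

  Under the Petrov condition constant controls give \<open>V\<^sub>\<delta>(x) \<le> c (\<parallel>x\<parallel> - \<delta>)\<close> near the sphere. A control
  that is nearly optimal for one point has a hitting time bounded by the value, and applied to a nearby
  point it ends near the sphere; this yields the local Lipschitz estimate, and Rademacher's theorem the
  differentiability. Trajectories exist by Peano's theorem, since \<open>f\<close> is Lipschitz only on \<open>G\<close> whereas the
  invariance hypothesis concerns curves in \<open>G\<^sub>1\<close>.
\<close>

section \<open>Differentiability of Lipschitz functions\<close>

text \<open>All values live in \<open>ennreal\<close>, so the two comparison inequalities also cover
  points outside \<open>D0\<close>: a finite gap makes \<open>V 0\<close> and
  \<open>V \<delta>\<close> infinite at the same points, and since the additive constant does not
  depend on the starting point, the estimate is uniform on \<open>G\<close>. The Lipschitz estimate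
  meets the difficulty that the running cost is bounded below only away from the origin: the cost
  bounds the time spent before the first visit to the target ball, not the time \<open>T\<close>
  that comes with a nearly optimal control, so such controls are cut at the first visit. Controls
  are merely measurable, so a curve need not be differentiable at a given time; the Gronwall
  estimates are therefore phrased by right difference quotients. Rademacher's theorem starts in
  dimension one, where a Lipschitz function plus a steep linear one is an indefinite integral;
  Fubini's theorem spreads this over parallel lines, and integrals of difference quotients over
  boxes show that the directional derivatives are linear in the direction.\<close>

lemma expanding_continuous_bij:
  fixes g :: "real \<Rightarrow> real"
  assumes exp: "\<And>x y. x \<le> y \<Longrightarrow> y - x \<le> g y - g x" and cont: "continuous_on UNIV g"
  shows "bij g"
proof (rule bijI)
  show "inj g"
  proof (rule linorder_injI)
    fix x y :: real assume "x < y"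
    then show "g x \<noteq> g y" using exp[of x y] by auto
  qed
  show "surj g"
  proof (rule surjI[where f = "\<lambda>y. SOME x. g x = y"])
    fix y
    have "\<exists>x. - \<bar>y - g 0\<bar> \<le> x \<and> x \<le> \<bar>y - g 0\<bar> \<and> g x = y"
    proof (rule IVT')
      show "g (- \<bar>y - g 0\<bar>) \<le> y" using exp[of "- \<bar>y - g 0\<bar>" 0] by linarith
      show "y \<le> g \<bar>y - g 0\<bar>" using exp[of 0 "\<bar>y - g 0\<bar>"] by linarith
    qed (auto intro: continuous_on_subset[OF cont])
    then show "g (SOME x. g x = y) = y" by (metis (mono_tags, lifting) someI)
  qed
qed

text \<open>The image measure of \<open>lborel\<close> under \<open>g\<inverse>\<close> assigns \<open>g b - g a\<close> to \<open>[a,b]\<close>; it is absolutely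
  continuous because \<open>g\<close> maps null sets to null sets.\<close>

lemma expanding_lipschitz_indefinite_integral:
  fixes g :: "real \<Rightarrow> real"
  assumes exp: "\<And>x y. x \<le> y \<Longrightarrow> y - x \<le> g y - g x" and lip: "L-lipschitz_on UNIV g"
  obtains \<rho> where "\<And>a b. a \<le> b \<Longrightarrow> (\<rho> has_integral (g b - g a)) {a..b}"
proof -
  have cont: "continuous_on UNIV g" using lip lipschitz_on_continuous_on by blast
  have bij: "bij g" by (rule expanding_continuous_bij[OF exp cont])
  define k where "k = inv g"
  have gk[simp]: "g (k y) = y" for y unfolding k_def using bij by (simp add: bij_is_surj surj_f_inv_f)
  have kg[simp]: "k (g y) = y" for y unfolding k_def using bij by (simp add: bij_is_inj)
  have k1: "\<bar>k x - k y\<bar> \<le> \<bar>x - y\<bar>" for x y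
  proof (cases "k x \<le> k y")
    case True then show ?thesis using exp[of "k x" "k y"] by simp
  next
    case False then show ?thesis using exp[of "k y" "k x"] by simp
  qed
  have "1-lipschitz_on UNIV k" by (intro lipschitz_onI) (use k1 in \<open>auto simp: dist_real_def\<close>)
  then have kmeas[measurable]: "k \<in> borel_measurable borel"
    by (intro borel_measurable_continuous_onI) (rule lipschitz_on_continuous_on)
  have gmono: "x \<le> y \<Longrightarrow> g x \<le> g y" for x y using exp[of x y] by linarith
  have gle: "g x \<le> g y \<longleftrightarrow> x \<le> y" for x y using gmono exp[of y x] by fastforce
  define \<nu> where "\<nu> = distr lborel lborel k"
  have em: "emeasure \<nu> A = emeasure lborel (g ` A)" if "A \<in> sets borel" for A
  proof -
    have "k -` A = g ` A" by (force simp: image_iff intro: gk[symmetric])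
    then show ?thesis unfolding \<nu>_def using that by (simp add: emeasure_distr)
  qed
  have "absolutely_continuous lborel \<nu>"
    unfolding absolutely_continuous_def
  proof
    fix A assume A: "A \<in> null_sets (lborel::real measure)"
    then have AB: "A \<in> sets borel" by auto
    have neg: "negligible A" using A by (simp add: negligible_iff_null_sets null_sets_completionI)
    have "negligible (g ` A)"
    proof (rule negligible_locally_Lipschitz_image[OF _ neg])
      fix x assume "x \<in> A"
      show "\<exists>T B. open T \<and> x \<in> T \<and> (\<forall>y\<in>A \<inter> T. norm (g y - g x) \<le> B * norm (y - x))"
        using lipschitz_onD[OF lip] by (intro exI[of _ UNIV] exI[of _ L]) (auto simp: dist_norm)
    qed simp
    moreover have "g ` A \<in> sets borel"
    proof -
      have "g ` A = k -` A" by (force simp: image_iff intro: gk[symmetric])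
      then show ?thesis using measurable_sets_borel[OF kmeas AB] by simp
    qed
    ultimately have "emeasure lborel (g ` A) = 0"
      by (simp add: negligible_iff_null_sets null_sets_def)
    then show "A \<in> null_sets \<nu>" using em[OF AB] AB by (auto simp: null_sets_def \<nu>_def)
  qed
  moreover have "sets \<nu> = sets lborel" by (simp add: \<nu>_def)
  ultimately obtain h where h[measurable]: "h \<in> borel_measurable borel" and hd: "density lborel h = \<nu>"
    using sigma_finite_measure.Radon_Nikodym[OF sigma_finite_lborel, of \<nu>] by auto
  have hint: "(\<integral>\<^sup>+x. h x * indicator {a..b} x \<partial>lborel) = ennreal (g b - g a)" if "a \<le> b" for a b
  proof -
    have "g ` {a..b} = {g a..g b}"
    proof
      show "{g a..g b} \<subseteq> g ` {a..b}"
      proof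
        fix y assume "y \<in> {g a..g b}"
        then have "k y \<in> {a..b}" using gle[of a "k y"] gle[of "k y" b] by auto
        then show "y \<in> g ` {a..b}" by (metis gk imageI)
      qed
    qed (auto intro: gmono)
    then have "emeasure \<nu> {a..b} = ennreal (g b - g a)" using em[of "{a..b}"] gmono[OF that] by simp
    moreover have "emeasure \<nu> {a..b} = (\<integral>\<^sup>+x. h x * indicator {a..b} x \<partial>lborel)"
      unfolding hd[symmetric] by (subst emeasure_density) auto
    ultimately show ?thesis by simp
  qed
  \<comment> \<open>The density is \<open>ennreal\<close>-valued. Finite mass on each of countably
    many intervals makes it finite almost everywhere, so passing to real values below loses
    nothing.\<close>
  have "AE x in lborel. h x * indicator {-real n..real n} x \<noteq> \<infinity>" for n :: nat
    by (rule nn_integral_PInf_AE) (use hint[of "-real n" "real n"] in auto)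
  then have "AE x in lborel. \<forall>n::nat. h x * indicator {-real n..real n} x \<noteq> \<infinity>"
    by (simp add: AE_all_countable)
  then have hfin: "AE x in lborel. h x \<noteq> \<infinity>"
  proof eventually_elim
    fix x assume *: "\<forall>n::nat. h x * indicator {-real n..real n} x \<noteq> \<infinity>"
    obtain n :: nat where "\<bar>x\<bar> \<le> real n" using real_arch_simple by blast
    then have "x \<in> {-real n..real n}" by auto
    then show "h x \<noteq> \<infinity>" using *[rule_format, of n] by auto
  qed
  define \<rho> where "\<rho> x = enn2real (h x)" for x
  have "(\<rho> has_integral (g b - g a)) {a..b}" if "a \<le> b" for a b
  proof -
    have "((\<lambda>x. \<rho> x * indicator {a..b} x) has_integral (g b - g a)) UNIV"
    proof (rule nn_integral_has_integral)
      show "(\<lambda>x. \<rho> x * indicator {a..b} x) \<in> borel_measurable borel" unfolding \<rho>_def by measurable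
      show "0 \<le> \<rho> x * indicator {a..b} x" for x by (simp add: \<rho>_def indicator_def)
      show "0 \<le> g b - g a" using gmono[OF that] by simp
      have "(\<integral>\<^sup>+x. ennreal (\<rho> x * indicator {a..b} x) \<partial>lborel) = (\<integral>\<^sup>+x. h x * indicator {a..b} x \<partial>lborel)"
        by (rule nn_integral_cong_AE)
          (use hfin in \<open>eventually_elim, auto simp: \<rho>_def indicator_def less_top\<close>)
      then show "(\<integral>\<^sup>+x. ennreal (\<rho> x * indicator {a..b} x) \<partial>lborel) = ennreal (g b - g a)"
        using hint[OF that] by simp
    qed
    moreover have "(\<lambda>x. \<rho> x * indicator {a..b} x) = (\<lambda>x. if x \<in> {a..b} then \<rho> x else 0)"
      by (auto simp: indicator_def)
    ultimately show ?thesis by (simp only: has_integral_restrict_UNIV)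
  qed
  then show ?thesis by (rule that)
qed

text \<open>The slope \<open>L + 1\<close> outweighs any decrease of \<open>f\<close> and leaves a
  slope of at least 1, so \<open>g\<close> is expanding and hence the indefinite integral of some
  \<open>\<rho>\<close>. By Lebesgue's differentiation theorem the averages of \<open>\<rho>\<close>
  over \<open>{x..x + h}\<close> converge almost everywhere; subtracting the linear part gives the
  derivative of \<open>f\<close>. These averages look to the right, whence the one-sided
  limit.\<close>

lemma lipschitz_right_derivative:
  fixes f :: "real \<Rightarrow> real"
  assumes lip: "L-lipschitz_on UNIV f"
  obtains N where "negligible N"
    "\<And>x. x \<notin> N \<Longrightarrow> \<exists>D. ((\<lambda>h. (f (x + h) - f x) / h) \<longlongrightarrow> D) (at_right 0)"
proof -
  define g where "g x = f x + (L + 1) * x" for x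
  have L0: "L \<ge> 0" using lip by (rule lipschitz_on_nonneg)
  have fl: "\<bar>f x - f y\<bar> \<le> L * \<bar>x - y\<bar>" for x y using lipschitz_onD[OF lip, of x y] by (simp add: dist_real_def)
  obtain \<rho> where \<rho>: "\<And>a b. a \<le> b \<Longrightarrow> (\<rho> has_integral (g b - g a)) {a..b}"
  proof (rule expanding_lipschitz_indefinite_integral[of g "2 * L + 1"])
    fix x y :: real assume "x \<le> y"
    then show "y - x \<le> g y - g x" using fl[of y x] by (auto simp: g_def algebra_simps abs_if split: if_splits)
  next
    show "(2 * L + 1)-lipschitz_on UNIV g"
    proof (rule lipschitz_onI)
      fix x y
      have "dist (g x) (g y) = \<bar>(f x - f y) + (L + 1) * (x - y)\<bar>" by (simp add: dist_real_def g_def algebra_simps)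
      also have "\<dots> \<le> L * \<bar>x - y\<bar> + (L + 1) * \<bar>x - y\<bar>"
        proof -
        have "\<bar>(L + 1) * (x - y)\<bar> = (L + 1) * \<bar>x - y\<bar>" using L0 by (simp add: abs_mult)
        then show ?thesis using fl[of x y] abs_triangle_ineq[of "f x - f y" "(L + 1) * (x - y)"] by linarith
      qed
      finally show "dist (g x) (g y) \<le> (2 * L + 1) * dist x y" by (simp add: dist_real_def algebra_simps)
    qed (use L0 in simp)
  qed blast
  have "\<rho> integrable_on cbox a b" for a b
  proof (cases "a \<le> b")
    case True then show ?thesis using \<rho>[OF True] by (auto simp: integrable_on_def)
  qed auto
  then obtain N where N: "negligible N" and
    Nd: "\<And>x e. \<lbrakk>x \<notin> N; 0 < e\<rbrakk> \<Longrightarrow> \<exists>d>0. \<forall>h. 0 < h \<and> h < d \<longrightarrow>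
          norm (integral (cbox x (x + h *\<^sub>R One)) \<rho> /\<^sub>R h ^ DIM(real) - \<rho> x) < e"
    using integrable_ccontinuous_explicit[of \<rho>] by metis
  show thesis
  proof (rule that[OF N])
    fix x assume "x \<notin> N"
    have "((\<lambda>h. (f (x + h) - f x) / h) \<longlongrightarrow> \<rho> x - (L + 1)) (at_right 0)"
    proof (rule tendstoI)
      fix e :: real assume "e > 0"
      then obtain d where "d > 0" and
        d: "\<And>h. 0 < h \<Longrightarrow> h < d \<Longrightarrow> norm (integral (cbox x (x + h *\<^sub>R One)) \<rho> /\<^sub>R h ^ DIM(real) - \<rho> x) < e"
        using Nd[OF \<open>x \<notin> N\<close>] by metis
      have "dist ((f (x + h) - f x) / h) (\<rho> x - (L + 1)) < e" if "0 < h" "h < d" for h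
      proof -
        have "integral {x..x + h} \<rho> = g (x + h) - g x" using \<rho>[of x "x + h"] that by (auto dest: integral_unique)
        then have "\<bar>(g (x + h) - g x) / h - \<rho> x\<bar> < e" using d[OF that] by (simp add: divide_inverse mult.commute)
        moreover have "(g (x + h) - g x) / h = (f (x + h) - f x) / h + (L + 1)"
          using that by (simp add: g_def field_simps)
        ultimately show ?thesis by (simp add: dist_real_def algebra_simps)
      qed
      then show "\<forall>\<^sub>F h in at_right 0. dist ((f (x + h) - f x) / h) (\<rho> x - (L + 1)) < e"
        using \<open>d > 0\<close> by (auto simp: eventually_at_right_field intro!: exI[of _ d])
    qed
    then show "\<exists>D. ((\<lambda>h. (f (x + h) - f x) / h) \<longlongrightarrow> D) (at_right 0)" by blast
  qed
qed

section \<open>Directional derivatives of Lipschitz functions\<close>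

text \<open>The Cauchy criterion with tolerances and radii indexed by naturals: when
  \<open>q\<close> depends continuously on a parameter, the set of parameters with a limit becomes a
  countable intersection of countable unions of closed sets, hence Borel.\<close>

lemma convergent_at_right_0_iff_Cauchy:
  fixes q :: "real \<Rightarrow> real"
  shows "(\<exists>D. (q \<longlongrightarrow> D) (at_right 0)) \<longleftrightarrow>
    (\<forall>n::nat. \<exists>m::nat. \<forall>h\<in>{0<..<1/Suc m}. \<forall>k\<in>{0<..<1/Suc m}. \<bar>q h - q k\<bar> \<le> 1/Suc n)"
proof safe
  fix D and n :: nat assume "(q \<longlongrightarrow> D) (at_right 0)"
  define c where "c = 1 / real (Suc n)"
  have "c / 2 > 0" by (simp add: c_def)
  from tendstoD[OF \<open>(q \<longlongrightarrow> D) (at_right 0)\<close> this]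
  obtain d where d: "d > 0" "\<And>h. 0 < h \<Longrightarrow> h < d \<Longrightarrow> \<bar>q h - D\<bar> < c / 2"
    by (auto simp: eventually_at_right_field dist_real_def)
  obtain m where m: "inverse (real (Suc m)) < d" using reals_Archimedean[OF d(1)] by blast
  have "\<bar>q h - q k\<bar> \<le> c" if "h\<in>{0<..<1/Suc m}" "k\<in>{0<..<1/Suc m}" for h k
  proof -
    have "\<bar>q h - D\<bar> < c / 2" "\<bar>q k - D\<bar> < c / 2" using d(2)[of h] d(2)[of k] that m by (auto simp: inverse_eq_divide)
    then show ?thesis by linarith
  qed
  then show "\<exists>m. \<forall>h\<in>{0<..<1/Suc m}. \<forall>k\<in>{0<..<1/Suc m}. \<bar>q h - q k\<bar> \<le> 1/Suc n"
    unfolding c_def by blast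
next
  assume *: "\<forall>n::nat. \<exists>m::nat. \<forall>h\<in>{0<..<1/Suc m}. \<forall>k\<in>{0<..<1/Suc m}. \<bar>q h - q k\<bar> \<le> 1/Suc n"
  define F where "F = filtermap q (at_right 0)"
  have "cauchy_filter F"
    unfolding F_def cauchy_filter_metric_filtermap
  proof safe
    fix e :: real assume "e > 0"
    obtain n where n: "inverse (real (Suc n)) < e" using reals_Archimedean[OF \<open>e > 0\<close>] by blast
    obtain m :: nat where m: "\<forall>h\<in>{0<..<1/Suc m}. \<forall>k\<in>{0<..<1/Suc m}. \<bar>q h - q k\<bar> \<le> 1/Suc n" using * by blast
    show "\<exists>P. eventually P (at_right 0) \<and> (\<forall>x y. P x \<and> P y \<longrightarrow> dist (q x) (q y) < e)"
    proof (intro exI conjI allI impI)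
      show "\<forall>\<^sub>F x in at_right 0. x \<in> {0<..<1/Suc m}"
        by (auto simp: eventually_at_right_field intro!: exI[of _ "1 / Suc m"])
      fix x y assume "x \<in> {0<..<1/real (Suc m)} \<and> y \<in> {0<..<1/real (Suc m)}"
      then have "\<bar>q x - q y\<bar> \<le> 1/Suc n" using m by blast
      then show "dist (q x) (q y) < e" using n by (simp add: dist_real_def inverse_eq_divide)
    qed
  qed
  moreover have "F \<noteq> bot" by (simp add: F_def filtermap_bot_iff)
  ultimately obtain D where "F \<le> nhds D"
    using complete_UNIV[where 'a = real] unfolding complete_uniform by (metis UNIV_I top_greatest principal_UNIV)
  then show "\<exists>D. (q \<longlongrightarrow> D) (at_right 0)" unfolding F_def filterlim_def by blast
qed

definition diff_quot :: "('a::real_vector \<Rightarrow> real) \<Rightarrow> 'a \<Rightarrow> 'a \<Rightarrow> real \<Rightarrow> real" where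
  "diff_quot f v x h = (f (x + h *\<^sub>R v) - f x) / h"

lemma abs_diff_quot_le:
  assumes lip: "L-lipschitz_on UNIV f"
  shows "\<bar>diff_quot f v x h\<bar> \<le> L * norm v"
proof -
  have "\<bar>f (x + h *\<^sub>R v) - f x\<bar> \<le> L * (\<bar>h\<bar> * norm v)"
    using lipschitz_onD[OF lip, of "x + h *\<^sub>R v" x] by (simp add: dist_norm)
  then show ?thesis using lipschitz_on_nonneg[OF lip]
    by (cases "h = 0") (auto simp: diff_quot_def field_simps abs_divide)
qed

text \<open>On every line in direction \<open>v\<close> the one-dimensional result applies, so for
  each \<open>x\<close> the times \<open>t\<close> with \<open>x + t *\<^sub>R v\<close> in the
  exceptional set \<open>N\<close> are null. Integrating over \<open>t\<close> in
  \<open>{0..1}\<close> and over all \<open>x\<close>, and exchanging the integrals, each slice in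
  \<open>t\<close> is a translate of \<open>N\<close> and contributes the full measure of
  \<open>N\<close>, which is therefore 0. Averaging over translations avoids coordinates adapted to
  \<open>v\<close>.\<close>

lemma lipschitz_directional_derivative:
  fixes f :: "'a::euclidean_space \<Rightarrow> real"
  assumes lip: "L-lipschitz_on UNIV f"
  shows "AE x in lborel. \<exists>D. (diff_quot f v x \<longlongrightarrow> D) (at_right 0)"
proof -
  define Q where "Q n m = {x. \<forall>h\<in>{0<..<1/Suc m}. \<forall>k\<in>{0<..<1/Suc m}.
       \<bar>diff_quot f v x h - diff_quot f v x k\<bar> \<le> 1/Suc n}" for n m :: nat
  define E where "E = (\<Inter>n. \<Union>m. Q n m)"
  have E: "x \<in> E \<longleftrightarrow> (\<exists>D. (diff_quot f v x \<longlongrightarrow> D) (at_right 0))" for x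
    unfolding convergent_at_right_0_iff_Cauchy by (simp add: E_def Q_def)
  have contf: "continuous_on S f" for S using lip by (meson continuous_on_subset lipschitz_on_continuous_on subset_UNIV)
  have contq: "continuous_on UNIV (\<lambda>x. diff_quot f v x h)" if "h > 0" for h
    unfolding diff_quot_def using that
    by (intro continuous_intros continuous_on_compose2[OF contf[of UNIV]]) auto
  have "closed (Q n m)" for n m
  proof -
    have "Q n m = (\<Inter>h\<in>{0<..<1/Suc m}. \<Inter>k\<in>{0<..<1/Suc m}.
        {x. \<bar>diff_quot f v x h - diff_quot f v x k\<bar> \<le> 1/Suc n})" by (auto simp: Q_def)
    also have "closed \<dots>"
      by (intro closed_INT ballI closed_Collect_le continuous_intros contq) auto
    finally show ?thesis .
  qed
  then have Em: "E \<in> sets borel" unfolding E_def by (intro sets.countable_INT' sets.countable_UN) auto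
  define N where "N = - E"
  have Nm[measurable]: "N \<in> sets borel" using Em unfolding N_def by auto
  have "(\<integral>\<^sup>+t. indicator {0..1} t * indicator N (x + t *\<^sub>R v) \<partial>lborel) = 0" for x
  proof -
    have "(L * norm v)-lipschitz_on UNIV (\<lambda>t::real. f (x + t *\<^sub>R v))"
    proof (rule lipschitz_onI)
      fix s t :: real
      have "dist (x + s *\<^sub>R v) (x + t *\<^sub>R v) = \<bar>s - t\<bar> * norm v"
        by (simp add: dist_norm flip: scaleR_diff_left)
      then show "dist (f (x + s *\<^sub>R v)) (f (x + t *\<^sub>R v)) \<le> L * norm v * dist s t"
        using lipschitz_onD[OF lip, of "x + s *\<^sub>R v" "x + t *\<^sub>R v"] by (simp add: dist_real_def mult_ac)
    qed (use lipschitz_on_nonneg[OF lip] in simp)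
    then obtain M where M: "negligible M" "\<And>t. t \<notin> M \<Longrightarrow>
        \<exists>D. ((\<lambda>h. (f (x + (t + h) *\<^sub>R v) - f (x + t *\<^sub>R v)) / h) \<longlongrightarrow> D) (at_right 0)"
      by (rule lipschitz_right_derivative) blast
    have "(\<integral>\<^sup>+t. indicator {0..1} t * indicator N (x + t *\<^sub>R v) \<partial>lborel) = 0"
    proof (subst nn_integral_0_iff_AE)
      have "AE t in lebesgue. t \<notin> M" using M(1) by (simp add: AE_not_in negligible_iff_null_sets)
      then have "AE t in lborel. t \<notin> M" by (simp add: AE_completion_iff)
      then show "AE t in lborel. indicator {0..1} t * indicator N (x + t *\<^sub>R v) = (0::ennreal)"
      proof eventually_elim
        fix t assume "t \<notin> M"
        from M(2)[OF this] have "x + t *\<^sub>R v \<in> E" unfolding E diff_quot_def by (simp add: scaleR_add_left add_ac)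
        then show "indicator {0..1} t * indicator N (x + t *\<^sub>R v) = (0::ennreal)" by (simp add: N_def)
      qed
    qed measurable
    then show ?thesis .
  qed
  then have "0 = (\<integral>\<^sup>+x. \<integral>\<^sup>+t. indicator {0..1} t * indicator N (x + t *\<^sub>R v) \<partial>lborel \<partial>(lborel :: 'a measure))"
    by simp
  also have "\<dots> = (\<integral>\<^sup>+t. \<integral>\<^sup>+x. indicator {0..1} t * indicator N (x + t *\<^sub>R v) \<partial>lborel \<partial>(lborel :: real measure))"
    by (rule pair_sigma_finite.Fubini'[symmetric, of lborel lborel])
       (auto simp: pair_sigma_finite_def sigma_finite_lborel split_beta')
  also have "\<dots> = (\<integral>\<^sup>+t. emeasure lborel N * indicator {0..1} t \<partial>(lborel :: real measure))"
  proof (rule nn_integral_cong)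
    fix t :: real
    have "(\<integral>\<^sup>+x. indicator {0..1} t * indicator N (x + t *\<^sub>R v) \<partial>lborel) =
        indicator {0..1} t * (\<integral>\<^sup>+x. indicator N (t *\<^sub>R v + x) \<partial>lborel)"
      by (subst nn_integral_cmult) (auto simp: add_ac)
    also have "(\<integral>\<^sup>+x. indicator N (t *\<^sub>R v + x) \<partial>lborel) = (\<integral>\<^sup>+x. indicator N x \<partial>(distr lborel borel ((+) (t *\<^sub>R v))))"
      by (subst nn_integral_distr) auto
    also have "\<dots> = emeasure lborel N" by (simp add: lborel_distr_plus)
    finally show "(\<integral>\<^sup>+x. indicator {0..1} t * indicator N (x + t *\<^sub>R v) \<partial>lborel) = emeasure lborel N * indicator {0..1} t"
      by (simp add: mult.commute)
  qed
  also have "\<dots> = emeasure lborel N" by (simp add: nn_integral_cmult)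
  finally have "N \<in> null_sets lborel" by (intro null_setsI) auto
  then have "AE x in lborel. x \<notin> N" by (rule AE_not_in)
  then show ?thesis by eventually_elim (simp add: N_def E)
qed

text \<open>The limit along \<open>h = 1/(n+1)\<close> is taken so that the derivative is Borel measurable everywhere;
  it is only meaningful where the one-sided limit exists.\<close>

definition dir_deriv :: "('a::real_vector \<Rightarrow> real) \<Rightarrow> 'a \<Rightarrow> 'a \<Rightarrow> real" where
  "dir_deriv f v x = lim (\<lambda>n. diff_quot f v x (1 / Suc n))"

lemma dir_deriv_eq:
  assumes "(diff_quot f v x \<longlongrightarrow> D) (at_right 0)"
  shows "dir_deriv f v x = D"
proof -
  have "filterlim (\<lambda>n. 1 / real (Suc n)) (at_right 0) sequentially"
    using LIMSEQ_Suc[OF lim_1_over_n[where 'a = real]] by (intro filterlim_at_withinI) auto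
  from filterlim_compose[OF assms this] show ?thesis unfolding dir_deriv_def by (rule limI)
qed

lemma tendsto_dir_deriv_AE:
  fixes f :: "'a::euclidean_space \<Rightarrow> real"
  assumes lip: "L-lipschitz_on UNIV f"
  shows "AE x in lborel. (diff_quot f v x \<longlongrightarrow> dir_deriv f v x) (at_right 0)"
  using lipschitz_directional_derivative[OF lip, of v] by eventually_elim (auto simp: dir_deriv_eq)

text \<open>Rescaling the step \<open>h\<close> by \<open>c\<close> keeps it on the right of 0 only
  for positive \<open>c\<close>; negative factors are reached through additivity.\<close>

lemma diff_quot_scaleR_tendsto:
  assumes "(diff_quot f v x \<longlongrightarrow> D) (at_right 0)" "c \<ge> 0"
  shows "(diff_quot f (c *\<^sub>R v) x \<longlongrightarrow> c * D) (at_right 0)"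
proof (cases "c = 0")
  case True then show ?thesis by (simp add: diff_quot_def[abs_def])
next
  case False
  with assms have c: "c > 0" by simp
  have "filterlim (\<lambda>h. c * h) (at_right 0) (at_right 0)"
    using c by (intro filterlim_at_withinI tendsto_eq_intros)
      (auto simp: eventually_at_right_field intro!: exI[of _ 1])
  from filterlim_compose[OF assms(1) this]
  have "((\<lambda>h. c * diff_quot f v x (c * h)) \<longlongrightarrow> c * D) (at_right 0)" by (intro tendsto_intros)
  moreover have "c * diff_quot f v x (c * h) = diff_quot f (c *\<^sub>R v) x h" for h
    using c by (simp add: diff_quot_def mult.commute)
  ultimately show ?thesis by simp
qed

text \<open>By Lebesgue's differentiation theorem \<open>F x\<close> is, for almost every
  \<open>x\<close>, the limit of averages over small cubes with corner \<open>x\<close>, and all of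
  these vanish.\<close>

lemma zero_AE_if_integral_cbox_zero:
  fixes F :: "'a::euclidean_space \<Rightarrow> real"
  assumes "\<And>a b. (F has_integral 0) (cbox a b)"
  shows "AE x in lborel. F x = 0"
proof -
  have "F integrable_on cbox a b" for a b using assms by (auto simp: integrable_on_def)
  then obtain N where N: "negligible N" and
    Nd: "\<And>x e. \<lbrakk>x \<notin> N; 0 < e\<rbrakk> \<Longrightarrow> \<exists>d>0. \<forall>h. 0 < h \<and> h < d \<longrightarrow>
          norm (integral (cbox x (x + h *\<^sub>R One)) F /\<^sub>R h ^ DIM('a) - F x) < e"
    using integrable_ccontinuous_explicit[of F] by metis
  have z: "F x = 0" if xN: "x \<notin> N" for x
  proof (rule ccontr)
    assume "F x \<noteq> 0"
    then obtain d where d: "d > 0" "\<forall>h. 0 < h \<and> h < d \<longrightarrow>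
          norm (integral (cbox x (x + h *\<^sub>R One)) F /\<^sub>R h ^ DIM('a) - F x) < \<bar>F x\<bar>"
      using Nd[OF xN, of "\<bar>F x\<bar>"] by auto
    then show False using d(2)[rule_format, of "d/2"] assms[THEN integral_unique] by simp
  qed
  have "AE x in lebesgue. x \<notin> N" using N by (simp add: AE_not_in negligible_iff_null_sets)
  then have "AE x in lborel. x \<notin> N" by (simp add: AE_completion_iff)
  then show ?thesis by eventually_elim (rule z)
qed

lemma dir_deriv_measurable:
  fixes f :: "'a::euclidean_space \<Rightarrow> real"
  assumes "continuous_on UNIV f"
  shows "(\<lambda>x. diff_quot f v x h) \<in> borel_measurable borel" "dir_deriv f v \<in> borel_measurable borel"
proof -
  have [measurable]: "f \<in> borel_measurable borel" using assms by (rule borel_measurable_continuous_onI)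
  show [measurable]: "(\<lambda>x. diff_quot f v x h) \<in> borel_measurable borel" for h unfolding diff_quot_def by measurable
  show "dir_deriv f v \<in> borel_measurable borel"
    unfolding dir_deriv_def[abs_def] by (rule borel_measurable_lim_metric) measurable
qed

text \<open>Substituting \<open>y = x + u / (n + 1)\<close> moves the translation from the
  difference quotient onto the indicator of the box. The translated indicators converge off the
  frontier of the box, a null set, the quotients converge almost everywhere, and the Lipschitz bound
  allows dominated convergence. With \<open>u = 0\<close> this is the limit without
  translation.\<close>

lemma diff_quot_shift_limit:
  fixes f :: "'a::euclidean_space \<Rightarrow> real"
  assumes lip: "L-lipschitz_on UNIV f"
  shows "(\<lambda>n. LINT x|lborel. indicator (cbox a b) x * diff_quot f v (x + (1 / Suc n) *\<^sub>R u) (1 / Suc n))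
      \<longlonglongrightarrow> (LINT x|lborel. indicator (cbox a b) x * dir_deriv f v x)"
    and "integrable lborel (\<lambda>x. indicator (cbox a b) x * dir_deriv f v x)"
    and "\<And>n. integrable lborel (\<lambda>x. indicator (cbox a b) x * diff_quot f v (x + (1 / Suc n) *\<^sub>R u) (1 / Suc n))"
proof -
  have contf: "continuous_on UNIV f" using lip by (rule lipschitz_on_continuous_on)
  note [measurable] = dir_deriv_measurable[OF contf]
  have L0: "L \<ge> 0" using lip by (rule lipschitz_on_nonneg)
  define e where "e n = 1 / real (Suc n)" for n
  have e: "0 < e n" "e n \<le> 1" for n by (auto simp: e_def)
  have e_lim: "e \<longlonglongrightarrow> 0" unfolding e_def using LIMSEQ_Suc[OF lim_1_over_n[where 'a = real]] .
  obtain R where R: "R > 0" "\<And>x. x \<in> cbox a b \<Longrightarrow> norm x \<le> R"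
    using bounded_cbox[of a b] bounded_pos by (metis (no_types, lifting))
  have eq: "(LINT x|lborel. indicator (cbox a b) x * diff_quot f v (x + e n *\<^sub>R u) (e n)) =
      (LINT y|lborel. indicator (cbox a b) (y - e n *\<^sub>R u) * diff_quot f v y (e n))" (is "?A = ?B") for n
  proof -
    have "?B = (LINT y|distr lborel borel ((+) (e n *\<^sub>R u)). indicator (cbox a b) (y - e n *\<^sub>R u) * diff_quot f v y (e n))"
      by (simp add: lborel_distr_plus)
    also have "\<dots> = ?A" by (subst integral_distr) (auto simp: add_ac)
    finally show ?thesis by simp
  qed
  \<comment> \<open>The step sizes are at most 1, so one ball of radius \<open>R + norm u\<close>
    contains all the translated boxes.\<close>
  define w where "w y = indicator (cball 0 (R + norm u)) y * (L * norm v)" for y :: 'a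
  have w: "integrable lborel w"
    unfolding w_def by (intro integrable_mult_left integrable_real_indicator emeasure_bounded_finite) auto
  have fr: "AE y in lborel. y \<notin> frontier (cbox a b)"
  proof -
    have "AE y in lebesgue. y \<notin> frontier (cbox a b)"
      by (intro AE_not_in) (simp add: negligible_convex_frontier flip: negligible_iff_null_sets)
    then show ?thesis by (simp add: AE_completion_iff)
  qed
  have "(\<lambda>n. LINT y|lborel. indicator (cbox a b) (y - e n *\<^sub>R u) * diff_quot f v y (e n))
      \<longlonglongrightarrow> (LINT y|lborel. indicator (cbox a b) y * dir_deriv f v y)" (is "?T")
    and I: "integrable lborel (\<lambda>x. indicator (cbox a b) x * dir_deriv f v x)"
  proof -
    have lim: "AE y in lborel. (\<lambda>n. indicator (cbox a b) (y - e n *\<^sub>R u) * diff_quot f v y (e n))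
        \<longlonglongrightarrow> indicator (cbox a b) y * dir_deriv f v y"
      using tendsto_dir_deriv_AE[OF lip, of v] fr
    proof eventually_elim
      fix y assume t: "(diff_quot f v y \<longlongrightarrow> dir_deriv f v y) (at_right 0)" and y: "y \<notin> frontier (cbox a b)"
      have ylim: "(\<lambda>n. y - e n *\<^sub>R u) \<longlonglongrightarrow> y" using e_lim by (auto intro!: tendsto_eq_intros)
      have "eventually (\<lambda>n. indicator (cbox a b) (y - e n *\<^sub>R u) = (indicator (cbox a b) y :: real)) sequentially"
      proof (cases "y \<in> cbox a b")
        case True
        then have "y \<in> interior (cbox a b)" using y by (simp add: frontier_def)
        then have "eventually (\<lambda>n. y - e n *\<^sub>R u \<in> interior (cbox a b)) sequentially"
          using ylim by (intro topological_tendstoD) auto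
        then show ?thesis by eventually_elim (use True interior_subset[of "cbox a b"] in \<open>auto simp: indicator_def simp del: interior_cbox\<close>)
      next
        case False
        then have "eventually (\<lambda>n. y - e n *\<^sub>R u \<in> - cbox a b) sequentially"
          using ylim by (intro topological_tendstoD) auto
        then show ?thesis by eventually_elim (use False in \<open>auto simp: indicator_def\<close>)
      qed
      then have "(\<lambda>n. indicator (cbox a b) (y - e n *\<^sub>R u) :: real) \<longlonglongrightarrow> indicator (cbox a b) y"
        by (rule tendsto_eventually)
      moreover have "filterlim e (at_right 0) sequentially"
        using e_lim e by (intro filterlim_at_withinI) auto
      ultimately show "(\<lambda>n. indicator (cbox a b) (y - e n *\<^sub>R u) * diff_quot f v y (e n))
        \<longlonglongrightarrow> indicator (cbox a b) y * dir_deriv f v y"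
        using filterlim_compose[OF t] by (intro tendsto_mult) auto
    qed
    have bd: "AE y in lborel. norm (indicator (cbox a b) (y - e n *\<^sub>R u) * diff_quot f v y (e n)) \<le> w y" for n
    proof (rule AE_I2)
      fix y
      show "norm (indicator (cbox a b) (y - e n *\<^sub>R u) * diff_quot f v y (e n)) \<le> w y"
      proof (cases "y - e n *\<^sub>R u \<in> cbox a b")
        case True
        have "norm (e n *\<^sub>R u) \<le> norm u" using e[of n] by (simp add: mult_left_le_one_le)
        then have "norm y \<le> R + norm u"
          using R(2)[OF True] norm_triangle_ineq[of "y - e n *\<^sub>R u" "e n *\<^sub>R u"] by simp
        then show ?thesis using True abs_diff_quot_le[OF lip, of v y "e n"] by (simp add: w_def)
      next
        case False then show ?thesis using L0 by (simp add: w_def)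
      qed
    qed
    show ?T by (rule integral_dominated_convergence[OF _ _ w lim bd]) measurable
    show "integrable lborel (\<lambda>x. indicator (cbox a b) x * dir_deriv f v x)"
      by (rule integrable_dominated_convergence[OF _ _ w lim bd]) measurable
  qed
  then show "(\<lambda>n. LINT x|lborel. indicator (cbox a b) x * diff_quot f v (x + (1 / Suc n) *\<^sub>R u) (1 / Suc n))
      \<longlonglongrightarrow> (LINT x|lborel. indicator (cbox a b) x * dir_deriv f v x)"
    using eq by (simp add: e_def)
  show "integrable lborel (\<lambda>x. indicator (cbox a b) x * dir_deriv f v x)" by fact
  show "integrable lborel (\<lambda>x. indicator (cbox a b) x * diff_quot f v (x + (1 / Suc n) *\<^sub>R u) (1 / Suc n))" for n
  proof (rule Bochner_Integration.integrable_bound)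
    show "integrable lborel (\<lambda>x. indicator (cbox a b) x * (L * norm v))"
      by (intro integrable_mult_left integrable_real_indicator emeasure_bounded_finite) auto
    show "AE x in lborel. norm (indicator (cbox a b) x * diff_quot f v (x + (1 / Suc n) *\<^sub>R u) (1 / Suc n))
        \<le> norm (indicator (cbox a b) x * (L * norm v))"
      using abs_diff_quot_le[OF lip, of v _ "1 / Suc n"] L0 by (auto simp: indicator_def)
  qed measurable
qed

text \<open>Testing against indicators of boxes turns the translation in
  \<open>f (x + h u + h v) - f x = (f (x + h u + h v) - f (x + h u)) + (f (x + h u) - f x)\<close>
  into a translation of the box, which is harmless in the limit.\<close>

lemma dir_deriv_add_AE:
  fixes f :: "'a::euclidean_space \<Rightarrow> real"
  assumes lip: "L-lipschitz_on UNIV f"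
  shows "AE x in lborel. dir_deriv f (u + v) x = dir_deriv f u x + dir_deriv f v x"
proof -
  define F where "F x = dir_deriv f (u + v) x - dir_deriv f u x - dir_deriv f v x" for x
  have "(F has_integral 0) (cbox a b)" for a b
  proof -
    let ?I = "indicat_real (cbox a b)"
    note lim = diff_quot_shift_limit[OF lip, of a b]
    have "(LINT x|lborel. ?I x * diff_quot f (u + v) x (1 / Suc n)) =
       (LINT x|lborel. ?I x * diff_quot f u x (1 / Suc n)) +
       (LINT x|lborel. ?I x * diff_quot f v (x + (1 / Suc n) *\<^sub>R u) (1 / Suc n))" for n
    proof -
      have "?I x * diff_quot f (u + v) x (1 / Suc n) = ?I x * diff_quot f u x (1 / Suc n) +
         ?I x * diff_quot f v (x + (1 / Suc n) *\<^sub>R u) (1 / Suc n)" for x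
        by (simp add: diff_quot_def field_simps scaleR_add_right)
      then show ?thesis
        using lim(3)[of u n 0] lim(3)[of v n u] by (simp add: Bochner_Integration.integral_add)
    qed
    moreover have "(\<lambda>n. LINT x|lborel. ?I x * diff_quot f w x (1 / Suc n))
       \<longlonglongrightarrow> (LINT x|lborel. ?I x * dir_deriv f w x)" for w
      using lim(1)[of w 0] by simp
    note this[of u] this[of "u + v"]
    ultimately have "(LINT x|lborel. ?I x * dir_deriv f (u + v) x) =
       (LINT x|lborel. ?I x * dir_deriv f u x) + (LINT x|lborel. ?I x * dir_deriv f v x)"
      using lim(1)[of v u] by (intro LIMSEQ_unique[OF \<open>(\<lambda>n. LINT x|lborel. ?I x * diff_quot f (u + v) x (1 / Suc n)) \<longlonglongrightarrow> _\<close>])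
        (simp add: tendsto_add)
    moreover have "integrable lborel (\<lambda>x. ?I x * F x)"
      unfolding F_def right_diff_distrib by (intro Bochner_Integration.integrable_diff lim(2))
    moreover have "(LINT x|lborel. ?I x * F x) = (LINT x|lborel. ?I x * dir_deriv f (u + v) x) -
       (LINT x|lborel. ?I x * dir_deriv f u x) - (LINT x|lborel. ?I x * dir_deriv f v x)"
      unfolding F_def right_diff_distrib
      by (simp add: Bochner_Integration.integral_diff Bochner_Integration.integrable_diff lim(2))
    ultimately have "((\<lambda>x. ?I x * F x) has_integral 0) UNIV"
      using has_integral_integral_lborel[of "\<lambda>x. ?I x * F x"] by simp
    moreover have "(\<lambda>x. ?I x * F x) = (\<lambda>x. if x \<in> cbox a b then F x else 0)" by (auto simp: indicator_def)
    ultimately show ?thesis by (simp add: has_integral_restrict_UNIV)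
  qed
  then have "AE x in lborel. F x = 0" by (rule zero_AE_if_integral_cbox_zero)
  then show ?thesis by eventually_elim (simp add: F_def)
qed

text \<open>For negative \<open>c\<close> the directions \<open>-c *\<^sub>R v\<close> and
  \<open>c *\<^sub>R v\<close> add up to 0, whose derivative is 0; additivity then reduces the claim
  to the factor \<open>-c\<close>.\<close>

lemma dir_deriv_scaleR_AE:
  fixes f :: "'a::euclidean_space \<Rightarrow> real"
  assumes lip: "L-lipschitz_on UNIV f"
  shows "AE x in lborel. dir_deriv f (c *\<^sub>R v) x = c * dir_deriv f v x"
proof (cases "c \<ge> 0")
  case True
  show ?thesis using tendsto_dir_deriv_AE[OF lip, of v]
    by eventually_elim (rule dir_deriv_eq, rule diff_quot_scaleR_tendsto[OF _ True])
next
  case False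
  show ?thesis using tendsto_dir_deriv_AE[OF lip, of v] dir_deriv_add_AE[OF lip, of "(-c) *\<^sub>R v" "c *\<^sub>R v"]
  proof eventually_elim
    fix x assume t: "(diff_quot f v x \<longlongrightarrow> dir_deriv f v x) (at_right 0)"
      and a: "dir_deriv f ((-c) *\<^sub>R v + c *\<^sub>R v) x = dir_deriv f ((-c) *\<^sub>R v) x + dir_deriv f (c *\<^sub>R v) x"
    have "dir_deriv f 0 x = 0" by (rule dir_deriv_eq) (simp add: diff_quot_def[abs_def])
    moreover have "dir_deriv f ((-c) *\<^sub>R v) x = (-c) * dir_deriv f v x"
      by (rule dir_deriv_eq, rule diff_quot_scaleR_tendsto[OF t]) (use False in simp)
    ultimately show "dir_deriv f (c *\<^sub>R v) x = c * dir_deriv f v x" using a by simp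
  qed
qed

text \<open>Each use of additivity and homogeneity has its own null set of exceptions; for a fixed
  \<open>u\<close> only finitely many are combined, along the basis expansion of
  \<open>u\<close>.\<close>

lemma dir_deriv_linear_AE:
  fixes f :: "'a::euclidean_space \<Rightarrow> real"
  assumes lip: "L-lipschitz_on UNIV f"
  shows "AE x in lborel. dir_deriv f u x = (\<Sum>i\<in>Basis. (u \<bullet> i) * dir_deriv f i x)"
proof -
  have "AE x in lborel. dir_deriv f (\<Sum>i\<in>S. (u \<bullet> i) *\<^sub>R i) x = (\<Sum>i\<in>S. (u \<bullet> i) * dir_deriv f i x)"
    if "finite S" for S :: "'a set"
    using that
  proof induction
    case empty
    have "dir_deriv f 0 x = 0" for x by (rule dir_deriv_eq) (simp add: diff_quot_def[abs_def])
    then show ?case by simp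
  next
    case (insert j S)
    have "AE x in lborel. dir_deriv f ((u \<bullet> j) *\<^sub>R j + (\<Sum>i\<in>S. (u \<bullet> i) *\<^sub>R i)) x =
        dir_deriv f ((u \<bullet> j) *\<^sub>R j) x + dir_deriv f (\<Sum>i\<in>S. (u \<bullet> i) *\<^sub>R i) x"
      by (rule dir_deriv_add_AE[OF lip])
    then show ?case using insert.IH dir_deriv_scaleR_AE[OF lip, of "u \<bullet> j" j]
      by eventually_elim (use insert.hyps in simp)
  qed
  from this[of Basis] show ?thesis by (simp add: euclidean_representation)
qed

text \<open>The exceptional null set depends on the direction, so linearity is available only for
  countably many directions at once, here a dense set. At a point outside all these null sets,
  compactness of the unit sphere leaves finitely many directions, for which the difference quotients
  converge simultaneously; the Lipschitz bound carries the estimate over to every other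
  direction.\<close>

theorem rademacher:
  fixes f :: "'a::euclidean_space \<Rightarrow> real"
  assumes lip: "L-lipschitz_on UNIV f"
  shows "AE x in lebesgue. f differentiable (at x)"
proof -
  have L0: "L \<ge> 0" using lip by (rule lipschitz_on_nonneg)
  obtain D :: "'a set" where D: "countable D" "\<And>X. open X \<Longrightarrow> X \<noteq> {} \<Longrightarrow> \<exists>d\<in>D. d \<in> X"
    using countable_dense_setE[where 'a = 'a] by blast
  have "AE x in lborel. \<forall>u\<in>D. (diff_quot f u x \<longlongrightarrow> dir_deriv f u x) (at_right 0) \<and>
      dir_deriv f u x = (\<Sum>i\<in>Basis. (u \<bullet> i) * dir_deriv f i x)"
    using D(1) tendsto_dir_deriv_AE[OF lip] dir_deriv_linear_AE[OF lip] by (simp add: AE_ball_countable)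
  then have "AE x in lborel. f differentiable (at x)"
  proof eventually_elim
    fix x
    assume x: "\<forall>u\<in>D. (diff_quot f u x \<longlongrightarrow> dir_deriv f u x) (at_right 0) \<and>
      dir_deriv f u x = (\<Sum>i\<in>Basis. (u \<bullet> i) * dir_deriv f i x)"
    define p where "p = (\<Sum>i\<in>Basis. dir_deriv f i x *\<^sub>R i)"
    have lim: "(diff_quot f u x \<longlongrightarrow> p \<bullet> u) (at_right 0)" if "u \<in> D" for u
    proof -
      have "p \<bullet> u = dir_deriv f u x"
        using x that by (simp add: p_def inner_sum_left) (simp add: inner_commute mult.commute)
      moreover have "(diff_quot f u x \<longlongrightarrow> dir_deriv f u x) (at_right 0)" using x that by blast
      ultimately show ?thesis by (simp only:)
    qed
    have "(f has_derivative (\<lambda>y. p \<bullet> y)) (at x)"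
      unfolding has_derivative_at_alt
    proof (intro conjI allI impI)
      show "bounded_linear ((\<bullet>) p)" by (rule bounded_linear_inner_right)
      fix e :: real assume "e > 0"
      \<comment> \<open>Three errors share \<open>e\<close>: replacing the direction
        \<open>w\<close> by the nearby \<open>u\<close> costs \<open>L * h * \<eta>\<close> in
        \<open>f\<close> and \<open>norm p * h * \<eta>\<close> in the linear part, and the
        difference quotient along \<open>u\<close> costs \<open>h * \<eta>\<close>.\<close>
      define \<eta> where "\<eta> = e / (1 + L + norm p)"
      have \<eta>: "\<eta> > 0" using \<open>e > 0\<close> L0 by (simp add: \<eta>_def add_pos_nonneg)
      have "sphere 0 1 \<subseteq> (\<Union>u\<in>D. ball u \<eta>)"
      proof
        fix w :: 'a
        obtain u where "u \<in> D" "u \<in> ball w \<eta>" using D(2)[of "ball w \<eta>"] \<eta> by auto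
        then show "w \<in> (\<Union>u\<in>D. ball u \<eta>)" by (auto simp: dist_commute)
      qed
      then obtain D' where D': "D' \<subseteq> D" "finite D'" "sphere 0 1 \<subseteq> (\<Union>u\<in>D'. ball u \<eta>)"
        using compactE_image[OF compact_sphere, of D "\<lambda>u. ball u \<eta>"] by (metis open_ball)
      have "eventually (\<lambda>h. \<forall>u\<in>D'. \<bar>diff_quot f u x h - p \<bullet> u\<bar> < \<eta>) (at_right 0)"
      proof (intro eventually_ball_finite ballI)
        fix u assume "u \<in> D'"
        then show "\<forall>\<^sub>F h in at_right 0. \<bar>diff_quot f u x h - p \<bullet> u\<bar> < \<eta>"
          using tendstoD[OF lim \<eta>, of u] D'(1) by (auto simp: dist_real_def)
      qed (rule D'(2))
      then obtain d where "d > 0" and *: "\<forall>h>0. h < d \<longrightarrow> (\<forall>u\<in>D'. \<bar>diff_quot f u x h - p \<bullet> u\<bar> < \<eta>)"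
        unfolding eventually_at_right_field by blast
      then have d: "d > 0" "\<And>h u. 0 < h \<Longrightarrow> h < d \<Longrightarrow> u \<in> D' \<Longrightarrow> \<bar>diff_quot f u x h - p \<bullet> u\<bar> < \<eta>"
        by blast+
      show "\<exists>d>0. \<forall>y. norm (y - x) < d \<longrightarrow> norm (f y - f x - p \<bullet> (y - x)) \<le> e * norm (y - x)"
      proof (intro exI conjI allI impI)
        fix y assume y: "norm (y - x) < d"
        show "norm (f y - f x - p \<bullet> (y - x)) \<le> e * norm (y - x)"
        proof (cases "y = x")
          case False
          define h where "h = norm (y - x)"
          define w where "w = (y - x) /\<^sub>R h"
          have h: "h > 0" "h < d" using False y by (auto simp: h_def)
          have yw: "y = x + h *\<^sub>R w" using h by (simp add: w_def)
          have "w \<in> sphere 0 1" using h by (simp add: w_def h_def)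
          then obtain u where u: "u \<in> D'" "norm (w - u) < \<eta>" using D'(3) by (auto simp: dist_norm norm_minus_commute)
          have q: "\<bar>f (x + h *\<^sub>R u) - f x - h * (p \<bullet> u)\<bar> \<le> h * \<eta>"
          proof -
            have "f (x + h *\<^sub>R u) - f x - h * (p \<bullet> u) = h * (diff_quot f u x h - p \<bullet> u)"
              using h by (simp add: diff_quot_def field_simps)
            then show ?thesis using d(2)[OF h u(1)] h by (simp add: abs_mult)
          qed
          have r: "\<bar>f y - f (x + h *\<^sub>R u)\<bar> \<le> L * (h * \<eta>)"
          proof -
            have "dist y (x + h *\<^sub>R u) = h * norm (w - u)"
              using h unfolding yw by (simp add: dist_norm flip: scaleR_diff_right)
            also have "\<dots> \<le> h * \<eta>" using u h by simp
            finally have "L * dist y (x + h *\<^sub>R u) \<le> L * (h * \<eta>)" using L0 by (rule mult_left_mono)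
            then show ?thesis using lipschitz_onD[OF lip, of y "x + h *\<^sub>R u"] by (simp add: dist_real_def)
          qed
          have s: "\<bar>h * (p \<bullet> (u - w))\<bar> \<le> norm p * (h * \<eta>)"
          proof -
            have "\<bar>p \<bullet> (u - w)\<bar> \<le> norm p * norm (u - w)" by (rule Cauchy_Schwarz_ineq2)
            also have "\<dots> \<le> norm p * \<eta>" using u by (intro mult_left_mono) (auto simp: norm_minus_commute)
            finally have "h * \<bar>p \<bullet> (u - w)\<bar> \<le> h * (norm p * \<eta>)" using h by (intro mult_left_mono) auto
            then show ?thesis using h by (simp add: abs_mult mult_ac)
          qed
          have "p \<bullet> (y - x) = h * (p \<bullet> w)" by (simp add: yw)
          moreover have "h * (p \<bullet> (u - w)) = h * (p \<bullet> u) - h * (p \<bullet> w)"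
            by (simp add: inner_diff_right right_diff_distrib)
          ultimately have "\<bar>f y - f x - p \<bullet> (y - x)\<bar> \<le> L * (h * \<eta>) + h * \<eta> + norm p * (h * \<eta>)"
            using q r s by linarith
          also have "\<dots> = (1 + L + norm p) * \<eta> * h" by (simp add: algebra_simps)
          also have "(1 + L + norm p) * \<eta> = e" using L0 by (simp add: \<eta>_def add_pos_nonneg add_nonneg_eq_0_iff)
          finally show ?thesis by (simp add: h_def)
        qed simp
      qed (rule d(1))
    qed
    then show "f differentiable (at x)" unfolding differentiable_def by blast
  qed
  then show ?thesis by (rule AE_completion)
qed

text \<open>McShane's extension: the lower envelope of the cones \<open>f z + L * dist x z\<close>
  with vertices over \<open>S\<close>. Each cone is \<open>L\<close>-Lipschitz, and the bound on
  \<open>f\<close> keeps every cone above the graph of \<open>f\<close> over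
  \<open>S\<close>.\<close>

lemma lipschitz_on_extend_UNIV:
  fixes f :: "'a::metric_space \<Rightarrow> real"
  assumes lip: "L-lipschitz_on S f"
  obtains g where "L-lipschitz_on UNIV g" "\<And>x. x \<in> S \<Longrightarrow> g x = f x"
proof (cases "S = {}")
  case True
  show thesis by (rule that[of "\<lambda>_. 0"])
    (use True lipschitz_on_nonneg[OF lip] in \<open>auto intro!: lipschitz_onI\<close>)
next
  case False
  then obtain z0 where z0: "z0 \<in> S" by blast
  have L0: "L \<ge> 0" using lip by (rule lipschitz_on_nonneg)
  have fl: "f z \<le> f w + L * dist z w" if "z \<in> S" "w \<in> S" for z w
    using lipschitz_onD[OF lip that] by (simp add: dist_real_def abs_le_iff)
  define g where "g x = (INF z\<in>S. f z + L * dist x z)" for x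
  have bdd: "bdd_below ((\<lambda>z. f z + L * dist x z) ` S)" for x
  proof (rule bdd_belowI2)
    fix z assume z: "z \<in> S"
    have "L * dist z0 z \<le> L * (dist x z0 + dist x z)"
      using L0 by (intro mult_left_mono) (auto simp: dist_triangle3)
    then show "f z0 - L * dist x z0 \<le> f z + L * dist x z"
      using fl[OF z0 z] by (simp add: algebra_simps)
  qed
  have le: "g x \<le> g y + L * dist x y" for x y
  proof -
    have "g x - L * dist x y \<le> f z + L * dist y z" if "z \<in> S" for z
    proof -
      have "g x \<le> f z + L * dist x z" unfolding g_def by (rule cINF_lower[OF bdd that])
      also have "L * dist x z \<le> L * (dist x y + dist y z)"
        using L0 by (intro mult_left_mono dist_triangle)
      finally show ?thesis by (simp add: algebra_simps)
    qed
    then have "g x - L * dist x y \<le> g y" unfolding g_def[of y] by (intro cINF_greatest[OF False])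
    then show ?thesis by simp
  qed
  show thesis
  proof (rule that)
    show "L-lipschitz_on UNIV g"
      proof (rule lipschitz_onI)
      fix x y show "dist (g x) (g y) \<le> L * dist x y"
        using le[of x y] le[of y x] by (simp add: dist_real_def abs_le_iff dist_commute)
    qed (rule L0)
    fix x assume x: "x \<in> S"
    have "g x \<le> f x" unfolding g_def using cINF_lower[OF bdd x, of x] by simp
    moreover have "f x \<le> g x" unfolding g_def by (intro cINF_greatest[OF False] fl x)
    ultimately show "g x = f x" by simp
  qed
qed

text \<open>By Lindelof's theorem countably many open sets with a Lipschitz bound cover
  \<open>D\<close>. On each of them \<open>f\<close> agrees with a globally Lipschitz function, and
  on an open set agreement transfers the derivative.\<close>

corollary locally_lipschitz_on_differentiable_AE:
  fixes f :: "'a::euclidean_space \<Rightarrow> real"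
  assumes "open D" and loc: "locally_lipschitz_on D f"
  shows "AE x in lebesgue. x \<in> D \<longrightarrow> f differentiable (at x)"
proof -
  define \<F> where "\<F> = {B. open B \<and> B \<subseteq> D \<and> (\<exists>L. L-lipschitz_on B f)}"
  obtain \<F>' where F': "\<F>' \<subseteq> \<F>" "countable \<F>'" "\<Union>\<F>' = \<Union>\<F>"
    by (rule Lindelof[of \<F>]) (auto simp: \<F>_def)
  have "D \<subseteq> \<Union>\<F>"
  proof
    fix x assume "x \<in> D"
    then obtain e L where "e > 0" "L-lipschitz_on (ball x e \<inter> D) f"
      using loc unfolding locally_lipschitz_on_def by blast
    then have "ball x e \<inter> D \<in> \<F>" using \<open>open D\<close> by (auto simp: \<F>_def)
    then show "x \<in> \<Union>\<F>" by (rule UnionI) (use \<open>x \<in> D\<close> \<open>e > 0\<close> in auto)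
  qed
  have *: "AE x in lebesgue. x \<in> B \<longrightarrow> f differentiable (at x)" if "B \<in> \<F>'" for B
  proof -
    from that F'(1) obtain L where B: "open B" and L: "L-lipschitz_on B f" by (auto simp: \<F>_def)
    obtain g where g: "L-lipschitz_on UNIV g" "\<And>x. x \<in> B \<Longrightarrow> g x = f x"
      using lipschitz_on_extend_UNIV[OF L] by blast
    show ?thesis using rademacher[OF g(1)]
    proof eventually_elim
      fix x assume "g differentiable (at x)"
      then show "x \<in> B \<longrightarrow> f differentiable (at x)"
        using g(2) B unfolding differentiable_def by (metis has_derivative_transform_within_open)
    qed
  qed
  then have "AE x in lebesgue. \<forall>B\<in>\<F>'. x \<in> B \<longrightarrow> f differentiable (at x)"
    by (intro iffD2[OF AE_ball_countable[OF F'(2)]] ballI *)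
  then show ?thesis
  proof eventually_elim
    fix x assume "\<forall>B\<in>\<F>'. x \<in> B \<longrightarrow> f differentiable (at x)"
    moreover have "x \<in> D \<Longrightarrow> x \<in> \<Union>\<F>'" unfolding F'(3) using \<open>D \<subseteq> \<Union>\<F>\<close> by (rule subsetD)
    ultimately show "x \<in> D \<longrightarrow> f differentiable (at x)" by (metis UnionE)
  qed
qed

section \<open>Caratheodory solutions and Gronwall estimates\<close>

lemma bounded_measurable_integral:
  fixes h :: "real \<Rightarrow> 'a::euclidean_space"
  assumes h: "h \<in> borel_measurable (lebesgue_on {a..b})" and M: "\<And>s. s \<in> {a..b} \<Longrightarrow> norm (h s) \<le> M"
  shows "h absolutely_integrable_on {a..b}"
    and "\<lbrakk>s \<in> {a..b}; t \<in> {a..b}; s \<le> t\<rbrakk> \<Longrightarrow> integral {a..t} h - integral {a..s} h = integral {s..t} h"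
    and "\<lbrakk>s \<in> {a..b}; t \<in> {a..b}\<rbrakk> \<Longrightarrow> norm (integral {a..t} h - integral {a..s} h) \<le> M * \<bar>t - s\<bar>"
proof -
  show ai: "h absolutely_integrable_on {a..b}"
    by (rule measurable_bounded_by_integrable_imp_absolutely_integrable[where g = "\<lambda>_. M"]) (use h M in auto)
  then have int: "h integrable_on {a..b}" by (simp add: set_lebesgue_integral_eq_integral)
  show eq: "integral {a..t} h - integral {a..s} h = integral {s..t} h"
    if "s \<in> {a..b}" "t \<in> {a..b}" "s \<le> t" for s t
  proof -
    have "h integrable_on {a..t}" by (rule integrable_on_subinterval[OF int]) (use that in auto)
    then have "integral {a..s} h + integral {s..t} h = integral {a..t} h"
      using that by (intro Henstock_Kurzweil_Integration.integral_combine) auto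
    then show ?thesis by (metis add_diff_cancel_left')
  qed
  have le: "norm (integral {a..t} h - integral {a..s} h) \<le> M * (t - s)"
    if st: "s \<in> {a..b}" "t \<in> {a..b}" "s \<le> t" for s t
  proof -
    have "h integrable_on {s..t}" by (rule integrable_on_subinterval[OF int]) (use st in auto)
    then have "norm (integral {s..t} h) \<le> integral {s..t} (\<lambda>_. M)"
      by (rule integral_norm_bound_integral) (use st M in auto)
    then show ?thesis using eq[OF st] st by (simp add: mult.commute)
  qed
  show "norm (integral {a..t} h - integral {a..s} h) \<le> M * \<bar>t - s\<bar>"
    if "s \<in> {a..b}" "t \<in> {a..b}"
  proof (cases "s \<le> t")
    case True then show ?thesis using le[OF that] by simp
  next
    case False then show ?thesis using le[OF that(2,1)] by (simp add: norm_minus_commute)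
  qed
qed

text \<open>Peano's theorem under Caratheodory's conditions, by Tonelli's delayed approximations
  \<open>x' (t) = \<Phi> t (x (t - d))\<close>, which are solved step by step on intervals of length \<open>d\<close>.\<close>

theorem caratheodory_existence:
  fixes \<Phi> :: "real \<Rightarrow> 'a::euclidean_space \<Rightarrow> 'a"
  assumes T: "T \<ge> 0"
    and cont: "\<And>s. s \<in> {0..T} \<Longrightarrow> continuous_on UNIV (\<Phi> s)"
    and bound: "\<And>s x. s \<in> {0..T} \<Longrightarrow> norm (\<Phi> s x) \<le> M"
    and meas: "\<And>X. continuous_on {0..T} X \<Longrightarrow> (\<lambda>s. \<Phi> s (X s)) \<in> borel_measurable (lebesgue_on {0..T})"
  obtains X where "continuous_on {0..T} X"
    and "\<And>t. t \<in> {0..T} \<Longrightarrow> X t = x0 + integral {0..t} (\<lambda>s. \<Phi> s (X s))"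
proof -
  have M0: "M \<ge> 0" using bound[of 0 0] T norm_ge_zero[of "\<Phi> 0 0"] by (simp add: order_trans[OF norm_ge_zero])
  \<comment> \<open>Cutting the delayed time off at 0 lets the value at time 0 serve as the
    history.\<close>
  define dl where "dl d s = max 0 (s - d)" for d s :: real
  define P where "P d X t = x0 + integral {0..t} (\<lambda>s. \<Phi> s (X (dl d s)))" for d and X :: "real \<Rightarrow> 'a" and t
  have dl: "dl d s \<in> {0..T}" "dl d s \<le> s" if "s \<in> {0..T}" "d > 0" for d s using that by (auto simp: dl_def)
  have contX: "continuous_on {0..T} X" if "M-lipschitz_on {0..T} X" for X :: "real \<Rightarrow> 'a"
    using that by (rule lipschitz_on_continuous_on)
  have measd: "(\<lambda>s. \<Phi> s (X (dl d s))) \<in> borel_measurable (lebesgue_on {0..T})"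
    if "M-lipschitz_on {0..T} X" "d > 0" for X d
    by (rule meas, rule continuous_on_compose2[OF contX[OF that(1)]])
       (use dl that in \<open>auto simp: dl_def intro!: continuous_intros\<close>)
  have Plip: "M-lipschitz_on {0..T} (P d X)" if "M-lipschitz_on {0..T} X" "d > 0" for X d
  proof (rule lipschitz_onI)
    fix s t assume st: "s \<in> {0..T}" "t \<in> {0..T}"
    have "norm (integral {0..s} (\<lambda>s. \<Phi> s (X (dl d s))) - integral {0..t} (\<lambda>s. \<Phi> s (X (dl d s)))) \<le> M * \<bar>s - t\<bar>"
      by (rule bounded_measurable_integral(3)[OF measd[OF that]]) (use bound st in auto)
    then show "dist (P d X s) (P d X t) \<le> M * dist s t" by (simp add: dist_norm P_def)
  qed (rule M0)
  \<comment> \<open>Up to time \<open>(n + 1) * d\<close> the operator \<open>P d\<close> reads its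
    argument only up to time \<open>n * d\<close>, where the fixed point equation already holds.
    Applying \<open>P d\<close> once more therefore extends the range of validity by
    \<open>d\<close>.\<close>
  have step: "\<exists>X. M-lipschitz_on {0..T} X \<and> (\<forall>t\<in>{0..T}. t \<le> real n * d \<longrightarrow> X t = P d X t)"
    if d: "d > 0" for n and d :: real
  proof (induction n)
    case 0
    have "M-lipschitz_on {0..T} (\<lambda>_. x0)" using M0 by (auto intro!: lipschitz_onI)
    then show ?case by (intro exI[of _ "\<lambda>_. x0"]) (auto simp: P_def)
  next
    case (Suc n)
    then obtain X where X: "M-lipschitz_on {0..T} X" "\<And>t. t \<in> {0..T} \<Longrightarrow> t \<le> real n * d \<Longrightarrow> X t = P d X t" by blast
    have "P d X t = P d (P d X) t" if t: "t \<in> {0..T}" "t \<le> real (Suc n) * d" for t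
    proof -
      have "X (dl d s) = P d X (dl d s)" if "s \<in> {0..t}" for s
      proof (rule X(2))
        have "s - d \<le> real n * d" using that t by (simp add: algebra_simps)
        then show "dl d s \<le> real n * d" using d by (simp add: dl_def)
        show "dl d s \<in> {0..T}" using that t dl d by auto
      qed
      then have "integral {0..t} (\<lambda>s. \<Phi> s (X (dl d s))) = integral {0..t} (\<lambda>s. \<Phi> s (P d X (dl d s)))"
        by (intro integral_cong) simp
      then show ?thesis unfolding P_def[of d X t] P_def[of d "P d X" t] by simp
    qed
    then show ?case using Plip[OF X(1) d] by blast
  qed
  define e where "e k = 1 / real (Suc k)" for k
  have e: "e k > 0" for k by (simp add: e_def)
  have "\<exists>X. M-lipschitz_on {0..T} X \<and> (\<forall>t\<in>{0..T}. X t = P (e k) X t)" for k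
  proof -
    obtain n where "T / e k \<le> real n" using real_arch_simple by blast
    then have "T \<le> real n * e k" using e[of k] by (simp add: field_simps)
    then have "\<And>t. t \<in> {0..T} \<Longrightarrow> t \<le> real n * e k" by auto
    then show ?thesis using step[OF e[of k], of n] by blast
  qed
  then obtain X where Xl: "\<And>k. M-lipschitz_on {0..T} (X k)"
    and XP: "\<And>k t. t \<in> {0..T} \<Longrightarrow> X k t = P (e k) (X k) t" by metis
  have Xd: "norm (X k s - X k t) \<le> M * \<bar>s - t\<bar>" if "s \<in> {0..T}" "t \<in> {0..T}" for k s t
    using lipschitz_onD[OF Xl that] by (simp add: dist_norm)
  have X0: "X k 0 = x0" for k using XP[of 0 k] T by (simp add: P_def)
  obtain g k where g: "continuous_on {0..T} g" and k: "strict_mono (k :: nat \<Rightarrow> nat)"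
    and lim: "\<And>e. 0 < e \<Longrightarrow> \<exists>N. \<forall>n x. n \<ge> N \<and> x \<in> {0..T} \<longrightarrow> norm (X (k n) x - g x) < e"
  proof (rule Arzela_Ascoli[of "{0..T}" X "norm x0 + M * T"])
    fix n x assume x: "x \<in> {0..T}"
    have "norm (X n x) \<le> norm (X n 0) + norm (X n x - X n 0)" by (metis norm_triangle_sub add.commute)
    also have "\<dots> \<le> norm x0 + M * T"
    proof (rule add_mono)
      have "norm (X n x - X n 0) \<le> M * \<bar>x - 0\<bar>" using x T by (intro Xd) auto
      also have "\<dots> \<le> M * T" using x M0 by (intro mult_left_mono) auto
      finally show "norm (X n x - X n 0) \<le> M * T" .
    qed (simp add: X0)
    finally show "norm (X n x) \<le> norm x0 + M * T" .
  next
    fix x r :: real assume x: "x \<in> {0..T}" "0 < r"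
    show "\<exists>d>0. \<forall>n y. y \<in> {0..T} \<and> norm (x - y) < d \<longrightarrow> norm (X n x - X n y) < r"
    proof (intro exI conjI allI impI)
      show "r / (M + 1) > 0" using x M0 by simp
      fix n y assume y: "y \<in> {0..T} \<and> norm (x - y) < r / (M + 1)"
      have "norm (X n x - X n y) \<le> M * \<bar>x - y\<bar>" using Xd x y by blast
      also have "\<dots> \<le> (M + 1) * \<bar>x - y\<bar>" by (intro mult_right_mono) auto
      also have "\<dots> < r" using y M0 by (simp add: field_simps)
      finally show "norm (X n x - X n y) < r" .
    qed
  qed auto
  have ptw: "(\<lambda>n. X (k n) t) \<longlonglongrightarrow> g t" if "t \<in> {0..T}" for t
    unfolding LIMSEQ_iff using lim that by (metis (no_types, lifting))
  have e0: "(\<lambda>n. e (k n)) \<longlonglongrightarrow> 0"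
    using LIMSEQ_subseq_LIMSEQ[OF LIMSEQ_Suc[OF lim_1_over_n[where 'a = real]] k] by (simp add: e_def o_def)
  \<comment> \<open>All approximations share the Lipschitz constant \<open>M\<close>, so a delay
    that tends to 0 does not affect the limit.\<close>
  have dlim: "(\<lambda>n. X (k n) (dl (e (k n)) s)) \<longlonglongrightarrow> g s" if s: "s \<in> {0..T}" for s
  proof -
    have "(\<lambda>n. X (k n) (dl (e (k n)) s) - X (k n) s) \<longlonglongrightarrow> 0"
    proof (rule Lim_null_comparison)
      show "\<forall>\<^sub>F n in sequentially. norm (X (k n) (dl (e (k n)) s) - X (k n) s) \<le> M * e (k n)"
      proof (rule always_eventually, rule allI)
        fix n
        have "norm (X (k n) (dl (e (k n)) s) - X (k n) s) \<le> M * \<bar>dl (e (k n)) s - s\<bar>"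
          by (rule Xd[OF dl(1)[OF s e] s])
        also have "\<dots> \<le> M * e (k n)" using s e[of "k n"] M0 by (intro mult_left_mono) (auto simp: dl_def)
        finally show "norm (X (k n) (dl (e (k n)) s) - X (k n) s) \<le> M * e (k n)" .
      qed
      show "(\<lambda>n. M * e (k n)) \<longlonglongrightarrow> 0" using tendsto_mult_right_zero[OF e0] .
    qed
    from tendsto_add[OF this ptw[OF s]] show ?thesis by simp
  qed
  show thesis
  proof (rule that[OF g])
    fix t assume t: "t \<in> {0..T}"
    have "(\<lambda>n. integral {0..t} (\<lambda>s. \<Phi> s (X (k n) (dl (e (k n)) s)))) \<longlonglongrightarrow> integral {0..t} (\<lambda>s. \<Phi> s (g s))"
    proof (rule dominated_convergence(2)[where h = "\<lambda>_. M"])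
      fix n
      have "(\<lambda>s. \<Phi> s (X (k n) (dl (e (k n)) s))) absolutely_integrable_on {0..T}"
        by (rule bounded_measurable_integral(1)[OF measd[OF Xl e]]) (rule bound)
      then show "(\<lambda>s. \<Phi> s (X (k n) (dl (e (k n)) s))) integrable_on {0..t}"
        using integrable_on_subinterval[OF set_lebesgue_integral_eq_integral(1)] t by (metis atLeastatMost_subset_iff order_refl atLeastAtMost_iff)
    next
      fix s assume "s \<in> {0..t}"
      then have s: "s \<in> {0..T}" using t by auto
      then show "norm (\<Phi> s (X (k n) (dl (e (k n)) s))) \<le> M" for n by (rule bound)
      show "(\<lambda>n. \<Phi> s (X (k n) (dl (e (k n)) s))) \<longlonglongrightarrow> \<Phi> s (g s)"
        by (rule continuous_on_tendsto_compose[OF cont[OF s] dlim[OF s]]) auto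
    qed auto
    then have "(\<lambda>n. X (k n) t) \<longlonglongrightarrow> x0 + integral {0..t} (\<lambda>s. \<Phi> s (g s))"
      using XP[OF t] by (auto simp: P_def intro!: tendsto_intros)
    then show "g t = x0 + integral {0..t} (\<lambda>s. \<Phi> s (g s))"
      using ptw[OF t] LIMSEQ_unique by blast
  qed
qed

text \<open>A continuous function with nonpositive upper right derivative cannot increase. Up to an
  arbitrarily small linear drift the inequality holds on a maximal initial interval, closed by
  continuity; if it ended before \<open>b\<close>, the slope condition at its right end would
  prolong it.\<close>

lemma antimono_from_right_slope:
  fixes \<psi> :: "real \<Rightarrow> real"
  assumes ab: "a \<le> b" and cont: "continuous_on {a..b} \<psi>"
    and slope: "\<And>t \<epsilon>. t \<in> {a..<b} \<Longrightarrow> \<epsilon> > 0 \<Longrightarrow> \<exists>d>0. \<forall>s. t < s \<and> s < t + d \<and> s \<le> b \<longrightarrow> \<psi> s \<le> \<psi> t + \<epsilon> * (s - t)"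
  shows "\<psi> b \<le> \<psi> a"
proof (rule field_le_epsilon)
  fix e :: real assume "e > 0"
  define \<epsilon> where "\<epsilon> = e / (b - a + 1)"
  have \<epsilon>: "\<epsilon> > 0" using \<open>e > 0\<close> ab by (simp add: \<epsilon>_def)
  define A where "A = {t \<in> {a..b}. \<psi> t \<le> \<psi> a + \<epsilon> * (t - a)}"
  \<comment> \<open>The whole interval up to \<open>t\<close> is required, so that every point below
    the supremum belongs to \<open>A\<close>.\<close>
  define S where "S = {t \<in> {a..b}. {a..t} \<subseteq> A}"
  have aS: "a \<in> S" using ab by (auto simp: S_def A_def)
  define \<tau> where "\<tau> = Sup S"
  have bdd: "bdd_above S" by (auto simp: S_def)
  have "S \<noteq> {}" "\<And>t. t \<in> S \<Longrightarrow> t \<le> b" using aS by (auto simp: S_def)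
  then have \<tau>: "a \<le> \<tau>" "\<tau> \<le> b" unfolding \<tau>_def
    by (rule_tac [2] cSup_least) (auto intro: cSup_upper[OF aS bdd])
  have "closed A"
  proof -
    have "A = {t \<in> {a..b}. \<psi> t - (\<psi> a + \<epsilon> * (t - a)) \<le> 0}" by (auto simp: A_def)
    also have "closed \<dots>"
      by (intro continuous_closed_preimage[of "{a..b}" "\<lambda>t. \<psi> t - (\<psi> a + \<epsilon> * (t - a))" "{..0}",
            unfolded vimage_def Int_def mem_Collect_eq atMost_iff] continuous_intros cont)
    finally show ?thesis .
  qed
  have below: "t \<in> A" if t: "a \<le> t" "t < \<tau>" for t
  proof -
    obtain s where "s \<in> S" "t < s" using t less_cSup_iff[OF \<open>S \<noteq> {}\<close> bdd, of t] unfolding \<tau>_def by blast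
    then show ?thesis using t by (auto simp: S_def)
  qed
  have \<tau>A: "\<tau> \<in> A"
  proof (cases "\<tau> = a")
    case True then show ?thesis using ab by (simp add: A_def)
  next
    case False
    then have "a < \<tau>" using \<tau> by simp
    then have "{a<..<\<tau>} \<subseteq> A" using below by auto
    then have "closure {a<..<\<tau>} \<subseteq> A" using \<open>closed A\<close> by (rule closure_minimal)
    then show ?thesis using \<open>a < \<tau>\<close> by auto
  qed
  have "\<tau> = b"
  proof (rule ccontr)
    assume "\<tau> \<noteq> b"
    then have lt: "\<tau> < b" using \<tau> by simp
    then obtain d where d: "d > 0" "\<And>s. \<tau> < s \<Longrightarrow> s < \<tau> + d \<Longrightarrow> s \<le> b \<Longrightarrow> \<psi> s \<le> \<psi> \<tau> + \<epsilon> * (s - \<tau>)"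
      using slope[of \<tau> \<epsilon>] \<tau> \<epsilon> by auto
    define s where "s = min b (\<tau> + d / 2)"
    have s: "\<tau> < s" "s \<le> b" using lt d by (auto simp: s_def)
    have "x \<in> A" if "x \<in> {a..s}" for x
    proof (cases "x \<le> \<tau>")
      case True then show ?thesis using below \<tau>A that by (cases "x = \<tau>") auto
    next
      case False
      have "\<psi> x \<le> \<psi> \<tau> + \<epsilon> * (x - \<tau>)" using False that d(1) s by (intro d(2)) (auto simp: s_def min_def split: if_splits)
      moreover have "\<psi> \<tau> \<le> \<psi> a + \<epsilon> * (\<tau> - a)" using \<tau>A by (simp add: A_def)
      ultimately show ?thesis using that s by (simp add: A_def algebra_simps)
    qed
    then have "s \<in> S" using s \<tau> by (auto simp: S_def)
    then have "s \<le> \<tau>" unfolding \<tau>_def using bdd by (rule cSup_upper)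
    then show False using s by simp
  qed
  then have "\<psi> b \<le> \<psi> a + \<epsilon> * (b - a)" using \<tau>A by (simp add: A_def)
  also have "\<epsilon> * (b - a) \<le> e" using \<open>e > 0\<close> ab by (simp add: \<epsilon>_def field_simps)
  finally show "\<psi> b \<le> \<psi> a + e" by simp
qed

text \<open>Multiplication by \<open>exp (- C * (t - a))\<close> turns the growth condition into a
  nonpositive right slope, because \<open>exp (- C * h) * (1 + C * h) \<le> 1\<close>. Right slopes
  suit both intended uses: a Lyapunov function along a curve, and the norm of the difference of two
  curves, neither of which need be differentiable in time.\<close>

lemma gronwall_right_slope:
  fixes \<phi> :: "real \<Rightarrow> real"
  assumes ab: "a \<le> b" and cont: "continuous_on {a..b} \<phi>" and C: "C \<ge> 0"
    and nn: "\<And>t. t \<in> {a..b} \<Longrightarrow> \<phi> t \<ge> 0"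
    and slope: "\<And>t \<epsilon>. t \<in> {a..<b} \<Longrightarrow> \<epsilon> > 0 \<Longrightarrow>
      \<exists>d>0. \<forall>s. t < s \<and> s < t + d \<and> s \<le> b \<longrightarrow> \<phi> s \<le> \<phi> t + (s - t) * (C * \<phi> t + \<epsilon>)"
  shows "\<phi> b \<le> exp (C * (b - a)) * \<phi> a"
proof -
  define \<psi> where "\<psi> t = exp (- C * (t - a)) * \<phi> t" for t
  have "\<psi> b \<le> \<psi> a"
  proof (rule antimono_from_right_slope[OF ab])
    show "continuous_on {a..b} \<psi>" unfolding \<psi>_def by (intro continuous_intros cont)
    fix t \<epsilon> :: real assume t: "t \<in> {a..<b}" and \<epsilon>: "\<epsilon> > 0"
    obtain d where d: "d > 0" "\<And>s. t < s \<Longrightarrow> s < t + d \<Longrightarrow> s \<le> b \<Longrightarrow> \<phi> s \<le> \<phi> t + (s - t) * (C * \<phi> t + \<epsilon>)"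
      using slope[OF t \<epsilon>] by blast
    have "\<psi> s \<le> \<psi> t + \<epsilon> * (s - t)" if s: "t < s" "s < t + d" "s \<le> b" for s
    proof -
      have e1: "exp (- C * (s - t)) * (1 + C * (s - t)) \<le> 1"
      proof -
        have "1 + C * (s - t) \<le> exp (C * (s - t))" by (rule exp_ge_add_one_self)
        then have "exp (- C * (s - t)) * (1 + C * (s - t)) \<le> exp (- C * (s - t)) * exp (C * (s - t))"
          by (intro mult_left_mono) auto
        also have "\<dots> = 1" by (simp flip: exp_add)
        finally show ?thesis .
      qed
      have "\<psi> s \<le> exp (- C * (s - a)) * (\<phi> t + (s - t) * (C * \<phi> t + \<epsilon>))"
        unfolding \<psi>_def by (intro mult_left_mono d(2) s) auto
      also have "\<dots> = exp (- C * (t - a)) * \<phi> t * (exp (- C * (s - t)) * (1 + C * (s - t))) + exp (- C * (s - a)) * (\<epsilon> * (s - t))"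
      proof -
        have "exp (- C * (s - a)) = exp (- C * (t - a)) * exp (- C * (s - t))"
          by (simp add: algebra_simps flip: exp_add)
        then show ?thesis by (simp add: algebra_simps)
      qed
      also have "\<dots> \<le> exp (- C * (t - a)) * \<phi> t * 1 + 1 * (\<epsilon> * (s - t))"
      proof (intro add_mono mult_left_mono mult_right_mono e1)
        show "0 \<le> exp (- C * (t - a)) * \<phi> t" using nn t by (intro mult_nonneg_nonneg) auto
        show "exp (- C * (s - a)) \<le> 1" using C s t by (simp add: mult_nonneg_nonneg)
        show "0 \<le> \<epsilon> * (s - t)" using s \<epsilon> by simp
      qed
      finally show ?thesis by (simp add: \<psi>_def)
    qed
    then show "\<exists>d>0. \<forall>s. t < s \<and> s < t + d \<and> s \<le> b \<longrightarrow> \<psi> s \<le> \<psi> t + \<epsilon> * (s - t)"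
      using d(1) by blast
  qed
  then have *: "exp (- C * (b - a)) * \<phi> b \<le> \<phi> a" by (simp add: \<psi>_def)
  have "\<phi> b = exp (C * (b - a)) * (exp (- C * (b - a)) * \<phi> b)"
    by (simp add: exp_minus)
  also have "\<dots> \<le> exp (C * (b - a)) * \<phi> a" using * by (rule mult_left_mono) simp
  finally show ?thesis .
qed

section \<open>Trajectories of the control system\<close>

text \<open>The cutoff decays linearly in the distance to \<open>K\<close> and vanishes at distance
  \<open>e\<close>, with the closed \<open>e\<close>-neighbourhood \<open>S\<close> still inside
  \<open>A\<close>. The product is continuous on \<open>S \<times> U\<close> and zero where the
  distance is at least \<open>e\<close>; these two closed sets overlap only where the cutoff is 0,
  so the pieces glue. Compactness of \<open>S \<times> U\<close> bounds the product.\<close>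

lemma cutoff_extension:
  fixes h :: "'a::euclidean_space \<Rightarrow> 'b::euclidean_space \<Rightarrow> 'c::real_normed_vector"
  assumes "open A" "compact K" "K \<subseteq> A" "K \<noteq> {}" "compact U" and h: "continuous_on (A \<times> U) (\<lambda>(x, u). h x u)"
  obtains \<kappa> :: "'a \<Rightarrow> real" and B where "\<And>x. 0 \<le> \<kappa> x" "\<And>x. \<kappa> x \<le> 1" "\<And>x. x \<in> K \<Longrightarrow> \<kappa> x = 1" "\<And>x. x \<notin> A \<Longrightarrow> \<kappa> x = 0"
    "continuous_on (UNIV \<times> U) (\<lambda>(x, u). \<kappa> x *\<^sub>R h x u)" "\<And>x u. u \<in> U \<Longrightarrow> norm (\<kappa> x *\<^sub>R h x u) \<le> B"
proof -
  obtain e where e: "e > 0" "(\<Union>x\<in>K. cball x e) \<subseteq> A"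
    using compact_subset_open_imp_cball_epsilon_subset[OF assms(2,1,3)] by blast
  define S where "S = {x. infdist x K \<le> e}"
  have SA: "S \<subseteq> A"
  proof
    fix x assume "x \<in> S"
    obtain y where "y \<in> K" "infdist x K = dist x y"
      using infdist_attains_inf[OF compact_imp_closed[OF assms(2)] assms(4)] by blast
    then have "x \<in> cball y e" using \<open>x \<in> S\<close> by (simp add: S_def dist_commute)
    then show "x \<in> A" using e(2) \<open>y \<in> K\<close> by blast
  qed
  have S: "compact S" unfolding S_def by (rule compact_infdist_le[OF assms(4,2) e(1)])
  define \<kappa> where "\<kappa> x = max 0 (1 - infdist x K / e)" for x
  have cchi: "continuous_on X \<kappa>" for X unfolding \<kappa>_def using e(1)
    by (intro continuous_on_max continuous_on_const continuous_on_diff continuous_on_divide continuous_on_infdist continuous_on_id) auto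
  have chi0: "\<kappa> x = 0" if "infdist x K \<ge> e" for x using that e(1) by (simp add: \<kappa>_def)
  have chi: "0 \<le> \<kappa> x" "\<kappa> x \<le> 1" for x using e(1) infdist_nonneg[of x K] by (auto simp: \<kappa>_def)
  have cS: "continuous_on (S \<times> U) (\<lambda>(x, u). \<kappa> x *\<^sub>R h x u)"
    unfolding split_beta'
    by (intro continuous_intros continuous_on_compose2[OF cchi[of UNIV]])
       (use continuous_on_subset[OF h, of "S \<times> U"] SA in \<open>auto simp: split_beta'\<close>)
  have "continuous_on (S \<times> U \<union> {x. infdist x K \<ge> e} \<times> U) (\<lambda>(x, u). \<kappa> x *\<^sub>R h x u)"
  proof (rule continuous_on_closed_Un)
    show "closed (S \<times> U)" using S assms(5) by (intro closed_Times compact_imp_closed)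
    show "closed ({x. infdist x K \<ge> e} \<times> U)"
      using assms(5) by (intro closed_Times compact_imp_closed closed_Collect_le continuous_intros) auto
    show "continuous_on ({x. infdist x K \<ge> e} \<times> U) (\<lambda>(x, u). \<kappa> x *\<^sub>R h x u)"
      by (rule continuous_on_cong[THEN iffD2, OF refl _ continuous_on_const[of _ 0]]) (auto simp: chi0)
  qed (rule cS)
  moreover have "S \<times> U \<union> {x. infdist x K \<ge> e} \<times> U = UNIV \<times> U" by (auto simp: S_def)
  ultimately have cont: "continuous_on (UNIV \<times> U) (\<lambda>(x, u). \<kappa> x *\<^sub>R h x u)" by simp
  have "compact ((\<lambda>(x, u). \<kappa> x *\<^sub>R h x u) ` (S \<times> U))"
    using S assms(5) by (intro compact_continuous_image cS compact_Times)
  then obtain B where B: "B > 0" "\<And>x u. x \<in> S \<Longrightarrow> u \<in> U \<Longrightarrow> norm (\<kappa> x *\<^sub>R h x u) \<le> B"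
    by (auto dest!: compact_imp_bounded simp: bounded_pos)
  show thesis
  proof (rule that[of \<kappa> B])
    show "\<kappa> x = 1" if "x \<in> K" for x using that by (simp add: \<kappa>_def)
    show "\<kappa> x = 0" if "x \<notin> A" for x proof -
      have "x \<notin> S" using that SA by blast
      then show ?thesis by (intro chi0) (simp add: S_def)
    qed
    show "norm (\<kappa> x *\<^sub>R h x u) \<le> B" if "u \<in> U" for x u
      using B that chi0[of x] by (cases "x \<in> S") (auto simp: S_def)
  qed (use chi cont in auto)
qed

text \<open>Along a trajectory the control jumps freely in time, so \<open>x\<close> can be frozen
  in \<open>F x (u s)\<close> only if the modulus of continuity in \<open>x\<close> is the same for
  all control values. Compactness of \<open>U\<close> provides this.\<close>

lemma uniform_in_parameter:
  fixes F :: "'a::euclidean_space \<Rightarrow> 'b::euclidean_space \<Rightarrow> 'c::real_normed_vector"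
  assumes cont: "continuous_on (A \<times> U) (\<lambda>(x, u). F x u)" and "compact U" "open A" "x \<in> A" "e > 0"
  obtains d where "d > 0" "\<And>y v. norm (y - x) < d \<Longrightarrow> v \<in> U \<Longrightarrow> y \<in> A \<and> norm (F y v - F x v) < e"
proof -
  obtain r where r: "r > 0" "cball x r \<subseteq> A" using assms(3,4) open_contains_cball by blast
  have "uniformly_continuous_on (cball x r \<times> U) (\<lambda>(x, u). F x u)"
    by (rule compact_uniformly_continuous)
      (use continuous_on_subset[OF cont] r assms(2) in \<open>auto intro: compact_Times simp: Sigma_mono\<close>)
  then obtain d where d: "d > 0" "\<And>p q. p \<in> cball x r \<times> U \<Longrightarrow> q \<in> cball x r \<times> U \<Longrightarrow> dist q p < d \<Longrightarrow>
      dist ((\<lambda>(x, u). F x u) q) ((\<lambda>(x, u). F x u) p) < e"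
    unfolding uniformly_continuous_on_def using \<open>e > 0\<close> by metis
  show thesis
  proof (rule that[of "min d r"])
    show "min d r > 0" using d r by simp
    fix y v assume y: "norm (y - x) < min d r" "v \<in> U"
    then have yr: "y \<in> cball x r" by (simp add: dist_norm norm_minus_commute)
    moreover have "dist (y, v) (x, v) < d" using y by (simp add: dist_Pair_Pair dist_norm)
    ultimately show "y \<in> A \<and> norm (F y v - F x v) < e"
      using d(2)[of "(x, v)" "(y, v)"] y r by (auto simp: dist_norm)
  qed
qed

text \<open>Extended by zero off \<open>A \<times> U\<close>, the function \<open>h\<close> is Borel
  on the whole product space, and a Borel function composed with a Lebesgue measurable one is
  measurable.\<close>

lemma superposition_measurable:
  fixes h :: "'a::euclidean_space \<Rightarrow> 'b::euclidean_space \<Rightarrow> 'c::euclidean_space"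
  assumes h: "continuous_on (A \<times> U) (\<lambda>(x, u). h x u)" and "A \<in> sets borel" "U \<in> sets borel"
    and S: "S \<in> sets lebesgue" and X: "continuous_on S X" "X ` S \<subseteq> A"
    and u: "u \<in> borel_measurable (lebesgue_on S)" "u ` S \<subseteq> U"
  shows "(\<lambda>s. h (X s) (u s)) \<in> borel_measurable (lebesgue_on S)"
proof -
  define H where "H p = indicator (A \<times> U) p *\<^sub>R (case p of (x, u) \<Rightarrow> h x u)" for p
  have [measurable]: "H \<in> borel_measurable borel"
    unfolding H_def using assms(2,3) h by (intro borel_measurable_continuous_on_indicator borel_Times)
  have [measurable]: "X \<in> borel_measurable (lebesgue_on S)"
    using X(1) S by (rule continuous_imp_measurable_on_sets_lebesgue)
  note [measurable] = u(1)
  have m: "(\<lambda>s. H (X s, u s)) \<in> borel_measurable (lebesgue_on S)" by measurable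
  have eq: "H (X s, u s) = h (X s) (u s)" if "s \<in> space (lebesgue_on S)" for s
    using that X(2) u(2) by (auto simp: H_def image_subset_iff)
  show ?thesis by (rule iffD1[OF measurable_cong[OF eq] m])
qed

text \<open>The curve need not have a derivative at \<open>t\<close>, so the chain rule is replaced
  by first order expansion of \<open>Y\<close>: the linear term is the integral of
  \<open>p \<bullet> h\<close>, controlled by \<open>loc\<close>, and the remainder is small because
  the curve moves with speed at most \<open>B\<close>.\<close>

lemma C1_along_integral_curve_slope:
  fixes X :: "real \<Rightarrow> 'a::euclidean_space"
  assumes Y: "GDERIV Y (X t) :> p" and t: "t \<in> {0..<T}"
    and Xint: "\<And>s. s \<in> {0..T} \<Longrightarrow> X s = x0 + integral {0..s} h"
    and h: "h \<in> borel_measurable (lebesgue_on {0..T})" "\<And>s. s \<in> {0..T} \<Longrightarrow> norm (h s) \<le> B"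
    and loc: "\<And>e. e > 0 \<Longrightarrow> \<exists>d>0. \<forall>s. t < s \<and> s < t + d \<and> s \<le> T \<longrightarrow> p \<bullet> h s \<le> c + e"
    and "\<epsilon> > 0"
  shows "\<exists>d>0. \<forall>s. t < s \<and> s < t + d \<and> s \<le> T \<longrightarrow> Y (X s) \<le> Y (X t) + (s - t) * (c + \<epsilon>)"
proof -
  have B0: "B \<ge> 0" using h(2)[of t] t norm_ge_zero[of "h t"] by (auto intro: order_trans[OF norm_ge_zero])
  have Xd: "norm (X s - X t) \<le> B * (s - t)" if "t < s" "s \<le> T" for s
    using bounded_measurable_integral(3)[OF h, of t s] that t Xint[of s] Xint[of t] by simp
  \<comment> \<open>The displacement is at most \<open>(B + 1) * (s - t)\<close>, so the remainder
    consumes one half of \<open>\<epsilon>\<close>; the other half goes to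
    \<open>loc\<close>.\<close>
  define e where "e = \<epsilon> / 2 / (B + 1)"
  have e: "e > 0" using \<open>\<epsilon> > 0\<close> B0 by (simp add: e_def)
  have "(Y has_derivative (\<lambda>y. y \<bullet> p)) (at (X t))" using Y by (simp add: gderiv_def)
  then obtain d1 where d1: "d1 > 0" "\<And>y. norm (y - X t) < d1 \<Longrightarrow>
      norm (Y y - Y (X t) - (y - X t) \<bullet> p) \<le> e * norm (y - X t)"
    unfolding has_derivative_at_alt using e by metis
  obtain d2 where d2: "d2 > 0" "\<And>s. t < s \<Longrightarrow> s < t + d2 \<Longrightarrow> s \<le> T \<Longrightarrow> p \<bullet> h s \<le> c + \<epsilon> / 2"
    using loc[of "\<epsilon> / 2"] \<open>\<epsilon> > 0\<close> by auto
  show ?thesis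
  proof (intro exI conjI allI impI)
    show "min d2 (d1 / (B + 1)) > 0" using d1 d2 B0 by simp
    fix s assume s: "t < s \<and> s < t + min d2 (d1 / (B + 1)) \<and> s \<le> T"
    have "norm (X s - X t) \<le> (B + 1) * (s - t)"
      using Xd[of s] s by (simp add: algebra_simps)
    also have "\<dots> < d1"
    proof -
      have "s - t < d1 / (B + 1)" using s by linarith
      then show ?thesis using B0 by (simp add: pos_less_divide_eq mult.commute)
    qed
    finally have "Y (X s) - Y (X t) - (X s - X t) \<bullet> p \<le> e * norm (X s - X t)"
      using d1(2)[of "X s"] by simp
    also have "\<dots> \<le> e * ((B + 1) * (s - t))"
      using Xd[of s] s e by (intro mult_left_mono) (auto simp: algebra_simps)
    also have "\<dots> = \<epsilon> / 2 * (s - t)" using B0 by (simp add: e_def field_simps)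
    finally have 1: "Y (X s) \<le> Y (X t) + (X s - X t) \<bullet> p + \<epsilon> / 2 * (s - t)" by simp
    have st: "s \<in> {0..T}" "t \<in> {0..T}" using s t by auto
    have hint: "h integrable_on {t..s}"
      using integrable_on_subinterval[OF set_lebesgue_integral_eq_integral(1)[OF bounded_measurable_integral(1)[OF h]], of t s]
        st by auto
    have "X s - X t = integral {t..s} h"
      using bounded_measurable_integral(2)[OF h st(2,1)] s Xint st by simp
    then have "(X s - X t) \<bullet> p = integral {t..s} (\<lambda>r. h r \<bullet> p)"
      using integral_linear[OF hint bounded_linear_inner_left[of p]] by (simp add: o_def)
    \<comment> \<open>The bound from \<open>loc\<close> holds only after time \<open>t\<close>; at
      the single time \<open>t\<close> the integrand is kept, which does not change the
      integral.\<close>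
    also have "\<dots> \<le> integral {t..s} (\<lambda>r. if r = t then h t \<bullet> p else c + \<epsilon> / 2)"
    proof (rule integral_le)
      show "(\<lambda>r. h r \<bullet> p) integrable_on {t..s}"
        using integrable_linear[OF hint bounded_linear_inner_left[of p]] by (simp add: o_def)
      show "(\<lambda>r. if r = t then h t \<bullet> p else c + \<epsilon> / 2) integrable_on {t..s}"
        by (rule integrable_spike[of "\<lambda>_. c + \<epsilon> / 2" _ "{t}"]) auto
      show "h r \<bullet> p \<le> (if r = t then h t \<bullet> p else c + \<epsilon> / 2)" if "r \<in> {t..s}" for r
        using d2(2)[of r] that s by (auto simp: inner_commute)
    qed
    also have "\<dots> = integral {t..s} (\<lambda>r. c + \<epsilon> / 2)" by (rule integral_spike[of "{t}"]) auto
    also have "\<dots> = (c + \<epsilon> / 2) * (s - t)" using s by simp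
    finally have "Y (X s) \<le> Y (X t) + (c + \<epsilon> / 2) * (s - t) + \<epsilon> / 2 * (s - t)" using 1 by simp
    also have "\<dots> = Y (X t) + (s - t) * (c + \<epsilon>)" by (simp add: field_simps)
    finally show "Y (X s) \<le> Y (X t) + (s - t) * (c + \<epsilon>)" .
  qed
qed

section \<open>Existence of trajectories\<close>

locale control_system =
  fixes U :: "(real ^ 'm) set" and G G1 :: "(real ^ 'n) set"
    and f :: "real ^ 'n \<Rightarrow> real ^ 'm \<Rightarrow> real ^ 'n"
  assumes system: "system_hypotheses U G G1 f" and U_nonempty: "U \<noteq> {}"
begin

lemmas system_conj = system[unfolded system_hypotheses_def]

lemmas compact_U = system_conj[THEN conjunct1]
  and open_G = system_conj[THEN conjunct2, THEN conjunct1]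
  and open_G1 = system_conj[THEN conjunct2, THEN conjunct2, THEN conjunct2, THEN conjunct1]
  and closure_G = system_conj[THEN conjunct2, THEN conjunct2, THEN conjunct2, THEN conjunct2, THEN conjunct2, THEN conjunct1]
  and f_continuous = system_conj[THEN conjunct2, THEN conjunct2, THEN conjunct2, THEN conjunct2, THEN conjunct2, THEN conjunct2, THEN conjunct2, THEN conjunct1]
  and invariance = system_conj[THEN conjunct2, THEN conjunct2, THEN conjunct2, THEN conjunct2, THEN conjunct2, THEN conjunct2, THEN conjunct2, THEN conjunct2, THEN conjunct1]
  and lipschitz_hypothesis = system_conj[THEN conjunct2, THEN conjunct2, THEN conjunct2, THEN conjunct2, THEN conjunct2, THEN conjunct2, THEN conjunct2, THEN conjunct2, THEN conjunct2, THEN conjunct1]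
  and lyapunov_hypothesis = system_conj[THEN conjunct2, THEN conjunct2, THEN conjunct2, THEN conjunct2, THEN conjunct2, THEN conjunct2, THEN conjunct2, THEN conjunct2, THEN conjunct2, THEN conjunct2]

lemma f_continuous_on_compose:
  assumes "continuous_on S x" "continuous_on S u" "x ` S \<subseteq> G1" "u ` S \<subseteq> U"
  shows "continuous_on S (\<lambda>s. f (x s) (u s))"
proof -
  have "continuous_on S (\<lambda>s. (\<lambda>(x, u). f x u) (x s, u s))"
    by (rule continuous_on_compose2[OF f_continuous continuous_on_Pair[OF assms(1,2)]]) (use assms(3,4) in auto)
  then show ?thesis by simp
qed

lemma G_subset: "G \<subseteq> closure G" "G \<subseteq> G1" using closure_subset closure_G by auto

lemma U_borel: "U \<in> sets borel"
  using compact_U by (rule borel_compact)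

lemma trajectory_in_G:
  assumes "is_trajectory G1 f T x0 u x" "x0 \<in> G" "u \<in> controls U" "t \<ge> 0" "ereal t < T"
  shows "x t \<in> G"
proof -
  have "0 < T" using assms(4,5) by (metis ereal_less_eq(5) order_le_less_trans zero_ereal_def)
  then show ?thesis using invariance assms by blast
qed

lemma f_lipschitz:
  obtains C where "C > 0" "\<And>x x' u. \<lbrakk>x \<in> G; x' \<in> G; norm x \<le> R; norm x' \<le> R; u \<in> U\<rbrakk> \<Longrightarrow>
    norm (f x u - f x' u) \<le> C * norm (x - x')"
proof -
  have "max R 1 > 0" by simp
  then obtain C where C: "C > 0" "\<forall>x \<in> cball 0 (max R 1) \<inter> closure G. \<forall>x' \<in> cball 0 (max R 1) \<inter> closure G. \<forall>u\<in>U.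
        norm (f x u - f x' u) \<le> C * norm (x - x')"
    using lipschitz_hypothesis by meson
  show thesis
  proof (rule that[OF C(1)])
    fix x x' u assume "x \<in> G" "x' \<in> G" "norm x \<le> R" "norm x' \<le> R" "u \<in> U"
    then have "x \<in> cball 0 (max R 1) \<inter> closure G" "x' \<in> cball 0 (max R 1) \<inter> closure G"
      using G_subset(1) by auto
    then show "norm (f x u - f x' u) \<le> C * norm (x - x')" using C(2) \<open>u \<in> U\<close> by blast
  qed
qed

lemma control_in_U: "u \<in> controls U \<Longrightarrow> t \<ge> 0 \<Longrightarrow> u t \<in> U"
  by (auto simp: controls_def)

lemma control_measurable: "u \<in> controls U \<Longrightarrow> a \<ge> 0 \<Longrightarrow> u \<in> borel_measurable (lebesgue_on {a..b})"
  by (rule measurable_restrict_mono[of u lebesgue "{0..}"]) (auto simp: controls_def)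

text \<open>The supremum in the hypothesis is a real one, which dominates its members only when they
  are bounded above; continuity of \<open>f\<close> and compactness of \<open>U\<close> ensure
  this.\<close>

lemma lyapunov_function:
  obtains Y DY C2 where "\<And>x. x \<in> G1 \<Longrightarrow> Y x \<ge> 0" and "\<And>x. x \<in> G1 \<Longrightarrow> GDERIV Y x :> DY x"
    and "\<And>K. compact K \<Longrightarrow> compact {x \<in> G1. Y x \<in> K}" and "(C2 :: real) > 0"
    and "\<And>x u. x \<in> G1 \<Longrightarrow> u \<in> U \<Longrightarrow> DY x \<bullet> f x u \<le> C2 * Y x"
proof -
  from lyapunov_hypothesis
obtain Y DY C2 where *: "(\<forall>x\<in>G1. Y x \<ge> 0 \<and> GDERIV Y x :> DY x) \<and> continuous_on G1 DY \<and>
        (\<forall>K. compact K \<longrightarrow> compact {x \<in> G1. Y x \<in> K}) \<and>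
        (C2 :: real) > 0 \<and> (\<forall>x\<in>G1. (SUP u\<in>U. DY x \<bullet> f x u) \<le> C2 * Y x)" by (elim exE)
  show thesis
  proof (rule that)
    show "Y x \<ge> 0" "GDERIV Y x :> DY x" if "x \<in> G1" for x using * that by blast+
    show "compact {x \<in> G1. Y x \<in> K}" if "compact K" for K using * that by blast
    show "C2 > 0" using * by blast
    fix x u assume x: "x \<in> G1" and u: "u \<in> U"
    have "continuous_on U (f x)"
      by (rule f_continuous_on_compose[OF continuous_on_const continuous_on_id]) (use x in auto)
    then have "compact ((\<lambda>u. DY x \<bullet> f x u) ` U)"
      by (intro compact_continuous_image compact_U continuous_intros)
    then have "bdd_above ((\<lambda>u. DY x \<bullet> f x u) ` U)" by (intro bounded_imp_bdd_above compact_imp_bounded)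
    then have "DY x \<bullet> f x u \<le> (SUP u\<in>U. DY x \<bullet> f x u)" using u by (intro cSUP_upper)
    also have "\<dots> \<le> C2 * Y x" using * x by blast
    finally show "DY x \<bullet> f x u \<le> C2 * Y x" .
  qed
qed

text \<open>The vector field is cut off outside a compact sublevel set of the Lyapunov function; a curve
  of the truncated field cannot leave that set.\<close>

lemma trajectory_exists:
  assumes "compact K0" "K0 \<subseteq> G" "T > 0"
  obtains K where "compact K" "\<And>x0 u. \<lbrakk>x0 \<in> K0; u \<in> controls U\<rbrakk> \<Longrightarrow>
    \<exists>x. is_trajectory G1 f (ereal T) x0 u x \<and> (\<forall>t. 0 \<le> t \<and> t < T \<longrightarrow> x t \<in> K)"
proof (cases "K0 = {}")
  case True
  show thesis by (rule that[of "{}"]) (use True in auto)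
next
  case False
  obtain Y DY C2 where Y0: "\<And>x. x \<in> G1 \<Longrightarrow> Y x \<ge> 0" and DY: "\<And>x. x \<in> G1 \<Longrightarrow> GDERIV Y x :> DY x"
    and proper: "\<And>K. compact K \<Longrightarrow> compact {x \<in> G1. Y x \<in> K}" and C2: "C2 > 0"
    and DYf: "\<And>x u. x \<in> G1 \<Longrightarrow> u \<in> U \<Longrightarrow> DY x \<bullet> f x u \<le> C2 * Y x"
    by (rule lyapunov_function) blast
  have Ycont: "continuous_on A Y" if "A \<subseteq> G1" for A
  proof (intro continuous_at_imp_continuous_on ballI)
    fix x assume "x \<in> A"
    then have "GDERIV Y x :> DY x" using that by (intro DY) auto
    then show "isCont Y x" by (auto simp: gderiv_def dest: has_derivative_continuous)
  qed
  have K0G: "K0 \<subseteq> G1" using assms(2) G_subset by blast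
  obtain M0 where M0: "\<And>x. x \<in> K0 \<Longrightarrow> Y x \<le> M0"
  proof -
    have "compact (Y ` K0)" by (intro compact_continuous_image Ycont assms K0G)
    then show thesis using that by (meson bounded_imp_bdd_above compact_imp_bounded bdd_above_def imageI)
  qed
  \<comment> \<open>The level is the Gronwall bound: at most \<open>M0\<close> initially, growing by
    a factor of at most \<open>exp (C2 * T)\<close>. Properness makes this sublevel set compact
    inside \<open>G1\<close>.\<close>
  define K where "K = {x \<in> G1. Y x \<in> {0..exp (C2 * T) * M0}}"
  have K: "compact K" "K \<subseteq> G1" unfolding K_def by (rule proper, simp) auto
  have eT: "exp (C2 * t) * Y x \<le> exp (C2 * T) * M0" if "t \<le> T" "x \<in> K0" for t x
  proof -
    have "exp (C2 * t) \<le> exp (C2 * T)" using that C2 by simp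
    moreover have "Y x \<le> M0" "0 \<le> Y x" using that M0 Y0 K0G by blast+
    ultimately show ?thesis by (intro mult_mono) simp_all
  qed
  have "K0 \<subseteq> K"
  proof
    fix x assume "x \<in> K0"
    then show "x \<in> K" using eT[of 0 x] assms(3) K0G Y0[of x] by (simp add: K_def subset_iff)
  qed
  then have "K \<noteq> {}" using False by blast
  from cutoff_extension[OF open_G1 K this compact_U f_continuous]
  obtain \<kappa> B where chi: "\<And>x. 0 \<le> \<kappa> x" "\<And>x. \<kappa> x \<le> 1" "\<And>x. x \<in> K \<Longrightarrow> \<kappa> x = 1" "\<And>x. x \<notin> G1 \<Longrightarrow> \<kappa> x = 0"
    and Fc: "continuous_on (UNIV \<times> U) (\<lambda>(x, u). \<kappa> x *\<^sub>R f x u)" and B: "\<And>x u. u \<in> U \<Longrightarrow> norm (\<kappa> x *\<^sub>R f x u) \<le> B"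
    by blast
  define F where "F x u = \<kappa> x *\<^sub>R f x u" for x u
  have Fc': "continuous_on (UNIV \<times> U) (\<lambda>(x, u). F x u)" using Fc by (simp add: F_def)
  show thesis
  proof (rule that[OF K(1)])
    fix x0 u assume x0: "x0 \<in> K0" and u: "u \<in> controls U"
    have uU: "u s \<in> U" if "s \<in> {0..T}" for s using u that control_in_U by auto
    have mF: "(\<lambda>s. F (X s) (u s)) \<in> borel_measurable (lebesgue_on {0..T})" if "continuous_on {0..T} X" for X
      by (rule superposition_measurable[OF Fc' _ U_borel _ that]) (use uU control_measurable[OF u] in auto)
    obtain X where Xc: "continuous_on {0..T} X"
      and X: "\<And>t. t \<in> {0..T} \<Longrightarrow> X t = x0 + integral {0..t} (\<lambda>s. F (X s) (u s))"
    proof (rule caratheodory_existence[of T "\<lambda>s x. F x (u s)" B x0])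
      fix s assume s: "s \<in> {0..T}"
      have "continuous_on UNIV (\<lambda>x. (x, u s))" by (intro continuous_on_Pair continuous_on_const continuous_on_id)
      then have "continuous_on UNIV (\<lambda>x. (\<lambda>(x, u). F x u) (x, u s))"
        by (rule continuous_on_compose2[OF Fc']) (use uU[OF s] in auto)
      then show "continuous_on UNIV (\<lambda>x. F x (u s))" by simp
      show "norm (F x (u s)) \<le> B" for x using B uU[OF s] by (simp add: F_def)
    next
      show "T \<ge> 0" using assms(3) by simp
    qed (blast intro: mF)+
    \<comment> \<open>The truncated field obeys the same Lyapunov inequality: the cutoff is at most
      1 and \<open>C2 * Y\<close> is nonnegative. The bound needs the curve to be in
      \<open>G1\<close> up to \<open>\<tau>\<close>, where \<open>Y\<close> is controlled.\<close>
    have Yle: "Y (X \<tau>) \<le> exp (C2 * \<tau>) * Y x0" if \<tau>: "\<tau> \<in> {0..T}" "\<And>s. s \<in> {0..\<tau>} \<Longrightarrow> X s \<in> G1" for \<tau>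
    proof -
      have "Y (X \<tau>) \<le> exp (C2 * (\<tau> - 0)) * Y (X 0)"
      proof (rule gronwall_right_slope)
        show "continuous_on {0..\<tau>} (\<lambda>t. Y (X t))"
          by (rule continuous_on_compose2[OF Ycont[of G1] continuous_on_subset[OF Xc]]) (use \<tau> in auto)
        show "Y (X t) \<ge> 0" if "t \<in> {0..\<tau>}" for t using \<tau> that Y0 by auto
        fix t \<epsilon> :: real assume t: "t \<in> {0..<\<tau>}" and \<epsilon>: "\<epsilon> > 0"
        have tG: "X t \<in> G1" using t \<tau> by auto
        have "\<exists>d>0. \<forall>s. t < s \<and> s < t + d \<and> s \<le> T \<longrightarrow> Y (X s) \<le> Y (X t) + (s - t) * (C2 * Y (X t) + \<epsilon>)"
        proof (rule C1_along_integral_curve_slope[OF DY[OF tG] _ X mF[OF Xc]])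
          show "t \<in> {0..<T}" using t \<tau> by auto
          show "norm (F (X s) (u s)) \<le> B" if "s \<in> {0..T}" for s using B uU[OF that] by (simp add: F_def)
          fix e :: real assume "e > 0"
          define e' where "e' = e / (norm (DY (X t)) + 1)"
          have e': "e' > 0" using \<open>e > 0\<close> by (simp add: e'_def add_nonneg_pos)
          obtain d where d: "d > 0" "\<And>y v. norm (y - X t) < d \<Longrightarrow> v \<in> U \<Longrightarrow> y \<in> UNIV \<and> norm (F y v - F (X t) v) < e'"
            by (rule uniform_in_parameter[OF Fc' compact_U open_UNIV UNIV_I e']) blast
          have "t \<in> {0..T}" using t \<tau> by auto
          then obtain d' where d': "d' > 0" "\<And>s. s \<in> {0..T} \<Longrightarrow> dist s t < d' \<Longrightarrow> dist (X s) (X t) < d"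
            using Xc d(1) unfolding continuous_on_iff by metis
          show "\<exists>d>0. \<forall>s. t < s \<and> s < t + d \<and> s \<le> T \<longrightarrow> DY (X t) \<bullet> F (X s) (u s) \<le> C2 * Y (X t) + e"
          proof (intro exI conjI allI impI, rule d'(1))
            fix s assume s: "t < s \<and> s < t + d' \<and> s \<le> T"
            then have sT: "s \<in> {0..T}" using t by auto
            have "norm (X s - X t) < d" using d'(2)[OF sT] s by (simp add: dist_norm)
            then have "norm (F (X s) (u s) - F (X t) (u s)) \<le> e'" using d(2) uU[OF sT] by (metis less_imp_le)
            then have "DY (X t) \<bullet> (F (X s) (u s) - F (X t) (u s)) \<le> norm (DY (X t)) * e'"
              by (meson Cauchy_Schwarz_ineq2 abs_le_D1 mult_left_mono norm_ge_zero order_trans)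
            also have "\<dots> \<le> e"
            proof -
              have "norm (DY (X t)) * e' \<le> (norm (DY (X t)) + 1) * e'" using e' by (intro mult_right_mono) auto
              also have "\<dots> = e" by (simp add: e'_def add_nonneg_eq_0_iff)
              finally show ?thesis .
            qed
            finally have "DY (X t) \<bullet> F (X s) (u s) \<le> DY (X t) \<bullet> F (X t) (u s) + e" by (simp add: inner_diff_right)
            moreover have "DY (X t) \<bullet> F (X t) (u s) \<le> C2 * Y (X t)"
            proof -
              have "DY (X t) \<bullet> F (X t) (u s) = \<kappa> (X t) * (DY (X t) \<bullet> f (X t) (u s))" by (simp add: F_def)
              also have "\<dots> \<le> \<kappa> (X t) * (C2 * Y (X t))" by (intro mult_left_mono DYf tG uU sT chi)
              also have "\<dots> \<le> 1 * (C2 * Y (X t))" using C2 Y0[OF tG] by (intro mult_right_mono chi) auto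
              finally show ?thesis by simp
            qed
            ultimately show "DY (X t) \<bullet> F (X s) (u s) \<le> C2 * Y (X t) + e" by linarith
          qed
        qed (use \<epsilon> in auto)
        then obtain d where "d > 0" "\<forall>s. t < s \<and> s < t + d \<and> s \<le> T \<longrightarrow> Y (X s) \<le> Y (X t) + (s - t) * (C2 * Y (X t) + \<epsilon>)"
          by blast
        then show "\<exists>d>0. \<forall>s. t < s \<and> s < t + d \<and> s \<le> \<tau> \<longrightarrow> Y (X s) \<le> Y (X t) + (s - t) * (C2 * Y (X t) + \<epsilon>)"
          using \<tau>(1) by (intro exI[of _ d]) simp
      next
        show "0 \<le> \<tau>" "0 \<le> C2" using \<tau>(1) C2 by simp_all
      qed
      moreover have "X 0 = x0" using X[of 0] assms(3) by simp
      ultimately show ?thesis by simp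
    qed
    \<comment> \<open>At a first time outside the open set \<open>G1\<close> the curve would be a
      limit of points of \<open>K\<close>, because \<open>Yle\<close> applies at all earlier times;
      but \<open>K\<close> is closed and contained in \<open>G1\<close>.\<close>
    have XG1: "X t \<in> G1" if "t \<in> {0..T}" for t
    proof (rule ccontr)
      assume "X t \<notin> G1"
      define Bad where "Bad = {s \<in> {0..T}. X s \<in> - G1}"
      have "Bad \<noteq> {}" using that \<open>X t \<notin> G1\<close> by (auto simp: Bad_def)
      moreover have "compact Bad"
      proof -
        have "closed ({0..T} \<inter> X -` (- G1))"
          using open_G1 by (intro continuous_closed_preimage[OF Xc]) auto
        moreover have "{0..T} \<inter> X -` (- G1) = Bad" by (auto simp: Bad_def)
        moreover have "bounded Bad" by (rule bounded_subset[OF bounded_closed_interval[of 0 T]]) (auto simp: Bad_def)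
        ultimately show ?thesis by (simp add: compact_eq_bounded_closed)
      qed
      ultimately obtain \<tau> where \<tau>: "\<tau> \<in> Bad" "\<And>s. s \<in> Bad \<Longrightarrow> \<tau> \<le> s" using compact_attains_inf by metis
      have "X 0 = x0" using X[of 0] assms(3) by simp
      then have "X 0 \<in> G1" using x0 K0G by blast
      then have "\<tau> \<noteq> 0" using \<tau>(1) by (auto simp: Bad_def)
      then have "\<tau> > 0" using \<tau>(1) by (simp add: Bad_def)
      have \<tau>T: "\<tau> \<in> {0..T}" using \<tau>(1) by (simp add: Bad_def)
      have "X s \<in> K" if "s \<in> {0..<\<tau>}" for s
      proof -
        have g: "X r \<in> G1" if "r \<in> {0..s}" for r
          using \<tau>(2)[of r] that \<open>s \<in> {0..<\<tau>}\<close> \<tau>T by (fastforce simp: Bad_def)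
        have "Y (X s) \<le> exp (C2 * s) * Y x0" by (rule Yle) (use that \<tau>T g in auto)
        also have "\<dots> \<le> exp (C2 * T) * M0" using that \<tau>T x0 by (intro eT) auto
        finally show ?thesis using g[of s] that Y0[of "X s"] by (simp add: K_def)
      qed
      then have "X ` closure {0..<\<tau>} \<subseteq> K"
        using \<open>\<tau> > 0\<close> \<tau>T K(1) by (intro image_closure_subset continuous_on_subset[OF Xc] compact_imp_closed) auto
      moreover have "\<tau> \<in> closure {0..<\<tau>}" using \<open>\<tau> > 0\<close> by simp
      ultimately have "X \<tau> \<in> G1" using K(2) by blast
      then show False using \<tau>(1) by (simp add: Bad_def)
    qed
    have XK: "X t \<in> K" if "t \<in> {0..T}" for t
    proof -
      have "Y (X t) \<le> exp (C2 * t) * Y x0" by (rule Yle) (use that XG1 in auto)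
      also have "\<dots> \<le> exp (C2 * T) * M0" using that x0 by (intro eT) auto
      finally show ?thesis using XG1[OF that] Y0[of "X t"] by (simp add: K_def)
    qed
    \<comment> \<open>The curve never leaves \<open>K\<close>, where the cutoff equals 1, so it also
      solves the original equation.\<close>
    have FX: "F (X s) (u s) = f (X s) (u s)" if "s \<in> {0..T}" for s using chi(3)[OF XK[OF that]] by (simp add: F_def)
    have ai: "(\<lambda>s. F (X s) (u s)) absolutely_integrable_on {0..T}"
    proof (rule bounded_measurable_integral(1)[OF mF[OF Xc]])
      show "norm (F (X s) (u s)) \<le> B" if "s \<in> {0..T}" for s using B uU[OF that] by (simp add: F_def)
    qed
    have "is_trajectory G1 f (ereal T) x0 u X"
      unfolding is_trajectory_def
    proof (intro allI impI conjI)
      fix t assume "0 \<le> t" "ereal t < ereal T"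
      then have t: "t \<in> {0..T}" by simp
      then have FXt: "F (X s) (u s) = f (X s) (u s)" if "s \<in> {0..t}" for s using that by (intro FX) simp
      show "X t \<in> G1" using t by (rule XG1)
      have "(\<lambda>s. F (X s) (u s)) absolutely_integrable_on {0..t}"
        by (rule set_integrable_subset[OF ai]) (use t in auto)
      then show "(\<lambda>s. f (X s) (u s)) absolutely_integrable_on {0..t}"
        by (rule absolutely_integrable_spike[of _ _ "{}"]) (simp_all add: FXt)
      have "integral {0..t} (\<lambda>s. F (X s) (u s)) = integral {0..t} (\<lambda>s. f (X s) (u s))"
        by (rule integral_cong) (rule FXt)
      then show "X t = x0 + integral {0..t} (\<lambda>s. f (X s) (u s))" using X[OF t] by argo
    qed
    then show "\<exists>x. is_trajectory G1 f (ereal T) x0 u x \<and> (\<forall>t. 0 \<le> t \<and> t < T \<longrightarrow> x t \<in> K)"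
    proof (intro exI conjI allI impI)
      show "X t \<in> K" if "0 \<le> t \<and> t < T" for t using that by (intro XK) simp
    qed
  qed
qed

section \<open>Uniqueness, dependence on initial data and global solutions\<close>

abbreviation sol :: "real ^ 'n \<Rightarrow> (real \<Rightarrow> real ^ 'm) \<Rightarrow> real \<Rightarrow> real ^ 'n" where
  "sol \<equiv> state G1 f"

lemma trajectoryD:
  assumes "is_trajectory G1 f T x0 u x" "0 \<le> t" "ereal t < T"
  shows "x t \<in> G1" "(\<lambda>s. f (x s) (u s)) absolutely_integrable_on {0..t}"
    "x t = x0 + integral {0..t} (\<lambda>s. f (x s) (u s))"
proof -
  note * = assms(1)[unfolded is_trajectory_def, rule_format, OF assms(2,3)]
  show "x t \<in> G1" by (rule *[THEN conjunct1])
  show "(\<lambda>s. f (x s) (u s)) absolutely_integrable_on {0..t}" by (rule *[THEN conjunct2, THEN conjunct1])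
  show "x t = x0 + integral {0..t} (\<lambda>s. f (x s) (u s))" by (rule *[THEN conjunct2, THEN conjunct2])
qed

lemma trajectory_integrable:
  assumes "is_trajectory G1 f (ereal T) x0 u x" "0 \<le> t" "t < T"
  shows "(\<lambda>s. f (x s) (u s)) integrable_on {0..t}" "x t = x0 + integral {0..t} (\<lambda>s. f (x s) (u s))"
    "continuous_on {0..t} x"
proof -
  have tr: "(\<lambda>s. f (x s) (u s)) absolutely_integrable_on {0..s}" "x s = x0 + integral {0..s} (\<lambda>s. f (x s) (u s))"
    if "0 \<le> s" "s \<le> t" for s
    by (rule trajectoryD[OF assms(1) that(1)]; use assms that in simp)+
  show int: "(\<lambda>s. f (x s) (u s)) integrable_on {0..t}"
    by (rule set_lebesgue_integral_eq_integral(1)[OF tr(1)[OF assms(2) order_refl]])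
  show "x t = x0 + integral {0..t} (\<lambda>s. f (x s) (u s))" by (rule tr(2)[OF assms(2) order_refl])
  have "continuous_on {0..t} (\<lambda>s. x0 + integral {0..s} (\<lambda>s. f (x s) (u s)))"
    by (intro continuous_on_add continuous_on_const indefinite_integral_continuous_1 int)
  moreover have "x0 + integral {0..s} (\<lambda>s. f (x s) (u s)) = x s" if "s \<in> {0..t}" for s
    using tr(2)[of s] that by simp
  ultimately show "continuous_on {0..t} x"
    by (rule continuous_on_eq)
qed

text \<open>Gronwall's estimate for the norm of the difference. Invariance keeps both curves in
  \<open>G\<close>, where \<open>f\<close> is Lipschitz in the state. Taking \<open>R\<close> and
  \<open>C\<close> as given lets the same constant serve all controls.\<close>

lemma trajectory_dependence:
  assumes x: "is_trajectory G1 f (ereal T) x0 u x" and y: "is_trajectory G1 f (ereal T) y0 u y"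
    and G: "x0 \<in> G" "y0 \<in> G" and u: "u \<in> controls U" and t: "0 \<le> t" "t < T"
    and R: "\<And>s. 0 \<le> s \<Longrightarrow> s \<le> t \<Longrightarrow> norm (x s) \<le> R" "\<And>s. 0 \<le> s \<Longrightarrow> s \<le> t \<Longrightarrow> norm (y s) \<le> R"
    and C: "C > 0" "\<And>x x' u. \<lbrakk>x \<in> G; x' \<in> G; norm x \<le> R; norm x' \<le> R; u \<in> U\<rbrakk> \<Longrightarrow>
      norm (f x u - f x' u) \<le> C * norm (x - x')"
  shows "norm (x t - y t) \<le> exp (C * t) * norm (x0 - y0)"
proof -
  note X = trajectory_integrable[OF x] and Y = trajectory_integrable[OF y]
  have xG: "x s \<in> G" and yG: "y s \<in> G" if "0 \<le> s" "s \<le> t" for s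
    using trajectory_in_G[OF x G(1) u, of s] trajectory_in_G[OF y G(2) u, of s] that t by simp_all
  have "norm (x t - y t) \<le> exp (C * (t - 0)) * norm (x 0 - y 0)"
  proof (rule gronwall_right_slope[OF t(1)])
    show cont: "continuous_on {0..t} (\<lambda>s. norm (x s - y s))"
      by (intro continuous_on_norm continuous_on_diff X(3) Y(3) t)
    show "0 \<le> C" using C(1) by simp
    fix a \<epsilon> :: real assume a: "a \<in> {0..<t}" and \<epsilon>: "\<epsilon> > 0"
    \<comment> \<open>A change of at most \<open>\<epsilon> / C\<close> in the distance changes the
      Lipschitz bound on the velocities by at most \<open>\<epsilon>\<close>.\<close>
    have "\<epsilon> / C > 0" using \<epsilon> C(1) by simp
    moreover have "a \<in> {0..t}" using a by simp
    ultimately obtain d where d: "d > 0"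
      "\<And>s. s \<in> {0..t} \<Longrightarrow> dist s a < d \<Longrightarrow> dist (norm (x s - y s)) (norm (x a - y a)) < \<epsilon> / C"
      using cont unfolding continuous_on_iff by metis
    have "norm (x s - y s) \<le> norm (x a - y a) + (s - a) * (C * norm (x a - y a) + \<epsilon>)"
      if s: "a < s" "s < a + d" "s \<le> t" for s
    proof -
      have st: "0 \<le> s" "s < T" "0 \<le> a" "a < T" using s a t by auto
      let ?h = "\<lambda>s. f (x s) (u s)" and ?k = "\<lambda>s. f (y s) (u s)"
      have i: "?h integrable_on {a..s}" "?k integrable_on {a..s}"
        by (rule integrable_on_subinterval[OF X(1)[OF st(1,2)]] integrable_on_subinterval[OF Y(1)[OF st(1,2)]];
            use a in auto)+
      have c: "integral {0..a} ?h + integral {a..s} ?h = integral {0..s} ?h"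
        "integral {0..a} ?k + integral {a..s} ?k = integral {0..s} ?k"
        using X(1)[OF st(1,2)] Y(1)[OF st(1,2)] s st
        by (auto intro!: Henstock_Kurzweil_Integration.integral_combine)
      have "x s = (x0 + integral {0..a} ?h) + integral {a..s} ?h"
        unfolding add.assoc c(1) by (rule X(2)[OF st(1,2)])
      moreover have "y s = (y0 + integral {0..a} ?k) + integral {a..s} ?k"
        unfolding add.assoc c(2) by (rule Y(2)[OF st(1,2)])
      ultimately have "x s = x a + integral {a..s} ?h" "y s = y a + integral {a..s} ?k"
        unfolding X(2)[OF st(3,4), symmetric] Y(2)[OF st(3,4), symmetric] by this+
      then have "x s - y s = (x a - y a) + integral {a..s} (\<lambda>r. ?h r - ?k r)"
        by (simp add: Henstock_Kurzweil_Integration.integral_diff[OF i])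
      then have "norm (x s - y s) \<le> norm (x a - y a) + norm (integral {a..s} (\<lambda>r. ?h r - ?k r))"
        by (simp only: norm_triangle_ineq)
      also have "norm (integral {a..s} (\<lambda>r. ?h r - ?k r)) \<le> integral {a..s} (\<lambda>_. C * norm (x a - y a) + \<epsilon>)"
      proof (rule integral_norm_bound_integral)
        show "(\<lambda>r. ?h r - ?k r) integrable_on {a..s}" by (rule Henstock_Kurzweil_Integration.integrable_diff[OF i])
        fix r assume r: "r \<in> {a..s}"
        then have r': "0 \<le> r" "r \<le> t" "r \<in> {0..t}" "dist r a < d" using s st by (auto simp: dist_real_def)
        have "norm (?h r - ?k r) \<le> C * norm (x r - y r)"
          by (intro C(2) xG yG R control_in_U[OF u] r')
        also have "norm (x r - y r) \<le> norm (x a - y a) + \<epsilon> / C"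
          using d(2)[OF r'(3,4)] by (simp add: dist_real_def)
        finally show "norm (?h r - ?k r) \<le> C * norm (x a - y a) + \<epsilon>"
          using C(1) by (simp add: distrib_left)
      qed (rule integrable_const_ivl)
      also have "\<dots> = (s - a) * (C * norm (x a - y a) + \<epsilon>)" using s by simp
      finally show ?thesis by simp
    qed
    then show "\<exists>d>0. \<forall>s. a < s \<and> s < a + d \<and> s \<le> t \<longrightarrow>
        norm (x s - y s) \<le> norm (x a - y a) + (s - a) * (C * norm (x a - y a) + \<epsilon>)"
      using d(1) by (intro exI[of _ d]) simp
  qed simp
  moreover have "x 0 = x0" "y 0 = y0" using X(2)[of 0] Y(2)[of 0] t by simp_all
  ultimately show ?thesis by simp
qed

lemma trajectory_unique:
  assumes x: "is_trajectory G1 f (ereal T) x0 u x" and y: "is_trajectory G1 f (ereal T) x0 u y"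
    and G: "x0 \<in> G" and u: "u \<in> controls U" and t: "0 \<le> t" "t < T"
  shows "x t = y t"
proof -
  have "bounded (x ` {0..t})" "bounded (y ` {0..t})"
    using trajectory_integrable(3)[OF x t] trajectory_integrable(3)[OF y t]
    by (auto intro!: compact_imp_bounded compact_continuous_image)
  then obtain R1 R2 where R: "\<And>s. s \<in> {0..t} \<Longrightarrow> norm (x s) \<le> R1" "\<And>s. s \<in> {0..t} \<Longrightarrow> norm (y s) \<le> R2"
    by (fastforce simp: bounded_iff)
  obtain C where C: "C > 0" "\<And>x x' u. \<lbrakk>x \<in> G; x' \<in> G; norm x \<le> max R1 R2; norm x' \<le> max R1 R2; u \<in> U\<rbrakk> \<Longrightarrow>
      norm (f x u - f x' u) \<le> C * norm (x - x')" using f_lipschitz[of "max R1 R2"] by blast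
  have "norm (x t - y t) \<le> exp (C * t) * norm (x0 - x0)"
  proof (rule trajectory_dependence[OF x y G G u t _ _ C])
    show "norm (x s) \<le> max R1 R2" "norm (y s) \<le> max R1 R2" if "0 \<le> s" "s \<le> t" for s
      using R[of s] that by auto
  qed
  then show ?thesis by simp
qed

lemma trajectory_restrict:
  assumes "is_trajectory G1 f T x0 u x" "T' \<le> T"
  shows "is_trajectory G1 f T' x0 u x"
  unfolding is_trajectory_def
proof (intro allI impI)
  fix t assume "0 \<le> t" and tT: "ereal t < T'"
  have "ereal t < T" using tT assms(2) by (rule less_le_trans)
  then show "x t \<in> G1 \<and> (\<lambda>s. f (x s) (u s)) absolutely_integrable_on {0..t} \<and>
      x t = x0 + integral {0..t} (\<lambda>s. f (x s) (u s))"
    by (intro conjI trajectoryD[OF assms(1) \<open>0 \<le> t\<close>])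
qed

text \<open>Uniqueness makes the solutions chosen on \<open>[0, k + 1)\<close> agree on common
  times, so the diagonal \<open>Z t t\<close> solves the equation for all times.\<close>

lemma global_trajectory_exists:
  assumes "x0 \<in> G" "u \<in> controls U"
  shows "\<exists>x. is_trajectory G1 f \<infinity> x0 u x"
proof -
  define Z where "Z k = (SOME x. is_trajectory G1 f (ereal (k + 1)) x0 u x)" for k
  have Z: "is_trajectory G1 f (ereal (k + 1)) x0 u (Z k)" if "k \<ge> 0" for k
  proof -
    have "compact {x0}" "{x0} \<subseteq> G" "k + 1 > 0" using assms that by auto
    then obtain K where K: "\<And>x u. \<lbrakk>x \<in> {x0}; u \<in> controls U\<rbrakk> \<Longrightarrow>
      \<exists>z. is_trajectory G1 f (ereal (k + 1)) x u z \<and> (\<forall>t. 0 \<le> t \<and> t < k + 1 \<longrightarrow> z t \<in> K)"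
      by (rule trajectory_exists) blast
    have "\<exists>x. is_trajectory G1 f (ereal (k + 1)) x0 u x" using K[OF singletonI assms(2)] by blast
    then show ?thesis unfolding Z_def by (rule someI_ex)
  qed
  have eq: "Z s s = Z t s" if "0 \<le> s" "s \<le> t" for s t
  proof (rule trajectory_unique[OF Z _ assms])
    show "is_trajectory G1 f (ereal (s + 1)) x0 u (Z t)"
      by (rule trajectory_restrict[OF Z]) (use that in auto)
  qed (use that in auto)
  have "is_trajectory G1 f \<infinity> x0 u (\<lambda>t. Z t t)"
    unfolding is_trajectory_def
  proof (intro allI impI)
    fix t :: real assume t: "0 \<le> t"
    have Zt: "Z t t \<in> G1" "(\<lambda>s. f (Z t s) (u s)) absolutely_integrable_on {0..t}"
      "Z t t = x0 + integral {0..t} (\<lambda>s. f (Z t s) (u s))"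
      by (rule trajectoryD[OF Z[OF t] t]; simp)+
    have e: "f (Z t s) (u s) = f (Z s s) (u s)" if "s \<in> {0..t}" for s using eq[of s t] that by simp
    have "(\<lambda>s. f (Z s s) (u s)) absolutely_integrable_on {0..t}"
      by (rule absolutely_integrable_spike[OF Zt(2), of "{}"]) (simp_all add: e)
    moreover have "integral {0..t} (\<lambda>s. f (Z t s) (u s)) = integral {0..t} (\<lambda>s. f (Z s s) (u s))"
      by (rule integral_cong) (rule e)
    then have "Z t t = x0 + integral {0..t} (\<lambda>s. f (Z s s) (u s))" using Zt(3) by (simp only:)
    ultimately show "Z t t \<in> G1 \<and> (\<lambda>s. f (Z s s) (u s)) absolutely_integrable_on {0..t} \<and>
        Z t t = x0 + integral {0..t} (\<lambda>s. f (Z s s) (u s))"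
      using Zt(1) by (intro conjI)
  qed
  then show ?thesis by blast
qed

text \<open>The definite description behind \<open>sol\<close> is meaningful because all global
  solutions have the same value at a nonnegative time; they may still differ as functions at
  negative times.\<close>

lemma state_eq:
  assumes x: "is_trajectory G1 f \<infinity> x0 u x" and G: "x0 \<in> G" and u: "u \<in> controls U" and t: "0 \<le> t"
  shows "sol x0 u t = x t"
  unfolding state_def
proof (rule the_equality)
  show "\<exists>z. is_trajectory G1 f \<infinity> x0 u z \<and> x t = z t" using x by blast
  fix y assume "\<exists>z. is_trajectory G1 f \<infinity> x0 u z \<and> y = z t"
  then obtain z where z: "is_trajectory G1 f \<infinity> x0 u z" "y = z t" by blast
  have "z t = x t"
    by (rule trajectory_unique[OF trajectory_restrict[OF z(1)] trajectory_restrict[OF x] G u t, of "t + 1"]) auto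
  then show "y = x t" using z by simp
qed

lemma state_trajectory:
  assumes G: "x0 \<in> G" and u: "u \<in> controls U"
  shows "is_trajectory G1 f \<infinity> x0 u (sol x0 u)"
proof -
  obtain x where x: "is_trajectory G1 f \<infinity> x0 u x" using global_trajectory_exists[OF assms] by blast
  note e = state_eq[OF x G u]
  show ?thesis
    unfolding is_trajectory_def
  proof (intro allI impI)
    fix t :: real assume t: "0 \<le> t"
    have xt: "x t \<in> G1" "(\<lambda>s. f (x s) (u s)) absolutely_integrable_on {0..t}"
      "x t = x0 + integral {0..t} (\<lambda>s. f (x s) (u s))"
      by (rule trajectoryD[OF x t]; simp)+
    have fe: "f (x s) (u s) = f (sol x0 u s) (u s)" if "s \<in> {0..t}" for s using e[of s] that by simp
    have "(\<lambda>s. f (sol x0 u s) (u s)) absolutely_integrable_on {0..t}"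
      by (rule absolutely_integrable_spike[OF xt(2), of "{}"]) (simp_all add: fe)
    moreover have "integral {0..t} (\<lambda>s. f (x s) (u s)) = integral {0..t} (\<lambda>s. f (sol x0 u s) (u s))"
      by (rule integral_cong) (rule fe)
    then have "sol x0 u t = x0 + integral {0..t} (\<lambda>s. f (sol x0 u s) (u s))"
      using xt(3) e[OF t] by (simp only:)
    moreover have "sol x0 u t \<in> G1" using xt(1) e[OF t] by simp
    ultimately show "sol x0 u t \<in> G1 \<and> (\<lambda>s. f (sol x0 u s) (u s)) absolutely_integrable_on {0..t} \<and>
        sol x0 u t = x0 + integral {0..t} (\<lambda>s. f (sol x0 u s) (u s))"
      by (intro conjI)
  qed
qed

lemma state_in_G: "x0 \<in> G \<Longrightarrow> u \<in> controls U \<Longrightarrow> 0 \<le> t \<Longrightarrow> sol x0 u t \<in> G"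
  by (rule trajectory_in_G[OF state_trajectory]) auto

lemma state_finite_trajectory:
  "x0 \<in> G \<Longrightarrow> u \<in> controls U \<Longrightarrow> is_trajectory G1 f (ereal T) x0 u (sol x0 u)"
  by (rule trajectory_restrict[OF state_trajectory]) auto

lemma state_integral:
  assumes "x0 \<in> G" "u \<in> controls U" "0 \<le> t"
  shows "sol x0 u t = x0 + integral {0..t} (\<lambda>s. f (sol x0 u s) (u s))"
    and "(\<lambda>s. f (sol x0 u s) (u s)) integrable_on {0..t}"
  by (rule trajectory_integrable(1,2)[OF state_finite_trajectory[OF assms(1,2)] assms(3), of "t + 1"]; simp)+

lemma state_0: "x0 \<in> G \<Longrightarrow> u \<in> controls U \<Longrightarrow> sol x0 u 0 = x0"
  using state_integral(1)[of x0 u 0] by simp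

lemma state_continuous:
  assumes "x0 \<in> G" "u \<in> controls U"
  shows "continuous_on {0..} (sol x0 u)"
  unfolding continuous_on_eq_continuous_within
proof
  fix t :: real assume "t \<in> {0..}"
  then have t: "t \<ge> 0" by simp
  then have "continuous_on {0..t + 1} (sol x0 u)"
    by (intro trajectory_integrable(3)[OF state_finite_trajectory[OF assms], of _ "t + 2"]) auto
  then have "continuous (at t within {0..t + 1}) (sol x0 u)"
    using t by (simp add: continuous_on_eq_continuous_within)
  moreover have "at t within {0..t + 1} = at t within {0..}"
    by (rule at_within_nhd[of _ "{..<t + 1}"]) auto
  ultimately show "continuous (at t within {0..}) (sol x0 u)" by (simp only:)
qed

text \<open>The compact set supplied by the existence proof serves all starting points in
  \<open>K0\<close> and all controls, and uniqueness identifies the curve found there with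
  \<open>sol\<close>.\<close>

lemma state_bounded:
  assumes "compact K0" "K0 \<subseteq> G"
  obtains R where "R > 0" "\<And>x0 u t. \<lbrakk>x0 \<in> K0; u \<in> controls U; 0 \<le> t; t \<le> T\<rbrakk> \<Longrightarrow> norm (sol x0 u t) \<le> R"
proof -
  \<comment> \<open>The horizon must be positive and must exceed \<open>T\<close> strictly, because
    trajectories live on half-open intervals.\<close>
  have "max T 0 + 1 > 0" by simp
  from trajectory_exists[OF assms this] obtain K where K: "compact K" "\<And>x0 u. \<lbrakk>x0 \<in> K0; u \<in> controls U\<rbrakk> \<Longrightarrow>
    \<exists>x. is_trajectory G1 f (ereal (max T 0 + 1)) x0 u x \<and> (\<forall>t. 0 \<le> t \<and> t < max T 0 + 1 \<longrightarrow> x t \<in> K)" by blast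
  obtain R where R: "R > 0" "\<And>x. x \<in> K \<Longrightarrow> norm x \<le> R"
    using compact_imp_bounded[OF K(1)] unfolding bounded_pos by blast
  show thesis
  proof (rule that[OF R(1)])
    fix x0 u t assume a: "x0 \<in> K0" "u \<in> controls U" "0 \<le> t" "t \<le> T"
    then have G: "x0 \<in> G" using assms(2) by blast
    obtain x where x: "is_trajectory G1 f (ereal (max T 0 + 1)) x0 u x" "\<forall>t. 0 \<le> t \<and> t < max T 0 + 1 \<longrightarrow> x t \<in> K"
      using K(2)[OF a(1,2)] by blast
    have tT: "t < max T 0 + 1" using a by simp
    have "sol x0 u t = x t"
      by (rule trajectory_unique[OF state_finite_trajectory[OF G a(2)] x(1) G a(2,3) tT])
    moreover have "x t \<in> K" using x(2) a(3) tT by blast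
    ultimately show "norm (sol x0 u t) \<le> R" using R(2) by simp
  qed
qed

lemma state_dependence:
  assumes "compact K0" "K0 \<subseteq> G"
  obtains C where "C > 0" "\<And>x0 y0 u t. \<lbrakk>x0 \<in> K0; y0 \<in> K0; u \<in> controls U; 0 \<le> t; t \<le> T\<rbrakk> \<Longrightarrow>
    norm (sol x0 u t - sol y0 u t) \<le> C * norm (x0 - y0)"
proof -
  obtain R where R: "\<And>x0 u t. \<lbrakk>x0 \<in> K0; u \<in> controls U; 0 \<le> t; t \<le> T\<rbrakk> \<Longrightarrow> norm (sol x0 u t) \<le> R"
    by (rule state_bounded[OF assms, of T]) blast
  obtain C where C: "C > 0" "\<And>x x' u. \<lbrakk>x \<in> G; x' \<in> G; norm x \<le> R; norm x' \<le> R; u \<in> U\<rbrakk> \<Longrightarrow>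
      norm (f x u - f x' u) \<le> C * norm (x - x')" by (rule f_lipschitz[of R]) blast
  show thesis
  proof (rule that[of "exp (C * T)"])
    fix x0 y0 u t assume a: "x0 \<in> K0" "y0 \<in> K0" "u \<in> controls U" "0 \<le> t" "t \<le> T"
    note G = subsetD[OF assms(2) a(1)] subsetD[OF assms(2) a(2)]
    have "norm (sol x0 u t - sol y0 u t) \<le> exp (C * t) * norm (x0 - y0)"
    proof (rule trajectory_dependence[OF state_finite_trajectory[OF G(1) a(3)] state_finite_trajectory[OF G(2) a(3)]
          G a(3,4) _ _ _ C, of "t + 1"])
      show "norm (sol x0 u s) \<le> R" "norm (sol y0 u s) \<le> R" if "0 \<le> s" "s \<le> t" for s
        using R a that by simp_all
    qed simp
    also have "\<dots> \<le> exp (C * T) * norm (x0 - y0)" using a C(1) by (intro mult_right_mono) simp_all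
    finally show "norm (sol x0 u t - sol y0 u t) \<le> exp (C * T) * norm (x0 - y0)" .
  qed simp
qed

section \<open>Concatenation of controls\<close>

definition switch :: "real \<Rightarrow> (real \<Rightarrow> real ^ 'm) \<Rightarrow> (real \<Rightarrow> real ^ 'm) \<Rightarrow> real \<Rightarrow> real ^ 'm" where
  "switch T u v t = (if t < T then u t else v (t - T))"

text \<open>Local essential boundedness is automatic for values in the compact set
  \<open>U\<close>.\<close>

lemma controlsI:
  assumes "\<And>t. t \<ge> 0 \<Longrightarrow> u t \<in> U" "u \<in> borel_measurable (lebesgue_on {0..})"
  shows "u \<in> controls U"
proof -
  obtain B where B: "\<And>v. v \<in> U \<Longrightarrow> norm v \<le> B"
    using compact_imp_bounded[OF compact_U] unfolding bounded_iff by blast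
  have "AE t in lebesgue_on {0..T}. norm (u t) \<le> B" for T
    by (rule AE_I2) (use B assms(1) in simp)
  then show ?thesis using assms by (auto simp: controls_def)
qed

lemma switch_in_controls:
  assumes u: "u \<in> controls U" and v: "v \<in> controls U" and T: "T \<ge> 0"
  shows "switch T u v \<in> controls U"
proof (rule controlsI)
  show "switch T u v t \<in> U" if "t \<ge> 0" for t
    using control_in_U[OF u that] control_in_U[OF v, of "t - T"] by (simp add: switch_def)
  \<comment> \<open>Extended by zero, both controls are Lebesgue measurable on the whole line, so
    the time shift by \<open>T\<close> preserves measurability.\<close>
  define u' v' where "u' t = (if t \<in> {0..} then u t else 0)" and "v' t = (if t \<in> {0..} then v t else 0)" for t :: real
  have [measurable]: "u' \<in> borel_measurable lebesgue" "v' \<in> borel_measurable lebesgue"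
    unfolding u'_def v'_def using u v by (intro borel_measurable_if_I; simp add: controls_def)+
  have [measurable]: "(\<lambda>t. t - T) \<in> lebesgue \<rightarrow>\<^sub>M lebesgue"
    using lebesgue_affine_measurable[of "\<lambda>_. 1" "- T"] by simp
  have [measurable]: "(\<lambda>t. v' (t - T)) \<in> borel_measurable lebesgue" by measurable
  have "(\<lambda>t. if t \<in> {..<0} then 0 else if t \<in> {..<T} then u' t else v' (t - T)) \<in> borel_measurable lebesgue"
    by (intro measurable_If_set) simp_all
  also have "(\<lambda>t. if t \<in> {..<0} then 0 else if t \<in> {..<T} then u' t else v' (t - T)) =
      (\<lambda>t. if t \<in> {0..} then switch T u v t else 0)"
    by (auto simp: u'_def v'_def switch_def fun_eq_iff)
  finally show "switch T u v \<in> borel_measurable (lebesgue_on {0..})"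
    by (rule borel_measurable_if_D)
qed

text \<open>The curves glued at time \<open>T\<close> satisfy the integral equation for the switched
  control, after a shift of the second integral, and are therefore its solution by
  uniqueness.\<close>

lemma state_switch:
  assumes x0: "x0 \<in> G" and u: "u \<in> controls U" and v: "v \<in> controls U" and T: "T \<ge> 0"
  shows "0 \<le> t \<Longrightarrow> t \<le> T \<Longrightarrow> sol x0 (switch T u v) t = sol x0 u t"
    and "0 \<le> t \<Longrightarrow> sol x0 (switch T u v) (T + t) = sol (sol x0 u T) v t"
proof -
  define w where "w = switch T u v"
  have w: "w \<in> controls U" unfolding w_def by (rule switch_in_controls[OF u v T])
  define x where "x = sol x0 u"
  define y where "y = sol (x T) v"
  have xT: "x T \<in> G" unfolding x_def by (rule state_in_G[OF x0 u T])
  define z where "z t = (if t < T then x t else y (t - T))" for t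
  have zT: "z T = x T" unfolding z_def y_def using state_0[OF xT v] by simp
  have X: "x t = x0 + integral {0..t} (\<lambda>s. f (x s) (u s))" "(\<lambda>s. f (x s) (u s)) absolutely_integrable_on {0..t}"
    "x t \<in> G1" if "0 \<le> t" for t
    by (rule trajectoryD[OF state_trajectory[OF x0 u, folded x_def] that]; simp)+
  have Y: "y t = x T + integral {0..t} (\<lambda>s. f (y s) (v s))" "(\<lambda>s. f (y s) (v s)) absolutely_integrable_on {0..t}"
    "y t \<in> G1" if "0 \<le> t" for t
    by (rule trajectoryD[OF state_trajectory[OF xT v, folded y_def] that]; simp)+
  have first: "(\<lambda>s. f (z s) (w s)) absolutely_integrable_on {0..t}" "x t = x0 + integral {0..t} (\<lambda>s. f (z s) (w s))"
    if t: "0 \<le> t" "t \<le> T" for t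
  proof -
    \<comment> \<open>Time \<open>T\<close> is left out: there the switched control already takes
      the value \<open>v 0\<close>.\<close>
    have e: "f (z s) (w s) = f (x s) (u s)" if "s \<in> {0..t} - {T}" for s
      using that t by (simp add: z_def w_def switch_def)
    show "(\<lambda>s. f (z s) (w s)) absolutely_integrable_on {0..t}"
      by (rule absolutely_integrable_spike[OF X(2)[OF t(1)] negligible_sing[of T]]) (rule e)
    have "integral {0..t} (\<lambda>s. f (z s) (w s)) = integral {0..t} (\<lambda>s. f (x s) (u s))"
      by (rule integral_spike[OF negligible_sing[of T]]) (simp add: e)
    then show "x t = x0 + integral {0..t} (\<lambda>s. f (z s) (w s))" using X(1)[OF t(1)] by simp
  qed
  have second: "(\<lambda>s. f (z s) (w s)) absolutely_integrable_on {T..T + t}"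
    "y t = x T + integral {T..T + t} (\<lambda>s. f (z s) (w s))" if t: "0 \<le> t" for t
  proof -
    let ?h = "\<lambda>s. f (y s) (v s)"
    have e: "f (z s) (w s) = ?h (s + - T)" if "s \<in> {T..T + t}" for s
      using that by (simp add: z_def w_def switch_def)
    have hi: "?h integrable_on cbox 0 t" "(\<lambda>s. norm (?h s)) integrable_on cbox 0 t"
      using Y(2)[OF t] unfolding absolutely_integrable_on_def by simp_all
    have "(\<lambda>s. ?h (s + - T)) integrable_on {T..T + t}" "(\<lambda>s. norm (?h (s + - T))) integrable_on {T..T + t}"
      using integrable_shift_cbox[OF hi(1), of "- T"] integrable_shift_cbox[OF hi(2), of "- T"] by (simp_all add: add.commute)
    then have "(\<lambda>s. ?h (s + - T)) absolutely_integrable_on {T..T + t}" unfolding absolutely_integrable_on_def by simp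
    then show "(\<lambda>s. f (z s) (w s)) absolutely_integrable_on {T..T + t}"
      by (rule absolutely_integrable_spike[of _ _ "{}"]) (simp_all add: e)
    have "integral {T..T + t} (\<lambda>s. f (z s) (w s)) = integral {T..T + t} (\<lambda>s. ?h (s + - T))"
      by (rule integral_cong) (rule e)
    also have "\<dots> = integral {0..t} ?h"
      using integral_shift_cbox[of 0 "- T" t ?h] by (simp add: add.commute)
    finally show "y t = x T + integral {T..T + t} (\<lambda>s. f (z s) (w s))" using Y(1)[OF t] by simp
  qed
  have "is_trajectory G1 f \<infinity> x0 w z"
    unfolding is_trajectory_def
  proof (intro allI impI)
    fix t :: real assume t: "0 \<le> t"
    show "z t \<in> G1 \<and> (\<lambda>s. f (z s) (w s)) absolutely_integrable_on {0..t} \<and> z t = x0 + integral {0..t} (\<lambda>s. f (z s) (w s))"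
    proof (cases "t < T")
      case True
      then have "z t = x t" by (simp add: z_def)
      then show ?thesis using first[of t] X(3)[OF t] t True by simp
    next
      case False
      define r where "r = t - T"
      have r: "r \<ge> 0" "t = T + r" using False by (simp_all add: r_def)
      have zt: "z t = y r" using False by (simp add: z_def r_def)
      have un: "{0..t} = {0..T} \<union> {T..T + r}" using r T by auto
      have ai: "(\<lambda>s. f (z s) (w s)) absolutely_integrable_on {0..t}"
        unfolding un by (rule absolutely_integrable_Un[OF first(1)[OF T order_refl] second(1)[OF r(1)]])
      then have "integral {0..T} (\<lambda>s. f (z s) (w s)) + integral {T..t} (\<lambda>s. f (z s) (w s)) = integral {0..t} (\<lambda>s. f (z s) (w s))"
        using T False by (intro Henstock_Kurzweil_Integration.integral_combine set_lebesgue_integral_eq_integral(1)) simp_all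
      moreover have "y r = (x0 + integral {0..T} (\<lambda>s. f (z s) (w s))) + integral {T..t} (\<lambda>s. f (z s) (w s))"
        using second(2)[OF r(1)] unfolding r(2) by (simp only: first(2)[OF T order_refl])
      ultimately have "z t = x0 + integral {0..t} (\<lambda>s. f (z s) (w s))" using zt by (simp add: add.assoc)
      then show ?thesis using ai Y(3)[OF r(1)] zt by simp
    qed
  qed
  note zw = state_eq[OF this x0 w]
  show "sol x0 (switch T u v) t = sol x0 u t" if "0 \<le> t" "t \<le> T"
  proof -
    have "z t = x t" using that zT by (cases "t = T") (simp_all add: z_def)
    then show ?thesis using zw[of t] that by (simp add: w_def x_def)
  qed
  show "sol x0 (switch T u v) (T + t) = sol (sol x0 u T) v t" if "0 \<le> t"
    using zw[of "T + t"] that T by (simp add: w_def z_def y_def x_def)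
qed

end

section \<open>Costs and dynamic programming\<close>

locale cost_system = control_system U G G1 f
  for U :: "(real ^ 'm) set" and G G1 :: "(real ^ 'n) set" and f :: "real ^ 'n \<Rightarrow> real ^ 'm \<Rightarrow> real ^ 'n" +
  fixes g :: "real ^ 'n \<Rightarrow> real ^ 'm \<Rightarrow> real"
  assumes g_nonneg: "\<And>x u. x \<in> closure G \<Longrightarrow> u \<in> U \<Longrightarrow> g x u \<ge> 0"
    and g_continuous: "continuous_on (closure G \<times> U) (\<lambda>(x, u). g x u)"
    and g_lipschitz: "\<And>R. R > 0 \<Longrightarrow> \<exists>C>0. \<forall>x \<in> cball 0 R \<inter> closure G. \<forall>x' \<in> cball 0 R \<inter> closure G. \<forall>u\<in>U.
        \<bar>g x u - g x' u\<bar> \<le> C * norm (x - x')"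
    and g_positive: "\<And>R. R > 0 \<Longrightarrow> \<exists>c>0. \<forall>x \<in> closure G. \<forall>u\<in>U. R \<le> norm x \<longrightarrow> c \<le> g x u"
begin

abbreviation run :: "real ^ 'n \<Rightarrow> (real \<Rightarrow> real ^ 'm) \<Rightarrow> real \<Rightarrow> real" where
  "run x0 u t \<equiv> g (sol x0 u t) (u t)"

definition cost :: "real ^ 'n \<Rightarrow> (real \<Rightarrow> real ^ 'm) \<Rightarrow> real set \<Rightarrow> ennreal" where
  "cost x0 u A = (\<integral>\<^sup>+t\<in>A. ennreal (run x0 u t) \<partial>lebesgue)"

abbreviation V :: "real \<Rightarrow> real ^ 'n \<Rightarrow> ennreal" where
  "V \<equiv> value_fun U G1 f g"

lemma state_in_closure: "x0 \<in> G \<Longrightarrow> u \<in> controls U \<Longrightarrow> 0 \<le> t \<Longrightarrow> sol x0 u t \<in> closure G"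
  using state_in_G G_subset(1) by blast

lemma run_nonneg: "x0 \<in> G \<Longrightarrow> u \<in> controls U \<Longrightarrow> 0 \<le> t \<Longrightarrow> 0 \<le> run x0 u t"
  by (intro g_nonneg state_in_closure control_in_U)

lemma run_measurable:
  assumes x0: "x0 \<in> G" and u: "u \<in> controls U" and A: "A \<in> sets lebesgue" "A \<subseteq> {0..}"
  shows "(\<lambda>t. ennreal (run x0 u t) * indicator A t) \<in> borel_measurable lebesgue"
proof -
  have "(\<lambda>t. run x0 u t) \<in> borel_measurable (lebesgue_on {0..})"
  proof (rule superposition_measurable[OF g_continuous _ U_borel _ state_continuous[OF x0 u]])
    show "u \<in> borel_measurable (lebesgue_on {0..})" using u by (simp add: controls_def)
    show "u ` {0..} \<subseteq> U" using control_in_U[OF u] by auto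
    show "sol x0 u ` {0..} \<subseteq> closure G" using state_in_closure[OF x0 u] by auto
  qed simp_all
  then have "(\<lambda>t. ennreal (run x0 u t)) \<in> borel_measurable (lebesgue_on {0..})" by measurable
  then have [measurable]: "(\<lambda>t. ennreal (run x0 u t) * indicator {0..} t) \<in> borel_measurable lebesgue"
    by (subst (asm) borel_measurable_restrict_space_iff_ennreal) simp_all
  note [measurable] = A(1)
  have "(\<lambda>t. (ennreal (run x0 u t) * indicator {0..} t) * indicator A t) \<in> borel_measurable lebesgue"
    by measurable
  also have "(\<lambda>t. (ennreal (run x0 u t) * indicator {0..} t) * indicator A t) = (\<lambda>t. ennreal (run x0 u t) * indicator A t)"
    using A(2) by (auto simp: fun_eq_iff indicator_def)
  finally show ?thesis .
qed

lemma cost_mono: "A \<subseteq> B \<Longrightarrow> cost x0 u A \<le> cost x0 u B"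
  unfolding cost_def by (intro nn_integral_mono mult_left_mono) (auto simp: indicator_def)

lemma cost_le:
  assumes "0 \<le> T" "0 \<le> M" "\<And>t. 0 \<le> t \<Longrightarrow> t \<le> T \<Longrightarrow> run x0 u t \<le> M"
  shows "cost x0 u {0..T} \<le> ennreal (M * T)"
proof -
  have "cost x0 u {0..T} \<le> (\<integral>\<^sup>+t. ennreal M * indicator {0..T} t \<partial>lebesgue)"
    unfolding cost_def by (intro nn_integral_mono) (use assms(3) in \<open>auto simp: indicator_def intro: ennreal_leI\<close>)
  also have "\<dots> = ennreal M * ennreal T" using assms by (subst nn_integral_cmult_indicator) simp_all
  also have "\<dots> = ennreal (M * T)" using assms by (simp add: ennreal_mult)
  finally show ?thesis .
qed

lemma cost_ge:
  assumes "0 \<le> T" "0 \<le> c" "\<And>t. 0 \<le> t \<Longrightarrow> t < T \<Longrightarrow> c \<le> run x0 u t"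
  shows "ennreal (c * T) \<le> cost x0 u {0..T}"
proof -
  have "ennreal (c * T) = ennreal c * ennreal T" using assms by (simp add: ennreal_mult)
  also have "\<dots> = (\<integral>\<^sup>+t. ennreal c * indicator {0..<T} t \<partial>lebesgue)"
    using assms by (subst nn_integral_cmult_indicator) simp_all
  also have "\<dots> \<le> cost x0 u {0..T}"
    unfolding cost_def by (intro nn_integral_mono) (use assms(3) in \<open>auto simp: indicator_def intro: ennreal_leI\<close>)
  finally show ?thesis .
qed

lemma run_bounded:
  assumes "compact K0" "K0 \<subseteq> G"
  obtains M where "M > 0" "\<And>x0 u t. \<lbrakk>x0 \<in> K0; u \<in> controls U; 0 \<le> t; t \<le> T\<rbrakk> \<Longrightarrow> run x0 u t \<le> M"
proof -
  obtain R where R: "R > 0" "\<And>x0 u t. \<lbrakk>x0 \<in> K0; u \<in> controls U; 0 \<le> t; t \<le> T\<rbrakk> \<Longrightarrow> norm (sol x0 u t) \<le> R"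
    by (rule state_bounded[OF assms, of T]) blast
  have "compact ((\<lambda>(x, u). g x u) ` ((cball 0 R \<inter> closure G) \<times> U))"
    by (intro compact_continuous_image continuous_on_subset[OF g_continuous] compact_Times compact_U
      compact_Int_closed compact_cball closed_closure) auto
  then obtain M where M: "M > 0" "\<And>p. p \<in> (\<lambda>(x, u). g x u) ` ((cball 0 R \<inter> closure G) \<times> U) \<Longrightarrow> norm p \<le> M"
    using compact_imp_bounded bounded_pos by metis
  show thesis
  proof (rule that[OF M(1)])
    fix x0 u t assume a: "x0 \<in> K0" "u \<in> controls U" "0 \<le> t" "t \<le> T"
    have "sol x0 u t \<in> cball 0 R \<inter> closure G"
      using R(2)[OF a] state_in_closure[OF subsetD[OF assms(2) a(1)] a(2,3)] by simp
    then have "run x0 u t \<in> (\<lambda>(x, u). g x u) ` ((cball 0 R \<inter> closure G) \<times> U)"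
      using control_in_U[OF a(2,3)] by (intro image_eqI[of _ _ "(sol x0 u t, u t)"]) simp_all
    then have "norm (run x0 u t) \<le> M" by (rule M(2))
    then show "run x0 u t \<le> M" by simp
  qed
qed

lemma cost_finite:
  assumes "x0 \<in> G" "u \<in> controls U" "0 \<le> T"
  shows "cost x0 u {0..T} < \<infinity>"
proof -
  have "compact {x0}" "{x0} \<subseteq> G" using assms by simp_all
  then obtain M where M: "M > 0" "\<And>x u t. \<lbrakk>x \<in> {x0}; u \<in> controls U; 0 \<le> t; t \<le> T\<rbrakk> \<Longrightarrow> run x u t \<le> M"
    by (rule run_bounded) blast
  have "cost x0 u {0..T} \<le> ennreal (M * T)"
    by (rule cost_le) (use assms M(1) M(2)[OF singletonI assms(2)] in auto)
  then show ?thesis by (simp add: order_le_less_trans)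
qed

text \<open>The integrand is split at \<open>T\<close> and the later part is shifted back. General
  sets \<open>A\<close> and \<open>B\<close> cover both value functions at once: half-lines for the
  infinite horizon, bounded intervals for the exit problem.\<close>

lemma cost_switch_le:
  assumes x0: "x0 \<in> G" and u: "u \<in> controls U" and v: "v \<in> controls U" and T: "T \<ge> 0"
    and A: "A \<in> sets lebesgue" "A \<subseteq> {0..}" and B: "B \<subseteq> {0..}" "\<And>s. s \<in> B \<Longrightarrow> T \<le> s \<Longrightarrow> s - T \<in> A"
  shows "cost x0 (switch T u v) B \<le> cost x0 u {0..T} + cost (sol x0 u T) v A"
proof -
  define y where "y = sol x0 u T"
  have y: "y \<in> G" unfolding y_def by (rule state_in_G[OF x0 u T])
  define h where "h s = ennreal (run y v s) * indicator A s" for s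
  have h: "h \<in> borel_measurable lebesgue" unfolding h_def by (rule run_measurable[OF y v A])
  have "(\<lambda>t. t - T) \<in> lebesgue \<rightarrow>\<^sub>M lebesgue"
    using lebesgue_affine_measurable[of "\<lambda>_. 1" "- T"] by simp
  from measurable_compose[OF this h] have hT: "(\<lambda>t. h (t - T)) \<in> borel_measurable lebesgue" .
  have m: "(\<lambda>t. ennreal (run x0 u t) * indicator {0..T} t) \<in> borel_measurable lebesgue"
    by (rule run_measurable[OF x0 u]) auto
  have "cost x0 (switch T u v) B \<le> (\<integral>\<^sup>+s. ennreal (run x0 u s) * indicator {0..T} s + h (s - T) \<partial>lebesgue)"
    unfolding cost_def
  proof (rule nn_integral_mono)
    fix s
    show "ennreal (run x0 (switch T u v) s) * indicator B s \<le> ennreal (run x0 u s) * indicator {0..T} s + h (s - T)"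
    proof (cases "s \<in> B")
      case True
      then have s0: "s \<ge> 0" using B(1) by auto
      show ?thesis
      proof (cases "s < T")
        case True
        then have "run x0 (switch T u v) s = run x0 u s"
          using state_switch(1)[OF x0 u v T s0] by (simp add: switch_def)
        then show ?thesis using True s0 \<open>s \<in> B\<close> by simp
      next
        case False
        then have "run x0 (switch T u v) s = run y v (s - T)"
          using state_switch(2)[OF x0 u v T, of "s - T"] by (simp add: switch_def y_def)
        moreover have "s - T \<in> A" using B(2) \<open>s \<in> B\<close> False by simp
        ultimately show ?thesis using \<open>s \<in> B\<close> by (simp add: h_def)
      qed
    qed simp
  qed
  also have "\<dots> = cost x0 u {0..T} + (\<integral>\<^sup>+s. h (s - T) \<partial>lebesgue)"
    unfolding cost_def by (rule nn_integral_add[OF m hT])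
  also have "(\<integral>\<^sup>+s. h (s - T) \<partial>lebesgue) = (\<integral>\<^sup>+s. h s \<partial>lebesgue)"
    using nn_integral_real_affine_lebesgue[OF h, of 1 "- T"] by (simp add: add.commute)
  finally show ?thesis by (simp add: cost_def h_def y_def)
qed

section \<open>Dynamic programming inequality\<close>

lemma value_0: "V 0 x0 = (INF u\<in>controls U. cost x0 u {0..})"
  by (simp add: value_fun_def infinite_horizon_value_def cost_def)

lemma value_exit:
  assumes "\<delta> > 0"
  shows "V \<delta> x0 = Inf {cost x0 u {0..T} | u T. u \<in> controls U \<and> T \<ge> 0 \<and> sol x0 u T \<in> cball 0 \<delta>}"
  using assms by (simp add: value_fun_def exit_time_value_def cost_def)

lemma value_le_cost:
  assumes "\<delta> > 0" "u \<in> controls U" "T \<ge> 0" "norm (sol x0 u T) \<le> \<delta>"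
  shows "V \<delta> x0 \<le> cost x0 u {0..T}"
  unfolding value_exit[OF assms(1)] by (rule Inf_lower) (use assms in auto)

lemma value_approx:
  assumes "\<delta> > 0" "V \<delta> x0 < c"
  obtains u T where "u \<in> controls U" "T \<ge> 0" "norm (sol x0 u T) \<le> \<delta>" "cost x0 u {0..T} < c"
proof -
  have "\<exists>a \<in> {cost x0 u {0..T} | u T. u \<in> controls U \<and> T \<ge> 0 \<and> sol x0 u T \<in> cball 0 \<delta>}. a < c"
    using assms(2) unfolding value_exit[OF assms(1)] Inf_less_iff .
  then show thesis using that by auto
qed

lemma ennreal_le_add_Inf:
  fixes a b :: ennreal
  assumes "\<And>c. c \<in> C \<Longrightarrow> a \<le> b + c"
  shows "a \<le> b + Inf C"
proof (cases "b = top")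
  case False
  have "a - b \<le> Inf C"
    by (rule Inf_greatest) (use assms False in \<open>simp add: ennreal_minus_le_iff\<close>)
  then show ?thesis using False by (simp add: ennreal_minus_le_iff)
qed simp

text \<open>Any control on \<open>[0, T]\<close> may be followed by a competitor from the point
  reached. For \<delta> > 0 this is valid even if the target was visited before \<open>T\<close>,
  since the exit value admits every time at which the state is in the target.\<close>

lemma value_le_switch:
  assumes "\<delta> \<ge> 0" and x0: "x0 \<in> G" and u: "u \<in> controls U" and T: "T \<ge> 0"
  shows "V \<delta> x0 \<le> cost x0 u {0..T} + V \<delta> (sol x0 u T)"
proof (cases "\<delta> = 0")
  case True
  show ?thesis unfolding True value_0[of "sol x0 u T"]
  proof (rule ennreal_le_add_Inf)
    fix c assume "c \<in> (\<lambda>v. cost (sol x0 u T) v {0..}) ` controls U"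
    then obtain v where v: "v \<in> controls U" "c = cost (sol x0 u T) v {0..}" by blast
    have "V 0 x0 \<le> cost x0 (switch T u v) {0..}"
      unfolding value_0 by (rule INF_lower) (rule switch_in_controls[OF u v(1) T])
    also have "\<dots> \<le> cost x0 u {0..T} + c"
      unfolding v(2) by (rule cost_switch_le[OF x0 u v(1) T]) auto
    finally show "V 0 x0 \<le> cost x0 u {0..T} + c" .
  qed
next
  case False
  then have \<delta>: "\<delta> > 0" using assms(1) by simp
  show ?thesis unfolding value_exit[OF \<delta>, of "sol x0 u T"]
  proof (rule ennreal_le_add_Inf)
    fix c assume "c \<in> {cost (sol x0 u T) v {0..t} | v t. v \<in> controls U \<and> t \<ge> 0 \<and>
      sol (sol x0 u T) v t \<in> cball 0 \<delta>}"
    then obtain v t where v: "v \<in> controls U" "t \<ge> 0" "norm (sol (sol x0 u T) v t) \<le> \<delta>"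
      "c = cost (sol x0 u T) v {0..t}" by auto
    have "V \<delta> x0 \<le> cost x0 (switch T u v) {0..T + t}"
      by (rule value_le_cost[OF \<delta> switch_in_controls[OF u v(1) T]])
        (use T v state_switch(2)[OF x0 u v(1) T v(2)] in simp_all)
    also have "\<dots> \<le> cost x0 u {0..T} + c"
      unfolding v(4) by (rule cost_switch_le[OF x0 u v(1) T]) auto
    finally show "V \<delta> x0 \<le> cost x0 u {0..T} + c" .
  qed
qed

definition reach :: "real \<Rightarrow> real ^ 'n \<Rightarrow> bool" where
  "reach \<delta> x0 \<longleftrightarrow> (\<exists>u\<in>controls U. \<exists>T\<ge>0. norm (sol x0 u T) \<le> \<delta>)"

text \<open>A running cost that is bounded along a trajectory on a bounded time interval can never
  make the value infinite; finiteness is a question of reachability alone.\<close>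

lemma value_exit_finite_iff:
  assumes "\<delta> > 0" "x0 \<in> G"
  shows "V \<delta> x0 < \<infinity> \<longleftrightarrow> reach \<delta> x0"
proof
  assume "V \<delta> x0 < \<infinity>"
  then show "reach \<delta> x0" using value_approx[OF assms(1)] unfolding reach_def by metis
next
  assume "reach \<delta> x0"
  then obtain u T where "u \<in> controls U" "T \<ge> 0" "norm (sol x0 u T) \<le> \<delta>" unfolding reach_def by blast
  then show "V \<delta> x0 < \<infinity>"
    using value_le_cost[OF assms(1)] cost_finite[OF assms(2)] by (meson order_le_less_trans)
qed

lemma value_exit_le_value_0:
  assumes "\<delta> > 0" "x0 \<in> G"
  shows "V \<delta> x0 \<le> V 0 x0"
  unfolding value_0
proof (rule INF_greatest)
  fix u assume u: "u \<in> controls U"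
  show "V \<delta> x0 \<le> cost x0 u {0..}"
  proof (cases "\<exists>T\<ge>0. norm (sol x0 u T) \<le> \<delta>")
    case True
    then obtain T where "T \<ge> 0" "norm (sol x0 u T) \<le> \<delta>" by blast
    then have "V \<delta> x0 \<le> cost x0 u {0..T}" by (intro value_le_cost[OF assms(1) u])
    also have "\<dots> \<le> cost x0 u {0..}" by (rule cost_mono) auto
    finally show ?thesis .
  next
    case False
    then have far: "\<delta> \<le> norm (sol x0 u t)" if "t \<ge> 0" for t using that by (meson linear)
    obtain c where c: "c > 0" "\<And>x u. x \<in> closure G \<Longrightarrow> u \<in> U \<Longrightarrow> \<delta> \<le> norm x \<Longrightarrow> c \<le> g x u"
      using g_positive[OF assms(1)] by blast
    \<comment> \<open>Staying outside the ball costs at least \<open>c\<close> per unit of time, so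
      time \<open>n / c\<close> already costs \<open>n\<close>.\<close>
    have "ennreal (real n) \<le> cost x0 u {0..}" for n :: nat
    proof -
      have "ennreal (c * (real n / c)) \<le> cost x0 u {0..real n / c}"
        by (rule cost_ge) (use c(1) c(2)[OF state_in_closure[OF assms(2) u] control_in_U[OF u] far] in auto)
      also have "\<dots> \<le> cost x0 u {0..}" by (rule cost_mono) auto
      finally show ?thesis using c(1) by simp
    qed
    then have "cost x0 u {0..} = \<infinity>"
      using ennreal_Ex_less_of_nat[of "cost x0 u {0..}"] by (metis ennreal_of_nat_eq_real_of_nat infinity_ennreal_def less_top not_le)
    then show ?thesis by simp
  qed
qed

end

section \<open>Convergence of the value functions\<close>

text \<open>The map \<open>1 - exp (- x)\<close> is 1-Lipschitz on \<open>x \<ge> 0\<close>. If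
  \<open>b\<close> is infinite, the finite gap forces \<open>a\<close> to be infinite too and both
  transforms equal 1, so uniformity extends to points of infinite value.\<close>

lemma abs_kruzhkov_diff_le:
  assumes "a \<le> b" "b \<le> a + ennreal e" "e \<ge> 0"
  shows "\<bar>kruzhkov a - kruzhkov b\<bar> \<le> e"
proof (cases "b = \<infinity>")
  case True
  then have "a = \<infinity>" using assms(2) by (metis ennreal_add_eq_top ennreal_neq_top infinity_ennreal_def top.extremum_uniqueI)
  then show ?thesis using True assms(3) by simp
next
  case False
  then have fin: "b < top" "a < top" using assms(1) by (auto simp: less_top order_le_less_trans)
  define x y where "x = enn2real a" and "y = enn2real b"
  have ab: "a = ennreal x" "b = ennreal y" "x \<ge> 0" "y \<ge> 0" using fin by (simp_all add: x_def y_def)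
  have xy: "x \<le> y" "y \<le> x + e"
    using assms ab(3,4) unfolding ab(1,2) by (simp_all add: ennreal_plus[symmetric] del: ennreal_plus)
  have k: "kruzhkov a = 1 - exp (- x)" "kruzhkov b = 1 - exp (- y)"
    using ab(3,4) unfolding ab(1,2) by (simp_all add: kruzhkov_def)
  have "exp (- x) - exp (- y) = exp (- x) * (1 - exp (- (y - x)))"
    by (simp add: right_diff_distrib flip: exp_add)
  also have "\<dots> \<le> 1 * (y - x)"
  proof (rule mult_mono)
    show "1 - exp (- (y - x)) \<le> y - x" using exp_ge_add_one_self[of "- (y - x)"] by linarith
  qed (use ab(3) xy in simp_all)
  finally have "exp (- x) - exp (- y) \<le> e" using xy by simp
  moreover have "exp (- y) \<le> exp (- x)" using xy by simp
  ultimately show ?thesis unfolding k by simp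
qed

lemma abs_enn2real_diff_le:
  assumes "a \<le> b + ennreal e" "b \<le> a + ennreal e" "e \<ge> 0" "a < \<infinity>" "b < \<infinity>"
  shows "\<bar>enn2real a - enn2real b\<bar> \<le> e"
proof -
  define x y where "x = enn2real a" and "y = enn2real b"
  have ab: "a = ennreal x" "b = ennreal y" "x \<ge> 0" "y \<ge> 0" using assms(4,5) by (simp_all add: x_def y_def)
  have "x \<le> y + e" "y \<le> x + e"
    using assms(1-3) ab(3,4) unfolding ab(1,2) by (simp_all add: ennreal_plus[symmetric] del: ennreal_plus)
  then show ?thesis by (simp add: x_def y_def abs_le_iff)
qed

text \<open>The common content of the two null-controllability alternatives: a stabilizing control
  from each point of the open ball, and smallness of \<open>V 0\<close> near the origin. The growth
  condition on the cost acts only through the latter, so the arguments below need no case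
  distinction.\<close>

locale value_system = cost_system U G G1 f g
  for U :: "(real ^ 'm) set" and G G1 :: "(real ^ 'n) set" and f :: "real ^ 'n \<Rightarrow> real ^ 'm \<Rightarrow> real ^ 'n" and g +
  fixes r :: real and \<beta> :: "real \<Rightarrow> real \<Rightarrow> real"
  assumes r_pos: "r > 0" and cball_r: "cball 0 r \<subseteq> G" and KL: "\<beta> \<in> class_KL"
    and stabilizing: "\<And>x0. norm x0 < r \<Longrightarrow> \<exists>u\<in>controls U. \<forall>t\<ge>0. norm (sol x0 u t) \<le> \<beta> (norm x0) t"
    and value_0_small: "\<And>e. e > 0 \<Longrightarrow> \<exists>\<rho>>0. \<forall>x. norm x \<le> \<rho> \<longrightarrow> V 0 x \<le> ennreal e"
begin

abbreviation D0 :: "(real ^ 'n) set" where "D0 \<equiv> null_controllable_domain U G G1 f"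

lemma beta_tendsto: "\<rho> \<ge> 0 \<Longrightarrow> (\<beta> \<rho> \<longlongrightarrow> 0) at_top"
  using KL by (simp add: class_KL_def class_L_def)

lemma beta_mono: "0 \<le> \<rho> \<Longrightarrow> \<rho> \<le> \<rho>' \<Longrightarrow> 0 \<le> t \<Longrightarrow> \<beta> \<rho> t \<le> \<beta> \<rho>' t"
proof -
  assume a: "0 \<le> \<rho>" "\<rho> \<le> \<rho>'" "0 \<le> t"
  have "strict_mono_on {0..} (\<lambda>s. \<beta> s t)" using KL a(3) by (simp add: class_KL_def class_K_def)
  then have "mono_on {0..} (\<lambda>s. \<beta> s t)" by (rule strict_mono_on_imp_mono_on)
  then show "\<beta> \<rho> t \<le> \<beta> \<rho>' t" by (rule mono_onD) (use a in auto)
qed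

lemma beta_eventually_less:
  assumes "\<rho> \<ge> 0" "e > 0"
  obtains t where "t \<ge> 0" "\<beta> \<rho> t < e"
proof -
  have "\<forall>\<^sub>F t in at_top. \<beta> \<rho> t < e" using order_tendstoD(2)[OF beta_tendsto[OF assms(1)] assms(2)] .
  then have "\<forall>\<^sub>F t in at_top. t \<ge> 0 \<and> \<beta> \<rho> t < e" using eventually_ge_at_top[of "0::real"] by eventually_elim simp
  then obtain t where "t \<ge> 0 \<and> \<beta> \<rho> t < e" using eventually_happens[of _ "at_top :: real filter"] by auto
  then show thesis using that by blast
qed

lemma in_G: "norm x \<le> r \<Longrightarrow> x \<in> G"
  using cball_r by auto

text \<open>The open ball in the controllability hypothesis can be closed: the bound \<open>\<beta> r t\<close> is uniform up
  to the sphere, so nearby points of the ball steer boundary points inside.\<close>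

lemma cball_enters_ball:
  assumes "norm x0 \<le> r"
  obtains u t where "u \<in> controls U" "t \<ge> 0" "norm (sol x0 u t) < r"
proof -
  \<comment> \<open>The order of choice matters: \<open>t\<close> comes from the uniform bound
    \<beta> r, the constant \<open>C\<close> depends on \<open>t\<close>, and only then is the
    nearby interior point \<open>y\<close> chosen. Half of \<open>r\<close> is left for the distance
    between the two trajectories.\<close>
  obtain t where t: "t \<ge> 0" "\<beta> r t < r / 2" using beta_eventually_less[of r "r / 2"] r_pos by auto
  obtain C where C: "C > 0" "\<And>x0 y0 u s. \<lbrakk>x0 \<in> cball 0 r; y0 \<in> cball 0 r; u \<in> controls U; 0 \<le> s; s \<le> t\<rbrakk> \<Longrightarrow>
    norm (sol x0 u s - sol y0 u s) \<le> C * norm (x0 - y0)"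
    by (rule state_dependence[OF compact_cball cball_r, of t]) blast
  \<comment> \<open>Shrinking \<open>x0\<close> by the factor \<open>1 - \<eta>\<close> moves it by
    at most \<open>\<eta> * r\<close>, hence moves the state at time \<open>t\<close> by at most
    \<open>r / 2\<close>.\<close>
  define \<eta> where "\<eta> = min 1 (1 / (2 * C))"
  have \<eta>: "0 < \<eta>" "\<eta> \<le> 1" "C * \<eta> \<le> 1 / 2" using C(1) by (auto simp: \<eta>_def min_def field_simps)
  define y where "y = (1 - \<eta>) *\<^sub>R x0"
  have ny: "norm y = (1 - \<eta>) * norm x0" using \<eta> by (simp add: y_def)
  have "norm y < r"
  proof (cases "norm x0 = 0")
    case False
    then have "(1 - \<eta>) * norm x0 < 1 * norm x0" using \<eta> by (intro mult_strict_right_mono) simp_all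
    then show ?thesis using ny assms by simp
  qed (use ny r_pos in simp)
  then obtain u where u: "u \<in> controls U" "\<forall>t\<ge>0. norm (sol y u t) \<le> \<beta> (norm y) t"
    using stabilizing by blast
  have "norm (sol x0 u t - sol y u t) \<le> C * norm (x0 - y)"
    by (rule C(2)) (use assms \<open>norm y < r\<close> u t in auto)
  also have "x0 - y = \<eta> *\<^sub>R x0" by (simp add: y_def scaleR_left_diff_distrib)
  also have "norm (\<eta> *\<^sub>R x0) = \<eta> * norm x0" using \<eta> by simp
  also have "C * (\<eta> * norm x0) \<le> 1 / 2 * r"
    unfolding mult.assoc[symmetric] using \<eta> assms by (intro mult_mono) simp_all
  finally have "norm (sol x0 u t - sol y u t) \<le> r / 2" by simp
  moreover have "norm (sol y u t) < r / 2"
  proof -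
    have "norm (sol y u t) \<le> \<beta> (norm y) t" using u(2) t(1) by blast
    also have "\<dots> \<le> \<beta> r t" using \<open>norm y < r\<close> t(1) by (intro beta_mono) simp_all
    finally show ?thesis using t(2) by simp
  qed
  ultimately have "norm (sol x0 u t) < r"
    using norm_triangle_ineq[of "sol x0 u t - sol y u t" "sol y u t"] by simp
  then show thesis using that u(1) t(1) by blast
qed

lemma D0_subset: "D0 \<subseteq> G"
  by (auto simp: null_controllable_domain_def)

lemma ball_subset_D0:
  assumes "norm x0 < r"
  shows "x0 \<in> D0"
proof -
  obtain u where u: "u \<in> controls U" "\<forall>t\<ge>0. norm (sol x0 u t) \<le> \<beta> (norm x0) t"
    using stabilizing[OF assms] by blast
  have "((\<lambda>t. norm (sol x0 u t)) \<longlongrightarrow> 0) at_top"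
  proof (rule tendsto_sandwich[OF _ _ tendsto_const beta_tendsto])
    show "\<forall>\<^sub>F t in at_top. norm (sol x0 u t) \<le> \<beta> (norm x0) t"
      using eventually_ge_at_top[of "0::real"] by eventually_elim (use u(2) in blast)
  qed simp_all
  then show ?thesis using u(1) in_G[of x0] assms unfolding null_controllable_domain_def by auto
qed

lemma D0_switch:
  assumes x0: "x0 \<in> G" and u: "u \<in> controls U" and T: "T \<ge> 0" and D: "sol x0 u T \<in> D0"
  shows "x0 \<in> D0"
proof -
  obtain v where v: "v \<in> controls U" "((\<lambda>t. norm (sol (sol x0 u T) v t)) \<longlongrightarrow> 0) at_top"
    using D unfolding null_controllable_domain_def by blast
  have "filterlim (\<lambda>t. - T + t) at_top at_top"
    by (rule filterlim_tendsto_add_at_top[OF tendsto_const filterlim_ident])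
  from filterlim_compose[OF v(2) this]
  have "((\<lambda>t. norm (sol (sol x0 u T) v (- T + t))) \<longlongrightarrow> 0) at_top" .
  moreover have "\<forall>\<^sub>F t in at_top. norm (sol (sol x0 u T) v (- T + t)) = norm (sol x0 (switch T u v) t)"
    using eventually_ge_at_top[of T]
  proof eventually_elim
    fix t assume "T \<le> t"
    then show "norm (sol (sol x0 u T) v (- T + t)) = norm (sol x0 (switch T u v) t)"
      using state_switch(2)[OF x0 u v(1) T, of "- T + t"] by simp
  qed
  ultimately have "((\<lambda>t. norm (sol x0 (switch T u v) t)) \<longlongrightarrow> 0) at_top"
    by (rule Lim_transform_eventually)
  then show ?thesis using x0 switch_in_controls[OF u v(1) T] unfolding null_controllable_domain_def by blast
qed

text \<open>Up to two switches lead from the target to the origin: the closed ball of radius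
  \<open>r\<close> is steered into the open one, where a stabilizing control exists. The detour
  covers starting from the sphere of radius \<open>r\<close>.\<close>

lemma D0_iff_reach:
  assumes "0 < \<delta>" "\<delta> \<le> r" "x0 \<in> G"
  shows "x0 \<in> D0 \<longleftrightarrow> reach \<delta> x0"
proof
  assume "x0 \<in> D0"
  then obtain u where u: "u \<in> controls U" "((\<lambda>t. norm (sol x0 u t)) \<longlongrightarrow> 0) at_top"
    unfolding null_controllable_domain_def by blast
  have "\<forall>\<^sub>F t in at_top. norm (sol x0 u t) < \<delta>" using order_tendstoD(2)[OF u(2) assms(1)] .
  then have "\<forall>\<^sub>F t in at_top. 0 \<le> t \<and> norm (sol x0 u t) < \<delta>"
    using eventually_ge_at_top[of "0::real"] by eventually_elim simp
  then obtain t where "0 \<le> t \<and> norm (sol x0 u t) < \<delta>"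
    using eventually_happens[of _ "at_top :: real filter"] by auto
  then show "reach \<delta> x0" using u(1) unfolding reach_def by (meson less_imp_le)
next
  assume "reach \<delta> x0"
  then obtain u T where u: "u \<in> controls U" "T \<ge> 0" "norm (sol x0 u T) \<le> \<delta>" unfolding reach_def by blast
  have le: "norm (sol x0 u T) \<le> r" using u(3) assms(2) by simp
  obtain v t where v: "v \<in> controls U" "t \<ge> 0" "norm (sol (sol x0 u T) v t) < r"
    by (rule cball_enters_ball[OF le])
  have "sol x0 u T \<in> D0"
    by (rule D0_switch[OF in_G[OF le] v(1,2) ball_subset_D0[OF v(3)]])
  then show "x0 \<in> D0" by (rule D0_switch[OF assms(3) u(1,2)])
qed

lemma value_0_le:
  assumes "\<delta> > 0" "x0 \<in> G" and small: "\<And>x. norm x \<le> \<delta> \<Longrightarrow> V 0 x \<le> ennreal e"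
  shows "V 0 x0 \<le> V \<delta> x0 + ennreal e"
proof -
  have "V 0 x0 \<le> ennreal e + V \<delta> x0" unfolding value_exit[OF assms(1)]
  proof (rule ennreal_le_add_Inf)
    fix c assume "c \<in> {cost x0 u {0..T} | u T. u \<in> controls U \<and> T \<ge> 0 \<and> sol x0 u T \<in> cball 0 \<delta>}"
    then obtain u T where u: "u \<in> controls U" "T \<ge> 0" "norm (sol x0 u T) \<le> \<delta>" "c = cost x0 u {0..T}" by auto
    have "V 0 x0 \<le> c + V 0 (sol x0 u T)" unfolding u(4) by (rule value_le_switch[OF order_refl assms(2) u(1,2)])
    also have "\<dots> \<le> c + ennreal e" by (intro add_left_mono small u(3))
    finally show "V 0 x0 \<le> ennreal e + c" by (simp add: add.commute)
  qed
  then show ?thesis by (simp add: add.commute)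
qed

text \<open>For \<delta> = 0 the infinite-horizon value is compared with an exit value for a radius
  so small that \<open>V 0\<close> is at most 1 on the target; the two then differ by at most 1 and
  are finite at the same points, where the reachability criterion applies.\<close>

lemma D0_eq_finite:
  assumes "0 \<le> \<delta>" "\<delta> \<le> r"
  shows "D0 = {x0 \<in> G. V \<delta> x0 < \<infinity>}"
proof (cases "\<delta> = 0")
  case False
  then have "x0 \<in> D0 \<longleftrightarrow> V \<delta> x0 < \<infinity>" if "x0 \<in> G" for x0
    using D0_iff_reach[of \<delta> x0] value_exit_finite_iff[of \<delta> x0] assms that by simp
  then show ?thesis using D0_subset by blast
next
  case True
  obtain \<rho> where \<rho>: "\<rho> > 0" "\<And>x. norm x \<le> \<rho> \<Longrightarrow> V 0 x \<le> ennreal 1" using value_0_small[of 1] by auto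
  define \<rho>' where "\<rho>' = min \<rho> r"
  have \<rho>': "\<rho>' > 0" "\<rho>' \<le> r" "\<rho>' \<le> \<rho>" using \<rho>(1) r_pos by (simp_all add: \<rho>'_def)
  have "V 0 x0 < \<infinity> \<longleftrightarrow> V \<rho>' x0 < \<infinity>" if x0: "x0 \<in> G" for x0
  proof
    assume "V 0 x0 < \<infinity>"
    then show "V \<rho>' x0 < \<infinity>" using value_exit_le_value_0[OF \<rho>'(1) x0] by (rule order_le_less_trans[rotated])
  next
    assume fin: "V \<rho>' x0 < \<infinity>"
    have "V 0 x0 \<le> V \<rho>' x0 + ennreal 1" by (rule value_0_le[OF \<rho>'(1) x0]) (use \<rho>(2) \<rho>'(3) in simp)
    also have "\<dots> < \<infinity>" using fin by simp
    finally show "V 0 x0 < \<infinity>" .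
  qed
  moreover have "x0 \<in> D0 \<longleftrightarrow> V \<rho>' x0 < \<infinity>" if "x0 \<in> G" for x0
    using D0_iff_reach[OF \<rho>'(1,2) that] value_exit_finite_iff[OF \<rho>'(1) that] by simp
  ultimately show ?thesis unfolding True using D0_subset by blast
qed

lemma kruzhkov_less_1_iff: "kruzhkov a < 1 \<longleftrightarrow> a < \<infinity>"
  by (simp add: kruzhkov_def less_top)

lemma value_uniformly_close:
  assumes "e > 0"
  shows "\<forall>\<^sub>F \<delta> in at_right 0. \<forall>x0\<in>G. V \<delta> x0 \<le> V 0 x0 \<and> V 0 x0 \<le> V \<delta> x0 + ennreal e"
proof -
  obtain \<rho> where \<rho>: "\<rho> > 0" "\<And>x. norm x \<le> \<rho> \<Longrightarrow> V 0 x \<le> ennreal e" using value_0_small[OF assms] by blast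
  have "\<forall>x0\<in>G. V \<delta> x0 \<le> V 0 x0 \<and> V 0 x0 \<le> V \<delta> x0 + ennreal e" if "0 < \<delta>" "\<delta> < \<rho>" for \<delta>
  proof (intro ballI conjI)
    fix x0 assume "x0 \<in> G"
    show "V \<delta> x0 \<le> V 0 x0" by (rule value_exit_le_value_0) fact+
    show "V 0 x0 \<le> V \<delta> x0 + ennreal e" by (rule value_0_le) (use that \<open>x0 \<in> G\<close> \<rho>(2) in simp_all)
  qed
  then show ?thesis using \<rho>(1) by (auto simp: eventually_at_right_field intro!: exI[of _ \<rho>])
qed

lemma kruzhkov_uniform_limit:
  "uniform_limit G (\<lambda>\<delta> x0. kruzhkov (V \<delta> x0)) (\<lambda>x0. kruzhkov (V 0 x0)) (at_right 0)"
proof (rule uniform_limitI)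
  fix e :: real assume "e > 0"
  then have "e / 2 > 0" by simp
  from value_uniformly_close[OF this]
  show "\<forall>\<^sub>F \<delta> in at_right 0. \<forall>x0\<in>G. dist (kruzhkov (V \<delta> x0)) (kruzhkov (V 0 x0)) < e"
  proof eventually_elim
    fix \<delta> assume *: "\<forall>x0\<in>G. V \<delta> x0 \<le> V 0 x0 \<and> V 0 x0 \<le> V \<delta> x0 + ennreal (e / 2)"
    show "\<forall>x0\<in>G. dist (kruzhkov (V \<delta> x0)) (kruzhkov (V 0 x0)) < e"
    proof
      fix x0 assume "x0 \<in> G"
      then have "\<bar>kruzhkov (V \<delta> x0) - kruzhkov (V 0 x0)\<bar> \<le> e / 2"
        using * \<open>e > 0\<close> by (intro abs_kruzhkov_diff_le) simp_all
      then show "dist (kruzhkov (V \<delta> x0)) (kruzhkov (V 0 x0)) < e" using \<open>e > 0\<close> by (simp add: dist_real_def)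
    qed
  qed
qed

text \<open>On \<open>D0\<close> all values concerned are finite, so the additive estimate between
  the extended values becomes an estimate of real differences with the same constant at every
  point.\<close>

lemma value_uniform_limit:
  "uniform_limit D0 (\<lambda>\<delta> x0. enn2real (V \<delta> x0)) (\<lambda>x0. enn2real (V 0 x0)) (at_right 0)"
proof (rule uniform_limitI)
  fix e :: real assume "e > 0"
  then have "e / 2 > 0" by simp
  from value_uniformly_close[OF this]
  show "\<forall>\<^sub>F \<delta> in at_right 0. \<forall>x0\<in>D0. dist (enn2real (V \<delta> x0)) (enn2real (V 0 x0)) < e"
  proof eventually_elim
    fix \<delta> assume *: "\<forall>x0\<in>G. V \<delta> x0 \<le> V 0 x0 \<and> V 0 x0 \<le> V \<delta> x0 + ennreal (e / 2)"
    show "\<forall>x0\<in>D0. dist (enn2real (V \<delta> x0)) (enn2real (V 0 x0)) < e"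
    proof
      fix x0 assume "x0 \<in> D0"
      then have G: "x0 \<in> G" and fin: "V 0 x0 < \<infinity>" using D0_eq_finite[of 0] r_pos by auto
      have le: "V \<delta> x0 \<le> V 0 x0" "V 0 x0 \<le> V \<delta> x0 + ennreal (e / 2)" using * G by auto
      have "\<bar>enn2real (V \<delta> x0) - enn2real (V 0 x0)\<bar> \<le> e / 2"
      proof (rule abs_enn2real_diff_le)
        show "V \<delta> x0 \<le> V 0 x0 + ennreal (e / 2)" using le(1) by (simp add: add_increasing2)
        show "V \<delta> x0 < \<infinity>" using le(1) fin by (rule order_le_less_trans)
      qed (use le fin \<open>e > 0\<close> in simp_all)
      then show "dist (enn2real (V \<delta> x0)) (enn2real (V 0 x0)) < e" using \<open>e > 0\<close> by (simp add: dist_real_def)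
    qed
  qed
qed

end

section \<open>Lipschitz continuity under the Petrov condition\<close>

context value_system begin

lemma constant_control: "v \<in> U \<Longrightarrow> (\<lambda>_. v) \<in> controls U"
  by (rule controlsI) simp_all

lemma exit_value_inside:
  assumes "\<delta> > 0" "x \<in> G" "norm x \<le> \<delta>"
  shows "V \<delta> x = 0"
proof -
  obtain v where "v \<in> U" using U_nonempty by blast
  then have c: "(\<lambda>_. v) \<in> controls U" by (rule constant_control)
  have "V \<delta> x \<le> cost x (\<lambda>_. v) {0..0}"
    by (rule value_le_cost[OF assms(1) c]) (simp_all add: state_0[OF assms(2) c] assms(3))
  also have "\<dots> \<le> ennreal (run x (\<lambda>_. v) 0 * 0)"
    by (rule cost_le) (use run_nonneg[OF assms(2) c] in auto)
  finally show ?thesis by simp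
qed

text \<open>A negative real infimum yields a negative member once the set is bounded below, which
  holds by compactness of \<open>U\<close>.\<close>

lemma petrov_point:
  assumes "petrov_condition U f \<delta>" "norm z = \<delta>" "z \<in> G"
  obtains v where "v \<in> U" "z \<bullet> f z v < 0"
proof -
  have "continuous_on U (f z)"
    by (rule f_continuous_on_compose[OF continuous_on_const continuous_on_id]) (use assms(3) G_subset(2) in auto)
  then have "compact ((\<lambda>u. z \<bullet> f z u) ` U)"
    by (intro compact_continuous_image compact_U continuous_on_inner continuous_on_const) simp
  then have "bdd_below ((\<lambda>u. z \<bullet> f z u) ` U)" by (intro bounded_imp_bdd_below compact_imp_bounded)
  moreover have "(INF u\<in>U. z \<bullet> f z u) < 0" using assms(1,2) by (simp add: petrov_condition_def)
  ultimately have "\<exists>v\<in>U. z \<bullet> f z v < 0" using cINF_less_iff[OF U_nonempty] by blast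
  then show thesis using that by blast
qed

text \<open>With a constant control the velocity is continuous in time, so the trajectory is
  differentiable in the classical sense at every positive time.\<close>

lemma constant_control_square_derivative:
  assumes x: "x \<in> G" and v: "v \<in> U" and t: "0 < t"
  shows "((\<lambda>t. (norm (sol x (\<lambda>_. v) t))\<^sup>2) has_real_derivative
      2 * (sol x (\<lambda>_. v) t \<bullet> f (sol x (\<lambda>_. v) t) v)) (at t)"
proof -
  note c = constant_control[OF v]
  define X where "X = sol x (\<lambda>_. v)"
  have Xc: "continuous_on {0..t + 1} X" unfolding X_def by (rule continuous_on_subset[OF state_continuous[OF x c]]) auto
  have XG: "X s \<in> G1" if "s \<in> {0..t + 1}" for s
    unfolding X_def using subsetD[OF G_subset(2) state_in_G[OF x c, of s]] that by simp
  have "continuous_on {0..t + 1} (\<lambda>s. f (X s) v)"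
    by (rule f_continuous_on_compose[OF Xc continuous_on_const]) (use XG v in auto)
  then have "((\<lambda>s. integral {0..s} (\<lambda>s. f (X s) v)) has_vector_derivative f (X t) v) (at t within {0..t + 1})"
    by (rule integral_has_vector_derivative) (use t in simp)
  then have "((\<lambda>s. integral {0..s} (\<lambda>s. f (X s) v)) has_vector_derivative f (X t) v) (at t)"
    using t by (simp add: at_within_Icc_at)
  then have "((\<lambda>s. x + integral {0..s} (\<lambda>s. f (X s) v)) has_vector_derivative 0 + f (X t) v) (at t)"
    by (intro has_vector_derivative_add has_vector_derivative_const)
  then have "(X has_vector_derivative 0 + f (X t) v) (at t)"
  proof (rule has_vector_derivative_transform_within_open)
    show "open {0::real<..}" "t \<in> {0<..}" using t by auto
    show "x + integral {0..s} (\<lambda>s. f (X s) v) = X s" if "s \<in> {0<..}" for s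
      using state_integral(1)[OF x c, of s] that by (simp add: X_def)
  qed
  then have d: "(X has_vector_derivative f (X t) v) (at t)" by simp
  have "((\<lambda>s. X s \<bullet> X s) has_vector_derivative X t \<bullet> f (X t) v + f (X t) v \<bullet> X t) (at t)"
    by (rule bounded_bilinear.has_vector_derivative[OF bounded_bilinear_inner d d])
  then show ?thesis
    unfolding has_real_derivative_iff_has_vector_derivative X_def[symmetric]
    by (simp add: power2_norm_eq_inner inner_commute)
qed

text \<open>The control value that points inward at \<open>z\<close> still does so near
  \<open>z\<close>. Held constant, it makes the squared norm fall at a rate of at least
  \<open>2 * \<eta>\<close>, so the ball is reached within a time proportional to
  \<open>norm x - \<delta>\<close>, and the running cost is bounded meanwhile.\<close>

lemma petrov_local:
  assumes \<delta>: "0 < \<delta>" "\<delta> \<le> r" and P: "petrov_condition U f \<delta>" and z: "norm z = \<delta>"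
  shows "\<exists>\<rho>>0. \<exists>c\<ge>0. \<forall>x. norm (x - z) < \<rho> \<longrightarrow> x \<in> G \<and> V \<delta> x \<le> ennreal (c * max 0 (norm x - \<delta>))"
proof -
  have zG: "z \<in> G" using in_G z \<delta> by simp
  obtain v where v: "v \<in> U" "z \<bullet> f z v < 0" by (rule petrov_point[OF P z zG])
  note cv = constant_control[OF v(1)]
  \<comment> \<open>Half of the decrease at \<open>z\<close>, so that a strict inequality is left to
    persist in a neighbourhood.\<close>
  define \<eta> where "\<eta> = - (z \<bullet> f z v) / 2"
  have \<eta>: "\<eta> > 0" "z \<bullet> f z v < - \<eta>" using v(2) by (simp_all add: \<eta>_def)
  have "continuous_on G (\<lambda>x. f x v)"
    by (rule f_continuous_on_compose[OF continuous_on_id continuous_on_const]) (use G_subset(2) v in auto)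
  then have "continuous_on G (\<lambda>x. x \<bullet> f x v)" by (intro continuous_on_inner continuous_on_id)
  then have "open (G \<inter> (\<lambda>x. x \<bullet> f x v) -` {..<- \<eta>})" by (rule continuous_open_preimage) (simp_all add: open_G)
  moreover have "z \<in> G \<inter> (\<lambda>x. x \<bullet> f x v) -` {..<- \<eta>}" using zG \<eta>(2) by simp
  ultimately obtain \<rho>0 where \<rho>0: "\<rho>0 > 0" "cball z \<rho>0 \<subseteq> G \<inter> (\<lambda>x. x \<bullet> f x v) -` {..<- \<eta>}"
    using open_contains_cball by blast
  have cb: "cball z \<rho>0 \<subseteq> G" using \<rho>0(2) by blast
  have decr: "y \<bullet> f y v < - \<eta>" if "norm (y - z) \<le> \<rho>0" for y
    using subsetD[OF \<rho>0(2), of y] that by (simp add: dist_norm norm_minus_commute)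
  have "continuous_on {0..} (sol z (\<lambda>_. v))" by (rule state_continuous[OF zG cv])
  then obtain \<tau>0 where \<tau>0: "\<tau>0 > 0" "\<And>t. t \<in> {0..} \<Longrightarrow> dist t 0 < \<tau>0 \<Longrightarrow>
      dist (sol z (\<lambda>_. v) t) (sol z (\<lambda>_. v) 0) < \<rho>0 / 2"
    unfolding continuous_on_iff using \<rho>0(1) by (metis atLeast_iff half_gt_zero order_refl)
  define \<tau> where "\<tau> = \<tau>0 / 2"
  have \<tau>: "\<tau> > 0" using \<tau>0(1) by (simp add: \<tau>_def)
  have zt: "norm (sol z (\<lambda>_. v) t - z) \<le> \<rho>0 / 2" if "0 \<le> t" "t \<le> \<tau>" for t
    using \<tau>0(2)[of t] that \<tau>0(1) by (simp add: state_0[OF zG cv] dist_norm \<tau>_def)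
  obtain C where C: "C > 0" "\<And>x0 y0 u s. \<lbrakk>x0 \<in> cball z \<rho>0; y0 \<in> cball z \<rho>0; u \<in> controls U; 0 \<le> s; s \<le> \<tau>\<rbrakk> \<Longrightarrow>
    norm (sol x0 u s - sol y0 u s) \<le> C * norm (x0 - y0)"
    by (rule state_dependence[OF compact_cball cb, of \<tau>]) blast
  obtain M where M: "M > 0" "\<And>x0 u t. \<lbrakk>x0 \<in> cball z \<rho>0; u \<in> controls U; 0 \<le> t; t \<le> \<tau>\<rbrakk> \<Longrightarrow> run x0 u t \<le> M"
    by (rule run_bounded[OF compact_cball cb, of \<tau>]) blast
  \<comment> \<open>The bound 1 gives \<open>norm x + \<delta> \<le> 2 * \<delta> + 1\<close>;
    \<open>\<rho>0\<close> puts \<open>x\<close> where \<open>C\<close> and \<open>M\<close> are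
    valid; \<open>\<rho>0 / (2 * C)\<close> keeps its trajectory within \<open>\<rho>0\<close> of
    \<open>z\<close>; the last entry keeps the stopping time below \<open>\<tau>\<close>.\<close>
  define \<rho> where "\<rho> = Min {1, \<rho>0, \<rho>0 / (2 * C), 2 * \<eta> * \<tau> / (2 * \<delta> + 1)}"
  have \<rho>: "\<rho> > 0" "\<rho> \<le> 1" "\<rho> \<le> \<rho>0" "\<rho> \<le> \<rho>0 / (2 * C)" "\<rho> \<le> 2 * \<eta> * \<tau> / (2 * \<delta> + 1)"
    using \<rho>0(1) C(1) \<eta>(1) \<tau> \<delta>(1) by (simp_all add: \<rho>_def)
  define c where "c = M * ((2 * \<delta> + 1) / (2 * \<eta>))"
  have c0: "c \<ge> 0" using M(1) \<delta>(1) \<eta>(1) by (simp add: c_def)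
  have "x \<in> G \<and> V \<delta> x \<le> ennreal (c * max 0 (norm x - \<delta>))" if x: "norm (x - z) < \<rho>" for x
  proof
    have xb: "x \<in> cball z \<rho>0" using x \<rho>(3) by (simp add: dist_norm norm_minus_commute)
    then show xG: "x \<in> G" using cb by blast
    show "V \<delta> x \<le> ennreal (c * max 0 (norm x - \<delta>))"
    proof (cases "norm x \<le> \<delta>")
      case True
      then show ?thesis using exit_value_inside[OF \<delta>(1) xG] by simp
    next
      case False
      define X where "X = sol x (\<lambda>_. v)"
      have near: "norm (X t - z) \<le> \<rho>0" if "0 \<le> t" "t \<le> \<tau>" for t
      proof -
        have "norm (X t - sol z (\<lambda>_. v) t) \<le> C * norm (x - z)"
          unfolding X_def by (rule C(2)[OF xb _ cv that]) (use \<rho>0(1) in simp)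
        also have "\<dots> \<le> C * (\<rho>0 / (2 * C))" using x \<rho>(4) C(1) by (intro mult_left_mono) simp_all
        also have "\<dots> = \<rho>0 / 2" using C(1) by simp
        finally have "norm (X t - sol z (\<lambda>_. v) t) \<le> \<rho>0 / 2" .
        then show ?thesis
          using zt[OF that] norm_triangle_ineq[of "X t - sol z (\<lambda>_. v) t" "sol z (\<lambda>_. v) t - z"] by simp
      qed
      \<comment> \<open>The time in which the squared norm, falling at rate
        \<open>2 * \<eta>\<close>, drops to the square of \<delta>.\<close>
      define T where "T = ((norm x)\<^sup>2 - \<delta>\<^sup>2) / (2 * \<eta>)"
      have d: "norm x - \<delta> > 0" "norm x - \<delta> < \<rho>"
        using False x z norm_triangle_ineq2[of x z] by simp_all
      have sq: "(norm x)\<^sup>2 - \<delta>\<^sup>2 = (norm x - \<delta>) * (norm x + \<delta>)" by (simp add: power2_eq_square algebra_simps)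
      also have "\<dots> \<le> (norm x - \<delta>) * (2 * \<delta> + 1)" using d \<rho>(2) by (intro mult_left_mono) simp_all
      finally have sqle: "(norm x)\<^sup>2 - \<delta>\<^sup>2 \<le> (norm x - \<delta>) * (2 * \<delta> + 1)" .
      have T0: "T > 0" unfolding T_def sq using d \<delta>(1) \<eta>(1) by simp
      have Tle: "T \<le> (norm x - \<delta>) * ((2 * \<delta> + 1) / (2 * \<eta>))"
        using divide_right_mono[OF sqle, of "2 * \<eta>"] \<eta>(1) by (simp add: T_def)
      have "T \<le> \<tau>"
      proof -
        have "(norm x - \<delta>) * ((2 * \<delta> + 1) / (2 * \<eta>)) \<le> 2 * \<eta> * \<tau> / (2 * \<delta> + 1) * ((2 * \<delta> + 1) / (2 * \<eta>))"
          using d(2) \<rho>(5) \<delta>(1) \<eta>(1) by (intro mult_right_mono) simp_all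
        also have "\<dots> = \<tau>"
        proof -
          have "2 * \<eta> * \<tau> / k * (k / (2 * \<eta>)) = \<tau>" if "k > 0" for k using that \<eta>(1) by simp
          then show ?thesis using \<delta>(1) by simp
        qed
        finally show ?thesis using Tle by simp
      qed
      have "(norm (X T))\<^sup>2 + 2 * \<eta> * T \<le> (norm (X 0))\<^sup>2 + 2 * \<eta> * 0"
      proof (rule DERIV_nonpos_imp_decreasing_open[of 0 T "\<lambda>t. (norm (X t))\<^sup>2 + 2 * \<eta> * t"])
        fix t assume t: "0 < t" "t < T"
        have "((\<lambda>t. (norm (X t))\<^sup>2 + 2 * \<eta> * t) has_real_derivative 2 * (X t \<bullet> f (X t) v) + 2 * \<eta>) (at t)"
          using DERIV_add[OF constant_control_square_derivative[OF xG v(1) t(1)] DERIV_cmult[OF DERIV_ident, of "2 * \<eta>"]]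
          by (simp add: X_def)
        moreover have "2 * (X t \<bullet> f (X t) v) + 2 * \<eta> \<le> 0" using decr[OF near[of t]] t \<open>T \<le> \<tau>\<close> by simp
        ultimately show "\<exists>y. ((\<lambda>t. (norm (X t))\<^sup>2 + 2 * \<eta> * t) has_real_derivative y) (at t) \<and> y \<le> 0" by blast
      next
        have "continuous_on {0..T} X" unfolding X_def by (rule continuous_on_subset[OF state_continuous[OF xG cv]]) auto
        then show "continuous_on {0..T} (\<lambda>t. (norm (X t))\<^sup>2 + 2 * \<eta> * t)" by (intro continuous_intros)
      qed (use T0 in simp)
      moreover have "X 0 = x" unfolding X_def by (rule state_0[OF xG cv])
      moreover have "2 * \<eta> * T = (norm x)\<^sup>2 - \<delta>\<^sup>2" using \<eta>(1) by (simp add: T_def)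
      ultimately have "(norm (X T))\<^sup>2 \<le> \<delta>\<^sup>2" by simp
      then have XT: "norm (X T) \<le> \<delta>" using \<delta>(1) by (rule_tac power2_le_imp_le) simp_all
      have "V \<delta> x \<le> cost x (\<lambda>_. v) {0..T}"
        by (rule value_le_cost[OF \<delta>(1) cv]) (use T0 XT in \<open>simp_all add: X_def\<close>)
      also have "\<dots> \<le> ennreal (M * T)"
        by (rule cost_le) (use T0 M(1) M(2)[OF xb cv] \<open>T \<le> \<tau>\<close> in auto)
      also have "\<dots> \<le> ennreal (c * max 0 (norm x - \<delta>))"
      proof (rule ennreal_leI)
        have "M * T \<le> M * ((norm x - \<delta>) * ((2 * \<delta> + 1) / (2 * \<eta>)))" using Tle M(1) by (intro mult_left_mono) simp_all
        also have "\<dots> = c * (norm x - \<delta>)" by (simp add: c_def)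
        finally show "M * T \<le> c * max 0 (norm x - \<delta>)" using d by simp
      qed
      finally show ?thesis .
    qed
  qed
  then show ?thesis using \<rho>(1) c0 by blast
qed

text \<open>Compactness of the sphere reduces the local estimates to finitely many, and the
  resulting open cover contains a whole collar of some width \<open>\<epsilon>\<close>. Inside the
  ball the value is 0.\<close>

lemma petrov_near_sphere:
  assumes \<delta>: "0 < \<delta>" "\<delta> \<le> r" and P: "petrov_condition U f \<delta>"
  obtains \<epsilon> c where "\<epsilon> > 0" "c \<ge> 0" "\<And>x. x \<in> G \<Longrightarrow> norm x \<le> \<delta> + \<epsilon> \<Longrightarrow> V \<delta> x \<le> ennreal (c * max 0 (norm x - \<delta>))"
proof -
  have "\<forall>z\<in>sphere 0 \<delta>. \<exists>\<rho>>0. \<exists>c\<ge>0. \<forall>x. norm (x - z) < \<rho> \<longrightarrow> x \<in> G \<and> V \<delta> x \<le> ennreal (c * max 0 (norm x - \<delta>))"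
    using petrov_local[OF \<delta> P] by simp
  then obtain \<rho> where \<rho>: "\<forall>z\<in>sphere 0 \<delta>. \<rho> z > 0 \<and> (\<exists>c\<ge>0. \<forall>x. norm (x - z) < \<rho> z \<longrightarrow> x \<in> G \<and> V \<delta> x \<le> ennreal (c * max 0 (norm x - \<delta>)))"
    unfolding bchoice_iff by blast
  then have "\<forall>z\<in>sphere 0 \<delta>. \<exists>c\<ge>0. \<forall>x. norm (x - z) < \<rho> z \<longrightarrow> x \<in> G \<and> V \<delta> x \<le> ennreal (c * max 0 (norm x - \<delta>))"
    by blast
  then obtain c where c: "\<forall>z\<in>sphere 0 \<delta>. c z \<ge> 0 \<and> (\<forall>x. norm (x - z) < \<rho> z \<longrightarrow> x \<in> G \<and> V \<delta> x \<le> ennreal (c z * max 0 (norm x - \<delta>)))"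
    unfolding bchoice_iff by blast
  have cover: "sphere 0 \<delta> \<subseteq> (\<Union>z\<in>sphere 0 \<delta>. ball z (\<rho> z))"
  proof
    fix z :: "real ^ 'n" assume z: "z \<in> sphere 0 \<delta>"
    then have "z \<in> ball z (\<rho> z)" using \<rho> by simp
    then show "z \<in> (\<Union>z\<in>sphere 0 \<delta>. ball z (\<rho> z))" using z by blast
  qed
  obtain D where D: "D \<subseteq> sphere 0 \<delta>" "finite D" "sphere 0 \<delta> \<subseteq> (\<Union>z\<in>D. ball z (\<rho> z))"
    by (rule compactE_image[OF compact_sphere _ cover]) auto
  have "open (\<Union>z\<in>D. ball z (\<rho> z))" by auto
  then obtain \<epsilon> where \<epsilon>: "\<epsilon> > 0" "(\<Union>z\<in>sphere 0 \<delta>. cball z \<epsilon>) \<subseteq> (\<Union>z\<in>D. ball z (\<rho> z))"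
    using compact_subset_open_imp_cball_epsilon_subset[OF compact_sphere _ D(3)] by blast
  \<comment> \<open>The constants are nonnegative, so their sum dominates each of them.\<close>
  define cc where "cc = (\<Sum>z\<in>D. c z)"
  have cnn: "c z \<ge> 0" if "z \<in> D" for z using c D(1) that by blast
  show thesis
  proof (rule that[OF \<epsilon>(1)])
    show cc0: "cc \<ge> 0" unfolding cc_def by (rule sum_nonneg) (rule cnn)
    fix x assume xG: "x \<in> G" and x: "norm x \<le> \<delta> + \<epsilon>"
    show "V \<delta> x \<le> ennreal (cc * max 0 (norm x - \<delta>))"
    proof (cases "norm x \<le> \<delta>")
      case True
      then show ?thesis using exit_value_inside[OF \<delta>(1) xG] by simp
    next
      case False
      \<comment> \<open>The radial projection to the sphere, at distance exactly
        \<open>norm x - \<delta>\<close> from \<open>x\<close>.\<close>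
      define p where "p = (\<delta> / norm x) *\<^sub>R x"
      have nx: "norm x > 0" using False \<delta>(1) by linarith
      have "norm p = \<delta>" using nx \<delta>(1) by (simp add: p_def)
      have "x - p = (1 - \<delta> / norm x) *\<^sub>R x" by (simp add: p_def scaleR_left_diff_distrib)
      then have "norm (x - p) = \<bar>1 - \<delta> / norm x\<bar> * norm x" by simp
      also have "\<dots> = norm x - \<delta>" using nx False by (simp add: field_simps)
      finally have "x \<in> cball p \<epsilon>" using x by (simp add: dist_norm norm_minus_commute)
      then have "x \<in> (\<Union>z\<in>sphere 0 \<delta>. cball z \<epsilon>)" using \<open>norm p = \<delta>\<close> by (intro UN_I[of p]) simp_all
      then obtain z where z: "z \<in> D" "x \<in> ball z (\<rho> z)" using \<epsilon>(2) by blast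
      have "norm (x - z) < \<rho> z" using z(2) by (simp add: dist_norm norm_minus_commute)
      then have "V \<delta> x \<le> ennreal (c z * max 0 (norm x - \<delta>))" using c z(1) D(1) by blast
      also have "\<dots> \<le> ennreal (cc * max 0 (norm x - \<delta>))"
        unfolding cc_def by (intro ennreal_leI mult_right_mono member_le_sum z(1) D(2)) (use cnn in auto)
      finally show ?thesis .
    qed
  qed
qed

section \<open>The local Lipschitz estimate\<close>

lemma cost_perturb:
  assumes x: "x \<in> G" and y: "y \<in> G" and u: "u \<in> controls U" and "0 \<le> T" "0 \<le> a"
    and le: "\<And>t. 0 \<le> t \<Longrightarrow> t \<le> T \<Longrightarrow> run x u t \<le> run y u t + a"
  shows "cost x u {0..T} \<le> cost y u {0..T} + ennreal (a * T)"
proof -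
  have m: "(\<lambda>t. ennreal (run y u t) * indicator {0..T} t) \<in> borel_measurable lebesgue"
    by (rule run_measurable[OF y u]) auto
  have "cost x u {0..T} \<le> (\<integral>\<^sup>+t. ennreal (run y u t) * indicator {0..T} t + ennreal a * indicator {0..T} t \<partial>lebesgue)"
    unfolding cost_def
  proof (rule nn_integral_mono)
    fix t
    show "ennreal (run x u t) * indicator {0..T} t \<le> ennreal (run y u t) * indicator {0..T} t + ennreal a * indicator {0..T} t"
    proof (cases "t \<in> {0..T}")
      case True
      then have "ennreal (run x u t) \<le> ennreal (run y u t + a)" by (intro ennreal_leI le) simp_all
      also have "\<dots> = ennreal (run y u t) + ennreal a" using run_nonneg[OF y u, of t] True assms(5) by (simp add: ennreal_plus)
      finally show ?thesis using True by simp
    qed simp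
  qed
  also have "\<dots> = cost y u {0..T} + (\<integral>\<^sup>+t. ennreal a * indicator {0..T} t \<partial>lebesgue)"
    unfolding cost_def
    by (intro nn_integral_add[OF m] borel_measurable_times_ennreal borel_measurable_const borel_measurable_indicator) simp
  also have "(\<integral>\<^sup>+t. ennreal a * indicator {0..T} t \<partial>lebesgue) = ennreal (a * T)"
    using assms(4,5) by (subst nn_integral_cmult_indicator) (simp_all add: ennreal_mult)
  finally show ?thesis .
qed

text \<open>Before \<open>S\<close> the state is at distance at least \<delta> from the origin,
  where the running cost has a positive lower bound; the cost thus bounds \<open>S\<close>, while it
  gives no bound on \<open>T\<close>.\<close>

lemma first_hitting_time:
  assumes x: "x \<in> G" and u: "u \<in> controls U" and T: "0 \<le> T" "norm (sol x u T) \<le> \<delta>"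
  obtains S where "0 \<le> S" "S \<le> T" "norm (sol x u S) \<le> \<delta>" "\<And>t. 0 \<le> t \<Longrightarrow> t < S \<Longrightarrow> \<delta> \<le> norm (sol x u t)"
proof -
  define H where "H = {0..T} \<inter> sol x u -` cball 0 \<delta>"
  have c: "continuous_on {0..T} (sol x u)" by (rule continuous_on_subset[OF state_continuous[OF x u]]) auto
  have "closed H" unfolding H_def by (rule continuous_closed_preimage[OF c]) auto
  moreover have "bounded H" unfolding H_def by (rule bounded_subset[OF bounded_closed_interval[of 0 T]]) auto
  ultimately have "compact H" by (simp add: compact_eq_bounded_closed)
  moreover have "H \<noteq> {}" using T by (auto simp: H_def)
  ultimately obtain S where S: "S \<in> H" "\<forall>t\<in>H. S \<le> t" using compact_attains_inf by blast
  show thesis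
  proof (rule that[of S])
    fix t assume t: "0 \<le> t" "t < S"
    then have "t \<notin> H" using S(2) by force
    moreover have "t \<in> {0..T}" using t S(1) by (simp add: H_def)
    ultimately show "\<delta> \<le> norm (sol x u t)" by (simp add: H_def)
  qed (use S(1) in \<open>simp_all add: H_def\<close>)
qed

text \<open>Aiming at half the radius leaves room: the control that brings \<open>x0\<close> to
  distance \<open>\<delta> / 2\<close> brings all nearby points into the ball of radius \<delta>, at
  bounded cost. Every nearby value is therefore finite, which also makes \<open>D0\<close>
  open.\<close>

lemma value_locally_bounded:
  assumes \<delta>: "0 < \<delta>" "\<delta> \<le> r" and x0: "x0 \<in> D0"
  obtains e B where "e > 0" "B > 0" "cball x0 e \<subseteq> G" "\<And>x. x \<in> cball x0 e \<Longrightarrow> V \<delta> x \<le> ennreal B"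
proof -
  have G: "x0 \<in> G" using x0 D0_subset by blast
  have "0 < \<delta> / 2" "\<delta> / 2 \<le> r" using \<delta> by simp_all
  then have "reach (\<delta> / 2) x0" using D0_iff_reach G x0 by blast
  then obtain u T where u: "u \<in> controls U" "T \<ge> 0" "norm (sol x0 u T) \<le> \<delta> / 2" unfolding reach_def by blast
  obtain e1 where e1: "e1 > 0" "cball x0 e1 \<subseteq> G" using open_G G open_contains_cball by blast
  obtain C where C: "C > 0" "\<And>x0' y0 u s. \<lbrakk>x0' \<in> cball x0 e1; y0 \<in> cball x0 e1; u \<in> controls U; 0 \<le> s; s \<le> T\<rbrakk> \<Longrightarrow>
    norm (sol x0' u s - sol y0 u s) \<le> C * norm (x0' - y0)"
    by (rule state_dependence[OF compact_cball e1(2), of T]) blast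
  obtain M where M: "M > 0" "\<And>x u t. \<lbrakk>x \<in> cball x0 e1; u \<in> controls U; 0 \<le> t; t \<le> T\<rbrakk> \<Longrightarrow> run x u t \<le> M"
    by (rule run_bounded[OF compact_cball e1(2), of T]) blast
  define e where "e = min e1 (\<delta> / (2 * C))"
  have e: "e > 0" "e \<le> e1" "e \<le> \<delta> / (2 * C)" using e1(1) \<delta>(1) C(1) by (simp_all add: e_def)
  show thesis
  proof (rule that[OF e(1)])
    show "M * T + 1 > 0" using M(1) u(2) by (intro add_nonneg_pos) simp_all
    show "cball x0 e \<subseteq> G" using e1(2) e(2) by auto
    fix x assume x: "x \<in> cball x0 e"
    then have xb: "x \<in> cball x0 e1" using e(2) by simp
    have "norm (sol x u T - sol x0 u T) \<le> C * norm (x - x0)"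
      by (rule C(2)[OF xb _ u(1,2) order_refl]) (use e1(1) in simp)
    also have "\<dots> \<le> C * (\<delta> / (2 * C))"
      using x e(3) C(1) by (intro mult_left_mono) (simp_all add: dist_norm norm_minus_commute)
    also have "\<dots> = \<delta> / 2" using C(1) by simp
    finally have "norm (sol x u T) \<le> \<delta>"
      using u(3) norm_triangle_ineq[of "sol x u T - sol x0 u T" "sol x0 u T"] by simp
    then have "V \<delta> x \<le> cost x u {0..T}" by (rule value_le_cost[OF \<delta>(1) u(1,2)])
    also have "\<dots> \<le> ennreal (M * T)"
      by (rule cost_le) (use u(2) M(1) M(2)[OF xb u(1)] in auto)
    also have "\<dots> \<le> ennreal (M * T + 1)" by (rule ennreal_leI) simp
    finally show "V \<delta> x \<le> ennreal (M * T + 1)" .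
  qed
qed

lemma open_D0: "open D0"
  unfolding open_contains_cball
proof
  fix x0 assume "x0 \<in> D0"
  then obtain e B where e: "e > 0" "cball x0 e \<subseteq> G" "\<And>x. x \<in> cball x0 e \<Longrightarrow> V r x \<le> ennreal B"
    using value_locally_bounded[OF r_pos order_refl] by metis
  have "x \<in> D0" if "x \<in> cball x0 e" for x
  proof -
    have "V r x < \<infinity>" using e(3)[OF that] by (simp add: order_le_less_trans)
    then show ?thesis using D0_eq_finite[of r] r_pos subsetD[OF e(2) that] by simp
  qed
  then show "\<exists>e>0. cball x0 e \<subseteq> D0" using e(1) by blast
qed

text \<open>A nearly optimal control for \<open>y\<close> is applied from \<open>x\<close> until the
  first visit of the trajectory from \<open>y\<close>. The two running costs then differ by
  \<open>Cg * C * norm (x - y)\<close> per unit of time, and the point reached from \<open>x\<close>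
  lies at most \<open>C * norm (x - y)\<close> outside the ball, where finishing costs at most
  \<open>c\<close> times that distance. These are the two terms of \<open>L\<close>.\<close>

lemma value_locally_lipschitz:
  assumes \<delta>: "0 < \<delta>" "\<delta> \<le> r" and P: "petrov_condition U f \<delta>"
  shows "locally_lipschitz_on D0 (\<lambda>x0. enn2real (V \<delta> x0))"
  unfolding locally_lipschitz_on_def
proof
  fix x0 assume x0: "x0 \<in> D0"
  obtain e1 B where e1: "e1 > 0" "B > 0" "cball x0 e1 \<subseteq> G" "\<And>x. x \<in> cball x0 e1 \<Longrightarrow> V \<delta> x \<le> ennreal B"
    by (rule value_locally_bounded[OF \<delta> x0]) blast
  obtain \<epsilon> c where \<epsilon>: "\<epsilon> > 0" and c: "c \<ge> 0" "\<And>x. x \<in> G \<Longrightarrow> norm x \<le> \<delta> + \<epsilon> \<Longrightarrow> V \<delta> x \<le> ennreal (c * max 0 (norm x - \<delta>))"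
    by (rule petrov_near_sphere[OF \<delta> P]) blast
  obtain q where q: "q > 0" "\<And>x u. x \<in> closure G \<Longrightarrow> u \<in> U \<Longrightarrow> \<delta> \<le> norm x \<Longrightarrow> q \<le> g x u"
    using g_positive[OF \<delta>(1)] by blast
  \<comment> \<open>A control that is optimal up to an error of at most 1 costs at most
    \<open>B + 1\<close>, and each unit of time before the first visit costs at least
    \<open>q\<close>. State bounds and Lipschitz constants can thus be fixed in advance on this
    horizon.\<close>
  define Tm where "Tm = (B + 1) / q"
  have Tm: "Tm > 0" using e1(2) q(1) by (simp add: Tm_def)
  obtain R where R: "R > 0" "\<And>x u t. \<lbrakk>x \<in> cball x0 e1; u \<in> controls U; 0 \<le> t; t \<le> Tm\<rbrakk> \<Longrightarrow> norm (sol x u t) \<le> R"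
    by (rule state_bounded[OF compact_cball e1(3), of Tm]) blast
  obtain C where C: "C > 0" "\<And>x y u s. \<lbrakk>x \<in> cball x0 e1; y \<in> cball x0 e1; u \<in> controls U; 0 \<le> s; s \<le> Tm\<rbrakk> \<Longrightarrow>
    norm (sol x u s - sol y u s) \<le> C * norm (x - y)"
    by (rule state_dependence[OF compact_cball e1(3), of Tm]) blast
  obtain Cg where Cg: "Cg > 0" "\<forall>x \<in> cball 0 R \<inter> closure G. \<forall>x' \<in> cball 0 R \<inter> closure G. \<forall>u\<in>U.
        \<bar>g x u - g x' u\<bar> \<le> Cg * norm (x - x')"
    using g_lipschitz[OF R(1)] by blast
  \<comment> \<open>Two points of the ball are at distance at most \<open>2 * e\<close>, so the
    endpoint reached from \<open>x\<close> stays in the collar of width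
    \<open>\<epsilon>\<close>.\<close>
  define e where "e = min e1 (\<epsilon> / (2 * C))"
  have e: "e > 0" "e \<le> e1" "e \<le> \<epsilon> / (2 * C)" using e1(1) \<epsilon> C(1) by (simp_all add: e_def)
  define L where "L = Cg * C * Tm + c * C"
  have L0: "L \<ge> 0" using Cg(1) C(1) Tm c(1) by (simp add: L_def)
  have main: "V \<delta> x \<le> V \<delta> y + ennreal (L * norm (x - y))" if x: "x \<in> ball x0 e" and y: "y \<in> ball x0 e" for x y
  proof -
    have xb: "x \<in> cball x0 e1" "y \<in> cball x0 e1" using x y e(2) by simp_all
    then have G: "x \<in> G" "y \<in> G" using e1(3) by blast+
    have xy: "C * norm (x - y) \<le> \<epsilon>"
    proof -
      have "norm (x - y) \<le> 2 * e" using x y norm_triangle_ineq4[of "x - x0" "y - x0"]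
        by (simp add: dist_norm norm_minus_commute)
      then have "C * norm (x - y) \<le> C * (2 * (\<epsilon> / (2 * C)))" using e(3) C(1) by (intro mult_left_mono) simp_all
      then show ?thesis using C(1) by simp
    qed
    have fin: "V \<delta> y \<le> ennreal B" by (rule e1(4)[OF xb(2)])
    show ?thesis
    proof (rule ennreal_le_epsilon)
      fix \<gamma>' :: real assume "\<gamma>' > 0"
      \<comment> \<open>Capped at 1 so that the horizon \<open>Tm\<close> applies whatever the
        tolerance is.\<close>
      define \<gamma> where "\<gamma> = min \<gamma>' 1"
      have \<gamma>: "\<gamma> > 0" "\<gamma> \<le> 1" "\<gamma> \<le> \<gamma>'" using \<open>\<gamma>' > 0\<close> by (simp_all add: \<gamma>_def)
      have "V \<delta> y < V \<delta> y + ennreal \<gamma>"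
      proof -
        have "V \<delta> y \<noteq> top" using fin by (auto simp: top_unique)
        then have "V \<delta> y = ennreal (enn2real (V \<delta> y))" by (simp add: less_top)
        also have "\<dots> < ennreal (enn2real (V \<delta> y) + \<gamma>)" using \<gamma>(1) by (intro ennreal_lessI add_nonneg_pos) simp_all
        also have "\<dots> = V \<delta> y + ennreal \<gamma>"
          using \<gamma>(1) \<open>V \<delta> y \<noteq> top\<close> by (simp add: ennreal_plus less_top)
        finally show ?thesis .
      qed
      then obtain u T where u: "u \<in> controls U" "T \<ge> 0" "norm (sol y u T) \<le> \<delta>" "cost y u {0..T} < V \<delta> y + ennreal \<gamma>"
        by (rule value_approx[OF \<delta>(1)])
      obtain S where S: "0 \<le> S" "S \<le> T" "norm (sol y u S) \<le> \<delta>" "\<And>t. 0 \<le> t \<Longrightarrow> t < S \<Longrightarrow> \<delta> \<le> norm (sol y u t)"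
        by (rule first_hitting_time[OF G(2) u(1-3)]) blast
      have costS: "cost y u {0..S} \<le> V \<delta> y + ennreal \<gamma>"
        using cost_mono[of "{0..S}" "{0..T}" y u] S(2) u(4) by (simp add: order_trans[OF _ less_imp_le])
      have "ennreal (q * S) \<le> cost y u {0..S}"
      proof (rule cost_ge[OF S(1)])
        show "q \<le> run y u t" if "0 \<le> t" "t < S" for t
          by (rule q(2)[OF state_in_closure[OF G(2) u(1) that(1)] control_in_U[OF u(1) that(1)] S(4)[OF that]])
      qed (use q(1) in simp)
      also have "\<dots> \<le> V \<delta> y + ennreal \<gamma>" by (rule costS)
      also have "\<dots> \<le> ennreal B + ennreal 1" using fin \<gamma>(2) by (intro add_mono ennreal_leI)
      also have "\<dots> = ennreal (B + 1)" using e1(2) by (simp add: ennreal_plus)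
      finally have "ennreal (q * S) \<le> ennreal (B + 1)" .
      then have "q * S \<le> B + 1" by (rule iffD1[OF ennreal_le_iff, rotated]) (use e1(2) in simp)
      then have STm: "S \<le> Tm" using q(1) by (simp add: Tm_def pos_le_divide_eq mult.commute)
      let ?X = "sol x u" and ?Y = "sol y u"
      have dep: "norm (?X t - ?Y t) \<le> C * norm (x - y)" if "0 \<le> t" "t \<le> S" for t
        by (rule C(2)[OF xb u(1) that(1)]) (use that STm in simp)
      have "cost x u {0..S} \<le> cost y u {0..S} + ennreal (Cg * (C * norm (x - y)) * S)"
      proof (rule cost_perturb[OF G u(1) S(1)])
        show "0 \<le> Cg * (C * norm (x - y))" using Cg(1) C(1) by simp
        fix t assume t: "0 \<le> t" "t \<le> S"
        then have tT: "t \<le> Tm" using STm by simp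
        have "?X t \<in> cball 0 R \<inter> closure G" "?Y t \<in> cball 0 R \<inter> closure G"
          using R(2)[OF xb(1) u(1) t(1) tT] R(2)[OF xb(2) u(1) t(1) tT]
            state_in_closure[OF G(1) u(1) t(1)] state_in_closure[OF G(2) u(1) t(1)] by simp_all
        then have "\<bar>run x u t - run y u t\<bar> \<le> Cg * norm (?X t - ?Y t)"
          using Cg(2) control_in_U[OF u(1) t(1)] by blast
        also have "\<dots> \<le> Cg * (C * norm (x - y))" using dep[OF t] Cg(1) by (intro mult_left_mono) simp_all
        finally show "run x u t \<le> run y u t + Cg * (C * norm (x - y))" by simp
      qed
      also have "\<dots> \<le> (V \<delta> y + ennreal \<gamma>) + ennreal (Cg * (C * norm (x - y)) * Tm)"
        using STm Cg(1) C(1) by (intro add_mono costS ennreal_leI mult_left_mono) simp_all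
      finally have 1: "cost x u {0..S} \<le> (V \<delta> y + ennreal \<gamma>) + ennreal (Cg * (C * norm (x - y)) * Tm)" .
      have XS: "norm (?X S) \<le> \<delta> + C * norm (x - y)"
        using dep[OF S(1) order_refl] S(3) norm_triangle_ineq[of "?X S - ?Y S" "?Y S"] by simp
      have "V \<delta> (?X S) \<le> ennreal (c * max 0 (norm (?X S) - \<delta>))"
        by (rule c(2)[OF state_in_G[OF G(1) u(1) S(1)]]) (use XS xy in simp)
      also have "\<dots> \<le> ennreal (c * (C * norm (x - y)))"
        using XS c(1) C(1) by (intro ennreal_leI mult_left_mono) simp_all
      finally have 2: "V \<delta> (?X S) \<le> ennreal (c * (C * norm (x - y)))" .
      have "V \<delta> x \<le> cost x u {0..S} + V \<delta> (?X S)" using \<delta>(1) by (intro value_le_switch[OF _ G(1) u(1) S(1)]) simp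
      also have "\<dots> \<le> ((V \<delta> y + ennreal \<gamma>) + ennreal (Cg * (C * norm (x - y)) * Tm)) + ennreal (c * (C * norm (x - y)))"
        by (rule add_mono[OF 1 2])
      also have "\<dots> = V \<delta> y + (ennreal (Cg * (C * norm (x - y)) * Tm) + ennreal (c * (C * norm (x - y)))) + ennreal \<gamma>"
        by (simp add: ac_simps)
      also have "ennreal (Cg * (C * norm (x - y)) * Tm) + ennreal (c * (C * norm (x - y))) = ennreal (L * norm (x - y))"
        using Cg(1) C(1) Tm c(1) by (subst ennreal_plus[symmetric]) (simp_all add: L_def algebra_simps)
      also have "V \<delta> y + ennreal (L * norm (x - y)) + ennreal \<gamma> \<le> V \<delta> y + ennreal (L * norm (x - y)) + ennreal \<gamma>'"
        using \<gamma>(3) by (intro add_left_mono ennreal_leI)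
      finally show "V \<delta> x \<le> V \<delta> y + ennreal (L * norm (x - y)) + ennreal \<gamma>'" .
    qed
  qed
  have "L-lipschitz_on (ball x0 e \<inter> D0) (\<lambda>x0. enn2real (V \<delta> x0))"
  proof (rule lipschitz_onI[OF _ L0])
    fix x y assume x: "x \<in> ball x0 e \<inter> D0" and y: "y \<in> ball x0 e \<inter> D0"
    have fin: "V \<delta> z < \<infinity>" if "z \<in> D0" for z using D0_eq_finite[of \<delta>] \<delta> that by simp
    have "\<bar>enn2real (V \<delta> x) - enn2real (V \<delta> y)\<bar> \<le> L * norm (x - y)"
    proof (rule abs_enn2real_diff_le)
      show "V \<delta> x \<le> V \<delta> y + ennreal (L * norm (x - y))" using x y by (intro main) simp_all
      show "V \<delta> y \<le> V \<delta> x + ennreal (L * norm (x - y))" using main[of y x] x y by (simp add: norm_minus_commute)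
    qed (use x y L0 fin in simp_all)
    then show "dist (enn2real (V \<delta> x)) (enn2real (V \<delta> y)) \<le> L * dist x y" by (simp add: dist_norm)
  qed
  then show "\<exists>\<epsilon>>0. \<exists>L. L-lipschitz_on (ball x0 \<epsilon> \<inter> D0) (\<lambda>x0. enn2real (V \<delta> x0))" using e(1) by blast
qed

end

section \<open>The value near the origin\<close>

text \<open>The inverse is characterized only on the range of \<alpha>. The intermediate value
  theorem supplies a preimage of \<open>y\<close> in \<open>{0..s}\<close>, and injectivity makes it
  the value of the inverse.\<close>

lemma class_K_inf_inverse_le:
  assumes \<alpha>: "\<alpha> \<in> class_K_inf" and y: "0 \<le> y" "y \<le> \<alpha> s" "0 \<le> s"
  shows "0 \<le> the_inv_into {0..} \<alpha> y" "the_inv_into {0..} \<alpha> y \<le> s"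
proof -
  have K: "strict_mono_on {0..} \<alpha>" "continuous_on {0..} \<alpha>" "\<alpha> 0 = 0"
    using \<alpha> by (simp_all add: class_K_inf_def class_K_def)
  have inj: "inj_on \<alpha> {0..}" using K(1) by (rule strict_mono_on_imp_inj_on)
  have "continuous_on {0..s} \<alpha>" by (rule continuous_on_subset[OF K(2)]) auto
  then obtain s' where s': "0 \<le> s'" "s' \<le> s" "\<alpha> s' = y"
    using IVT'[of \<alpha> 0 y s] K(3) y by auto
  have "the_inv_into {0..} \<alpha> y = s'" using the_inv_into_f_f[OF inj, of s'] s' by simp
  then show "0 \<le> the_inv_into {0..} \<alpha> y" "the_inv_into {0..} \<alpha> y \<le> s" using s' by simp_all
qed

lemma class_K_small:
  assumes "\<alpha> \<in> class_K" "e > 0"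
  obtains d where "d > 0" "\<And>s. 0 \<le> s \<Longrightarrow> s \<le> d \<Longrightarrow> \<alpha> s \<le> e"
proof -
  have "continuous_on {0..} \<alpha>" "\<alpha> 0 = 0" using assms(1) by (simp_all add: class_K_def)
  then obtain d where d: "d > 0" "\<And>s. s \<in> {0..} \<Longrightarrow> dist s 0 < d \<Longrightarrow> dist (\<alpha> s) (\<alpha> 0) < e"
    unfolding continuous_on_iff using assms(2) by (metis atLeast_iff order_refl)
  show thesis
  proof (rule that[of "d / 2"])
    fix s assume "0 \<le> s" "s \<le> d / 2"
    then have "dist (\<alpha> s) (\<alpha> 0) < e" using d(1) by (intro d(2)) simp_all
    then show "\<alpha> s \<le> e" using \<open>\<alpha> 0 = 0\<close> by (simp add: dist_real_def)
  qed (use d(1) in simp)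
qed

lemma class_KL_D:
  assumes "\<beta> \<in> class_KL"
  shows "t \<ge> 0 \<Longrightarrow> (\<lambda>s. \<beta> s t) \<in> class_K" "\<rho> \<ge> 0 \<Longrightarrow> \<beta> \<rho> \<in> class_L"
  using assms by (simp_all add: class_KL_def)

lemma class_KL_le:
  assumes "\<beta> \<in> class_KL" "0 \<le> \<rho>" "\<rho> \<le> \<rho>'" "0 \<le> t"
  shows "\<beta> \<rho> t \<le> \<beta> \<rho>' 0"
proof -
  have "antimono_on {0..} (\<beta> \<rho>)" using class_KL_D(2)[OF assms(1,2)] by (simp add: class_L_def)
  then have "\<beta> \<rho> t \<le> \<beta> \<rho> 0" using monotone_onD[of "{0..}" "(\<le>)" "(\<ge>)" "\<beta> \<rho>" 0 t] assms(4) by simp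
  also have "\<dots> \<le> \<beta> \<rho>' 0"
  proof -
    have "strict_mono_on {0..} (\<lambda>s. \<beta> s 0)" using class_KL_D(1)[OF assms(1), of 0] by (simp add: class_K_def)
    then have "mono_on {0..} (\<lambda>s. \<beta> s 0)" by (rule strict_mono_on_imp_mono_on)
    then show ?thesis by (rule mono_onD) (use assms in auto)
  qed
  finally show ?thesis .
qed

context cost_system begin

text \<open>An almost everywhere bound is what the weak alternative can give, since its controls are
  bounded only almost everywhere.\<close>

lemma cost_exponential_le:
  assumes k: "k > 0" and K: "K \<ge> 0"
    and le: "AE t in lebesgue_on {0..}. run x u t \<le> K * exp (- (k * t))"
  shows "cost x u {0..} \<le> ennreal (K / k)"
proof -
  have "((\<lambda>t. K * exp (- k * t)) has_integral K * (exp (- k * 0) / k)) {0..}"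
    by (intro has_integral_mult_right has_integral_exp_minus_to_infinity k)
  then have "((\<lambda>t. K * exp (- (k * t))) has_integral K / k) {0..}" by simp
  then have i: "(\<integral>\<^sup>+t. ennreal (K * exp (- (k * t))) * indicator {0..} t \<partial>lborel) = ennreal (K / k)"
    by (rule nn_integral_has_integral_lebesgue'[rotated]) (use K in simp)
  have "AE t in lebesgue. t \<in> {0..} \<longrightarrow> run x u t \<le> K * exp (- (k * t))"
    using le by (subst (asm) AE_restrict_space_iff) simp_all
  then have "AE t in lebesgue. ennreal (run x u t) * indicator {0..} t \<le> ennreal (K * exp (- (k * t))) * indicator {0..} t"
    by eventually_elim (auto simp: indicator_def intro: ennreal_leI)
  then have "cost x u {0..} \<le> (\<integral>\<^sup>+t. ennreal (K * exp (- (k * t))) * indicator {0..} t \<partial>lebesgue)"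
    unfolding cost_def by (rule nn_integral_mono_AE)
  also have "\<dots> = ennreal (K / k)" using i by (simp add: nn_integral_completion)
  finally show ?thesis .
qed

text \<open>The variable \<open>y\<close> stands for whichever quantity the growth condition
  measures, the norm of the state alone or the sum of the norms of state and control. In both cases
  the inverse of \<open>\<alpha>2\<close> turns the bound by \<beta> into exponential decay.\<close>

lemma value_0_small_at_origin:
  assumes \<alpha>1: "\<alpha>1 \<in> class_K_inf" and \<alpha>2: "\<alpha>2 \<in> class_K_inf"
    and \<beta>: "\<And>\<rho> t. \<rho> \<ge> 0 \<Longrightarrow> t \<ge> 0 \<Longrightarrow> \<beta> \<rho> t \<le> \<alpha>2 (\<alpha>1 \<rho> * exp (- t))"
    and C: "C11 > 0" "C12 > 0" and \<rho>1: "\<rho>1 > 0"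
    and ctrl: "\<And>x. norm x \<le> \<rho>1 \<Longrightarrow> \<exists>u\<in>controls U. AE t in lebesgue_on {0..}.
      \<exists>y. 0 \<le> y \<and> y \<le> \<beta> (norm x) t \<and> run x u t \<le> C11 * (the_inv_into {0..} \<alpha>2 y) powr C12"
    and e: "e > 0"
  shows "\<exists>\<rho>>0. \<forall>x. norm x \<le> \<rho> \<longrightarrow> V 0 x \<le> ennreal e"
proof -
  have \<alpha>1K: "\<alpha>1 \<in> class_K" using \<alpha>1 by (simp add: class_K_inf_def)
  then have \<alpha>1_nn: "\<alpha>1 s \<ge> 0" if "s \<ge> 0" for s using that by (auto simp: class_K_def)
  \<comment> \<open>Chosen so that \<open>C11 * a powr C12 / C12 = e\<close>; the left side is the
    integral of \<open>C11 * (a * exp (- t)) powr C12\<close> over the half-line.\<close>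
  define a where "a = (e * C12 / C11) powr (1 / C12)"
  have a: "a > 0" "a powr C12 = e * C12 / C11" using e C by (simp_all add: a_def powr_powr)
  obtain d where d: "d > 0" "\<And>s. 0 \<le> s \<Longrightarrow> s \<le> d \<Longrightarrow> \<alpha>1 s \<le> a" by (rule class_K_small[OF \<alpha>1K a(1)]) blast
  have "V 0 x \<le> ennreal e" if x: "norm x \<le> min \<rho>1 d" for x
  proof -
    obtain u where u: "u \<in> controls U" and ae: "AE t in lebesgue_on {0..}.
      \<exists>y. 0 \<le> y \<and> y \<le> \<beta> (norm x) t \<and> run x u t \<le> C11 * (the_inv_into {0..} \<alpha>2 y) powr C12"
      using ctrl[of x] x by auto
    define A where "A = \<alpha>1 (norm x)"
    have A: "0 \<le> A" "A \<le> a" using \<alpha>1_nn d(2) x by (simp_all add: A_def)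
    have "AE t in lebesgue_on {0..}. run x u t \<le> C11 * A powr C12 * exp (- (C12 * t))"
      using ae AE_space[of "lebesgue_on {0..}"]
    proof eventually_elim
      fix t assume "t \<in> space (lebesgue_on {0..})"
        and "\<exists>y. 0 \<le> y \<and> y \<le> \<beta> (norm x) t \<and> run x u t \<le> C11 * (the_inv_into {0..} \<alpha>2 y) powr C12"
      then obtain y where t: "0 \<le> t" and y: "0 \<le> y" "y \<le> \<beta> (norm x) t" "run x u t \<le> C11 * (the_inv_into {0..} \<alpha>2 y) powr C12"
        by auto
      have "y \<le> \<alpha>2 (A * exp (- t))" using y(2) \<beta>[of "norm x" t] t by (simp add: A_def)
      note inv = class_K_inf_inverse_le[OF \<alpha>2 y(1) this]
      have "(the_inv_into {0..} \<alpha>2 y) powr C12 \<le> (A * exp (- t)) powr C12"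
        using inv A(1) C(2) by (intro powr_mono2) simp_all
      also have "\<dots> = A powr C12 * exp (- (C12 * t))"
        using A(1) by (simp add: powr_mult exp_powr_real mult.commute)
      finally have "C11 * (the_inv_into {0..} \<alpha>2 y) powr C12 \<le> C11 * (A powr C12 * exp (- (C12 * t)))"
        using C(1) by (intro mult_left_mono) simp_all
      then show "run x u t \<le> C11 * A powr C12 * exp (- (C12 * t))" using y(3) by (simp add: mult.assoc)
    qed
    then have "cost x u {0..} \<le> ennreal (C11 * A powr C12 / C12)"
      using C by (intro cost_exponential_le) simp_all
    moreover have "V 0 x \<le> cost x u {0..}" unfolding value_0 by (rule INF_lower[OF u])
    moreover have "C11 * A powr C12 / C12 \<le> e"
    proof -
      have "A powr C12 \<le> e * C12 / C11" unfolding a(2)[symmetric] using A C(2) by (intro powr_mono2) simp_all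
      then show ?thesis using C by (simp add: field_simps)
    qed
    ultimately show ?thesis by (meson ennreal_leI order_trans)
  qed
  then show ?thesis using \<rho>1 d(1) by (intro exI[of _ "min \<rho>1 d"]) simp
qed

end

section \<open>From the hypotheses to the theorem\<close>

lemma value_system_if_hypotheses:
  fixes U :: "(real ^ 'm) set" and G G1 :: "(real ^ 'n) set"
  assumes sys: "system_hypotheses U G G1 f"
    and lnc: "local_null_controllability_hypotheses small U G G1 f r ubar \<beta>"
    and \<alpha>: "\<alpha>1 \<in> class_K_inf" "\<alpha>2 \<in> class_K_inf"
    and \<beta>\<alpha>: "\<And>\<rho> t. \<rho> \<ge> 0 \<Longrightarrow> t \<ge> 0 \<Longrightarrow> \<beta> \<rho> t \<le> \<alpha>2 (\<alpha>1 \<rho> * exp (- t))"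
    and rc: "running_cost_hypotheses small U G f r ubar \<alpha>2 g"
  shows "value_system U G G1 f g r \<beta>"
proof -
  have U0: "0 \<in> U" using lnc by (simp add: local_null_controllability_hypotheses_def)
  interpret control_system U G G1 f
    by unfold_locales (use sys U0 in auto)
  note rcs = rc[unfolded running_cost_hypotheses_def]
  note growth = rcs[THEN conjunct2, THEN conjunct2, THEN conjunct2, THEN conjunct2, THEN conjunct1]
  interpret cost_system U G G1 f g
  proof unfold_locales
    show "0 \<le> g x u" if "x \<in> closure G" "u \<in> U" for x u using rcs[THEN conjunct1] that by blast
    show "continuous_on (closure G \<times> U) (\<lambda>(x, u). g x u)" by (rule rcs[THEN conjunct2, THEN conjunct1])
    show "\<exists>C>0. \<forall>x \<in> cball 0 R \<inter> closure G. \<forall>x' \<in> cball 0 R \<inter> closure G. \<forall>u\<in>U.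
        \<bar>g x u - g x' u\<bar> \<le> C * norm (x - x')" if "R > 0" for R
      by (rule rcs[THEN conjunct2, THEN conjunct2, THEN conjunct1, rule_format, OF that])
    fix R :: real assume "R > 0"
    define I where "I = (INF (x, u) \<in> {(x, u). x \<in> closure G \<and> u \<in> U \<and> norm x \<ge> R}. ereal (g x u))"
    have "I > 0"
      unfolding I_def by (rule rcs[THEN conjunct2, THEN conjunct2, THEN conjunct2, THEN conjunct1, rule_format, OF \<open>R > 0\<close>])
    \<comment> \<open>The infimum may be infinite, namely over the empty set when \<open>G\<close>
      is bounded, so a real number strictly below it is taken.\<close>
    then obtain c where c: "0 < ereal c" "ereal c < I" using ereal_dense2 by blast
    have "c \<le> g x u" if "x \<in> closure G" "u \<in> U" "R \<le> norm x" for x u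
    proof -
      have "I \<le> ereal (g x u)"
        unfolding I_def by (rule INF_lower2[of "(x, u)"]) (use that in auto)
      then have "ereal c < ereal (g x u)" using c(2) by (rule order_less_le_trans[rotated])
      then show ?thesis by simp
    qed
    then show "\<exists>c>0. \<forall>x\<in>closure G. \<forall>u\<in>U. R \<le> norm x \<longrightarrow> c \<le> g x u" using c(1) by auto
  qed
  have r: "r > 0" "cball 0 r \<subseteq> G" and KL: "\<beta> \<in> class_KL"
    using lnc by (auto simp: local_null_controllability_hypotheses_def small_control_property_def
      weak_null_controllability_def split: if_splits)
  obtain C11 C12 where C: "C11 > 0" "C12 > 0" "\<And>x u. x \<in> cball 0 r \<Longrightarrow> u \<in> cball 0 ubar \<inter> U \<Longrightarrow>
    g x u \<le> C11 * (the_inv_into {0..} \<alpha>2 (if small then norm x + norm u else norm x)) powr C12"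
    using growth by blast
  obtain \<rho> where \<rho>: "\<rho> > 0" "\<And>s. 0 \<le> s \<Longrightarrow> s \<le> \<rho> \<Longrightarrow> \<beta> s 0 \<le> r"
    by (rule class_K_small[OF class_KL_D(1)[OF KL order_refl] r(1)]) blast
  \<comment> \<open>Strictly below \<open>r\<close>, so that the controllability hypothesis applies,
    and small enough that the trajectories never leave the closed ball of radius \<open>r\<close>,
    where the growth condition holds.\<close>
  define \<rho>1 where "\<rho>1 = min \<rho> (r / 2)"
  have \<rho>1: "\<rho>1 > 0" "\<rho>1 < r" "\<And>x. norm x \<le> \<rho>1 \<Longrightarrow> \<beta> (norm x) 0 \<le> r"
    using \<rho> r(1) by (simp_all add: \<rho>1_def)
  have bnd: "\<beta> (norm x) t \<le> r" if "norm x \<le> \<rho>1" "t \<ge> 0" for x :: "real ^ 'n" and t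
    using class_KL_le[OF KL norm_ge_zero order_refl that(2)] \<rho>1(3)[OF that(1)] by (rule order_trans)
  have small_ctrl: "\<exists>u\<in>controls U. \<forall>t\<ge>0. norm (sol x0 u t) + norm (u t) \<le> \<beta> (norm x0) t"
    if "small" "norm x0 < r" for x0
    using lnc that by (simp add: local_null_controllability_hypotheses_def small_control_property_def)
  have weak_ctrl: "\<exists>u\<in>controls U. (AE t in lebesgue_on {0..}. norm (u t) \<le> ubar) \<and>
      (\<forall>t\<ge>0. norm (sol x0 u t) \<le> \<beta> (norm x0) t)" if "\<not> small" "norm x0 < r" for x0
    using lnc that by (simp add: local_null_controllability_hypotheses_def weak_null_controllability_def)
  have stab: "\<exists>u\<in>controls U. \<forall>t\<ge>0. norm (sol x0 u t) \<le> \<beta> (norm x0) t" if "norm x0 < r" for x0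
  proof (cases small)
    case True
    show ?thesis using small_ctrl[OF True that] by (meson norm_ge_zero order_trans le_add_same_cancel1)
  next
    case False
    show ?thesis using weak_ctrl[OF False that] by blast
  qed
  have ctrl: "\<exists>u\<in>controls U. AE t in lebesgue_on {0..}.
      \<exists>y. 0 \<le> y \<and> y \<le> \<beta> (norm x) t \<and> run x u t \<le> C11 * (the_inv_into {0..} \<alpha>2 y) powr C12"
    if x: "norm x \<le> \<rho>1" for x
  proof (cases small)
    case True
    have ub: "ubar = \<beta> r 0" using lnc True by (simp add: local_null_controllability_hypotheses_def)
    obtain u where u: "u \<in> controls U" "\<forall>t\<ge>0. norm (sol x u t) + norm (u t) \<le> \<beta> (norm x) t"
      using small_ctrl[OF True order_le_less_trans[OF x \<rho>1(2)]] by blast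
    have "AE t in lebesgue_on {0..}.
      \<exists>y. 0 \<le> y \<and> y \<le> \<beta> (norm x) t \<and> run x u t \<le> C11 * (the_inv_into {0..} \<alpha>2 y) powr C12"
    proof (rule AE_I2)
      fix t :: real assume "t \<in> space (lebesgue_on {0..})"
      then have t: "t \<ge> 0" by simp
      have le: "norm (sol x u t) + norm (u t) \<le> \<beta> (norm x) t" using u(2) t by blast
      have "norm (sol x u t) \<le> r" using le bnd[OF x t] norm_ge_zero[of "u t"] by linarith
      \<comment> \<open>Monotonicity of \<beta> in both arguments bounds the control by
        \<open>\<beta> r 0\<close>, which is \<open>ubar\<close> in this alternative.\<close>
      moreover have "norm (u t) \<le> ubar"
        using le class_KL_le[OF KL norm_ge_zero[of x] _ t, of r] x \<rho>1(2) norm_ge_zero[of "sol x u t"]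
        unfolding ub by linarith
      ultimately have "run x u t \<le> C11 * (the_inv_into {0..} \<alpha>2 (norm (sol x u t) + norm (u t))) powr C12"
        using C(3)[of "sol x u t" "u t"] control_in_U[OF u(1) t] True by simp
      then show "\<exists>y. 0 \<le> y \<and> y \<le> \<beta> (norm x) t \<and> run x u t \<le> C11 * (the_inv_into {0..} \<alpha>2 y) powr C12"
        using le by (intro exI[of _ "norm (sol x u t) + norm (u t)"]) simp
    qed
    then show ?thesis using u(1) by blast
  next
    case False
    obtain u where u: "u \<in> controls U" "AE t in lebesgue_on {0..}. norm (u t) \<le> ubar"
      "\<forall>t\<ge>0. norm (sol x u t) \<le> \<beta> (norm x) t"
      using weak_ctrl[OF False order_le_less_trans[OF x \<rho>1(2)]] by blast
    have "AE t in lebesgue_on {0..}.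
      \<exists>y. 0 \<le> y \<and> y \<le> \<beta> (norm x) t \<and> run x u t \<le> C11 * (the_inv_into {0..} \<alpha>2 y) powr C12"
      using u(2) AE_space[of "lebesgue_on {0..}"]
    proof eventually_elim
      fix t assume un: "norm (u t) \<le> ubar" and "t \<in> space (lebesgue_on {0..})"
      then have t: "t \<ge> 0" by simp
      have le: "norm (sol x u t) \<le> \<beta> (norm x) t" using u(3) t by blast
      have "norm (sol x u t) \<le> r" using le bnd[OF x t] by linarith
      then have "run x u t \<le> C11 * (the_inv_into {0..} \<alpha>2 (norm (sol x u t))) powr C12"
        using C(3)[of "sol x u t" "u t"] control_in_U[OF u(1) t] un False by simp
      then show "\<exists>y. 0 \<le> y \<and> y \<le> \<beta> (norm x) t \<and> run x u t \<le> C11 * (the_inv_into {0..} \<alpha>2 y) powr C12"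
        using le by (intro exI[of _ "norm (sol x u t)"]) simp
    qed
    then show ?thesis using u(1) by blast
  qed
  show ?thesis
  proof unfold_locales
    show "\<exists>\<rho>>0. \<forall>x. norm x \<le> \<rho> \<longrightarrow> V 0 x \<le> ennreal e" if "e > 0" for e
      by (rule value_0_small_at_origin[OF \<alpha> \<beta>\<alpha> C(1,2) \<rho>1(1) ctrl that])
  qed (fact r KL stab)+
qed

theorem theorem3p9:
  fixes U :: "(real ^ 'm) set" and G G1 :: "(real ^ 'n) set"
    and f :: "real ^ 'n \<Rightarrow> real ^ 'm \<Rightarrow> real ^ 'n"
    and g :: "real ^ 'n \<Rightarrow> real ^ 'm \<Rightarrow> real"
    and small :: bool
    and r ubar :: real and \<beta> :: "real \<Rightarrow> real \<Rightarrow> real" and \<alpha>1 \<alpha>2 :: "real \<Rightarrow> real"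
  defines "D0 \<equiv> null_controllable_domain U G G1 f"
    and "V \<equiv> value_fun U G1 f g"
  assumes "system_hypotheses U G G1 f"
    and "local_null_controllability_hypotheses small U G G1 f r ubar \<beta>"
    and "\<alpha>1 \<in> class_K_inf" "\<alpha>2 \<in> class_K_inf"
    and "\<And>\<rho> t. \<rho> \<ge> 0 \<Longrightarrow> t \<ge> 0 \<Longrightarrow> \<beta> \<rho> t \<le> \<alpha>2 (\<alpha>1 \<rho> * exp (- t))"
    and "running_cost_hypotheses small U G f r ubar \<alpha>2 g"
  shows "(\<forall>\<delta>\<in>{0..r}. D0 = {x0 \<in> G. V \<delta> x0 < \<infinity>} \<and> D0 = {x0 \<in> G. kruzhkov (V \<delta> x0) < 1}) \<and>
         (uniform_limit G (\<lambda>\<delta> x0. kruzhkov (V \<delta> x0)) (\<lambda>x0. kruzhkov (V 0 x0)) (at_right 0)) \<and>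
         (\<forall>K. compact K \<and> K \<subseteq> D0 \<longrightarrow>
           uniform_limit K (\<lambda>\<delta> x0. enn2real (V \<delta> x0)) (\<lambda>x0. enn2real (V 0 x0)) (at_right 0)) \<and>
         (\<forall>\<delta>\<in>{0<..r}. petrov_condition U f \<delta> \<longrightarrow>
           locally_lipschitz_on D0 (\<lambda>x0. enn2real (V \<delta> x0)) \<and>
           (AE x0 in lebesgue. x0 \<in> D0 \<longrightarrow> (\<lambda>y. enn2real (V \<delta> y)) differentiable (at x0)))"
proof -
  interpret vs: value_system U G G1 f g r \<beta>
    by (rule value_system_if_hypotheses) fact+
  have "D0 = {x0 \<in> G. V \<delta> x0 < \<infinity>}" if "\<delta> \<in> {0..r}" for \<delta>
    unfolding D0_def V_def using that by (intro vs.D0_eq_finite) simp_all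
  then have 1: "\<forall>\<delta>\<in>{0..r}. D0 = {x0 \<in> G. V \<delta> x0 < \<infinity>} \<and> D0 = {x0 \<in> G. kruzhkov (V \<delta> x0) < 1}"
    by (simp add: vs.kruzhkov_less_1_iff)
  have 2: "uniform_limit G (\<lambda>\<delta> x0. kruzhkov (V \<delta> x0)) (\<lambda>x0. kruzhkov (V 0 x0)) (at_right 0)"
    unfolding V_def by (rule vs.kruzhkov_uniform_limit)
  have 3: "uniform_limit K (\<lambda>\<delta> x0. enn2real (V \<delta> x0)) (\<lambda>x0. enn2real (V 0 x0)) (at_right 0)" if "K \<subseteq> D0" for K
    using vs.value_uniform_limit that unfolding V_def D0_def by (rule uniform_limit_on_subset)
  have 4: "locally_lipschitz_on D0 (\<lambda>x0. enn2real (V \<delta> x0))" if "\<delta> \<in> {0<..r}" "petrov_condition U f \<delta>" for \<delta>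
    unfolding V_def D0_def using that by (intro vs.value_locally_lipschitz) simp_all
  \<comment> \<open>Outside \<open>D0\<close> the real-valued function takes the default value 0 in
    place of infinity; since \<open>D0\<close> is open, those points do not affect derivatives at
    points of \<open>D0\<close>.\<close>
  have "open D0" unfolding D0_def by (rule vs.open_D0)
  then have "AE x0 in lebesgue. x0 \<in> D0 \<longrightarrow> (\<lambda>y. enn2real (V \<delta> y)) differentiable (at x0)"
    if "\<delta> \<in> {0<..r}" "petrov_condition U f \<delta>" for \<delta>
    by (rule locally_lipschitz_on_differentiable_AE[OF _ 4[OF that]])
  with 1 2 3 4 show ?thesis by blast
qed

end
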